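(* Let $\psi:(M,L_M)\to(N,L_N)$ be a surjective submersion between Dirac manifolds that is a forward Dirac map. Suppose that $r_M\in\Omega^1(M,TM)$ is $\psi$-related to $r_N\in\Omega^1(N,TN)$. Then $L_N$ is compatible with $r_N$ provided $L_M$ is compatible with $r_M$.
   Context: $\mathbb{T}M=TM\oplus T^*M$ carries the pairing $\langle(X,\alpha),(Y,\beta)\rangle=\beta(X)+\alpha(Y)$ and the Courant-Dorfman bracket $[\![(X,\alpha),(Y,\beta)]\!]=([X,Y],\mathcal{L}_X\beta-i_Yd\alpha)$. A Dirac structure is a subbundle $L\subset\mathbb{T}M$ with $L=L^\perp$ whose sections are closed under the bracket; $(M,L)$ is then a Dirac manifold. For $r\in\Omega^1(M,TM)$, viewed as $r:TM\to TM$ with dual $r^*$, set $D^r_X(Y)=[Y,r(X)]-r([Y,X])$, $D^{r,*}_X(\alpha)=\mathcal{L}_X(r^*\alpha)-\mathcal{L}_{r(X)}\alpha$, $\mathbb{D}^r_X(Y,\alpha)=(D^r_X(Y),D^{r,*}_X(\alpha))$. $L$ and $r$ are compatible if $(r,r^* )(L)\subseteq L$ and $\mathbb{D}^r_X(\Gamma(L))\subseteq\Gamma(L)$ for all $X\in\mathfrak{X}(M)$. A smooth map $\psi:(M,L_M)\to(N,L_N)$ is a forward Dirac map if for all $x\in M$, $(L_N)_{\psi(x)}=\{(T_x\psi(X),\beta)\in\mathbb{T}_{\psi(x)}N: (X,(T_x\psi)^*\beta)\in(L_M)_x\}$. $r_M$ is $\psi$-related to $r_N$ if $r_N\circ d\psi=d\psi\circ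 r_M$. *)

theory Defs
  imports "HOL-Analysis.Analysis"
begin

section \<open>Smooth maps between open subsets of normed spaces\<close>

text \<open>The Frechet derivative, packaged as a bounded linear map.\<close>

definition fderiv ::
  "('e::real_normed_vector \<Rightarrow> 'f::real_normed_vector) \<Rightarrow> 'e \<Rightarrow> ('e \<Rightarrow>\<^sub>L 'f)" where
  "fderiv f x = Blinfun (frechet_derivative f (at x))"

text \<open>
  All directional derivatives up to order \<open>k\<close> exist and are continuous. This is
  used only for open \<open>S\<close> in a finite-dimensional space, where it is the usual class \<open>C^k\<close>.
\<close>

fun Ck_on :: "'e::real_normed_vector set \<Rightarrow> nat \<Rightarrow> ('e \<Rightarrow> 'f::real_normed_vector) \<Rightarrow> bool" where
  "Ck_on S 0 f \<longleftrightarrow> continuous_on S f"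
| "Ck_on S (Suc k) f \<longleftrightarrow>
     (\<forall>x\<in>S. f differentiable (at x)) \<and>
     (\<forall>v. Ck_on S k (\<lambda>x. frechet_derivative f (at x) v))"

definition smooth_on :: "'e::real_normed_vector set \<Rightarrow> ('e \<Rightarrow> 'f::real_normed_vector) \<Rightarrow> bool" where
  "smooth_on S f \<longleftrightarrow> (\<forall>k. Ck_on S k f)"

section \<open>Smooth manifolds\<close>

text \<open>
  The underlying set of a manifold is a whole type \<open>'a\<close>. The model space \<open>'e\<close> is a
  finite-dimensional inner product space (finiteness of the dimension is part of
  \<open>smooth_manifold\<close>); class \<open>euclidean_space\<close> is avoided because it would
  exclude dimension 0. A chart consists of its domain and its coordinate map, whose values
  off the domain are irrelevant.
\<close>

type_synonym ('a, 'e) chart = "'a set \<times> ('a \<Rightarrow> 'e)"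

abbreviation cdom :: "('a, 'e) chart \<Rightarrow> 'a set" where "cdom \<equiv> fst"

abbreviation cmap :: "('a, 'e) chart \<Rightarrow> 'a \<Rightarrow> 'e" where "cmap \<equiv> snd"

definition cinv :: "('a, 'e) chart \<Rightarrow> 'e \<Rightarrow> 'a" where
  "cinv c = inv_into (cdom c) (cmap c)"

definition is_chart :: "('a::topological_space, 'e::real_normed_vector) chart \<Rightarrow> bool" where
  "is_chart c \<longleftrightarrow>
     open (cdom c) \<and> open (cmap c ` cdom c) \<and>
     homeomorphism (cdom c) (cmap c ` cdom c) (cmap c) (cinv c)"

definition smooth_manifold ::
  "('a::{t2_space, second_countable_topology}, 'e::real_inner) chart set \<Rightarrow> bool" where
  "smooth_manifold A \<longleftrightarrow>
     (\<exists>b::'e set. finite b \<and> span b = UNIV) \<and>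
     (\<forall>c\<in>A. is_chart c) \<and>
     (\<Union>c\<in>A. cdom c) = UNIV \<and>
     (\<forall>c\<in>A. \<forall>c'\<in>A. smooth_on (cmap c ` (cdom c \<inter> cdom c')) (cmap c' \<circ> cinv c))"

text \<open>
  A preferred chart around each point. The tangent space \<open>T\<^sub>pM\<close> is represented by the model
  space \<open>'e\<close>: a tangent vector at \<open>p\<close> is given by its components in the chart
  \<open>chart_at A p\<close>. Accordingly \<open>T\<^sub>p\<^sup>*M\<close> is \<open>'e \<Rightarrow>\<^sub>L real\<close> and \<open>End(T\<^sub>pM)\<close> is
  \<open>'e \<Rightarrow>\<^sub>L 'e\<close>. The preferred chart need not vary continuously with \<open>p\<close>, so
  smoothness and derivatives are always expressed through the representation in a fixed chart.
\<close>

definition chart_at :: "('a, 'e) chart set \<Rightarrow> 'a \<Rightarrow> ('a, 'e) chart" where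
  "chart_at A p = (SOME c. c \<in> A \<and> p \<in> cdom c)"

definition smooth_map ::
  "('a::topological_space, 'e::real_normed_vector) chart set \<Rightarrow>
   ('b::topological_space, 'f::real_normed_vector) chart set \<Rightarrow> ('a \<Rightarrow> 'b) \<Rightarrow> bool" where
  "smooth_map A B \<psi> \<longleftrightarrow>
     continuous_on UNIV \<psi> \<and>
     (\<forall>c\<in>A. \<forall>d\<in>B. smooth_on (cmap c ` (cdom c \<inter> \<psi> -` cdom d)) (cmap d \<circ> \<psi> \<circ> cinv c))"

definition tangent_map ::
  "('a, 'e::real_normed_vector) chart set \<Rightarrow> ('b, 'f::real_normed_vector) chart set \<Rightarrow>
   ('a \<Rightarrow> 'b) \<Rightarrow> 'a \<Rightarrow> ('e \<Rightarrow>\<^sub>L 'f)" where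
  "tangent_map A B \<psi> p =
     fderiv (cmap (chart_at B (\<psi> p)) \<circ> \<psi> \<circ> cinv (chart_at A p)) (cmap (chart_at A p) p)"

text \<open>
  The differential of the coordinate map of \<open>c\<close> at \<open>p\<close>, as a map from \<open>T\<^sub>pM\<close> to
  the model space, and its inverse.
\<close>

definition dchart ::
  "('a, 'e::real_normed_vector) chart set \<Rightarrow> ('a, 'e) chart \<Rightarrow> 'a \<Rightarrow> ('e \<Rightarrow>\<^sub>L 'e)" where
  "dchart A c p = fderiv (cmap c \<circ> cinv (chart_at A p)) (cmap (chart_at A p) p)"

definition dchart_inv ::
  "('a, 'e::real_normed_vector) chart set \<Rightarrow> ('a, 'e) chart \<Rightarrow> 'a \<Rightarrow> ('e \<Rightarrow>\<^sub>L 'e)" where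
  "dchart_inv A c p = fderiv (cmap (chart_at A p) \<circ> cinv c) (cmap c p)"

section \<open>Vector fields, one-forms and vector-valued one-forms\<close>

type_synonym ('a, 'e) vfield = "'a \<Rightarrow> 'e"
type_synonym ('a, 'e) oneform = "'a \<Rightarrow> ('e \<Rightarrow>\<^sub>L real)"
type_synonym ('a, 'e) endofield = "'a \<Rightarrow> ('e \<Rightarrow>\<^sub>L 'e)"

text \<open>Local representations on the open set \<open>cmap c ` cdom c\<close> of the model space.\<close>

definition vrep ::
  "('a, 'e::real_normed_vector) chart set \<Rightarrow> ('a, 'e) chart \<Rightarrow> ('a, 'e) vfield \<Rightarrow> 'e \<Rightarrow> 'e" where
  "vrep A c X u = dchart A c (cinv c u) (X (cinv c u))"

definition crep ::
  "('a, 'e::real_normed_vector) chart set \<Rightarrow> ('a, 'e) chart \<Rightarrow> ('a, 'e) oneform \<Rightarrow>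
   'e \<Rightarrow> ('e \<Rightarrow>\<^sub>L real)" where
  "crep A c \<alpha> u = \<alpha> (cinv c u) o\<^sub>L dchart_inv A c (cinv c u)"

definition erep ::
  "('a, 'e::real_normed_vector) chart set \<Rightarrow> ('a, 'e) chart \<Rightarrow> ('a, 'e) endofield \<Rightarrow>
   'e \<Rightarrow> ('e \<Rightarrow>\<^sub>L 'e)" where
  "erep A c r u = dchart A c (cinv c u) o\<^sub>L r (cinv c u) o\<^sub>L dchart_inv A c (cinv c u)"

text \<open>Smoothness over an open subset \<open>U\<close> of the manifold.\<close>

definition smooth_vfield_on ::
  "('a, 'e::real_normed_vector) chart set \<Rightarrow> 'a set \<Rightarrow> ('a, 'e) vfield \<Rightarrow> bool" where
  "smooth_vfield_on A U X \<longleftrightarrow> (\<forall>c\<in>A. smooth_on (cmap c ` (cdom c \<inter> U)) (vrep A c X))"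

definition smooth_oneform_on ::
  "('a, 'e::real_normed_vector) chart set \<Rightarrow> 'a set \<Rightarrow> ('a, 'e) oneform \<Rightarrow> bool" where
  "smooth_oneform_on A U \<alpha> \<longleftrightarrow> (\<forall>c\<in>A. smooth_on (cmap c ` (cdom c \<inter> U)) (crep A c \<alpha>))"

definition smooth_endofield ::
  "('a, 'e::real_normed_vector) chart set \<Rightarrow> ('a, 'e) endofield \<Rightarrow> bool" where
  "smooth_endofield A r \<longleftrightarrow> (\<forall>c\<in>A. smooth_on (cmap c ` cdom c) (erep A c r))"

text \<open>
  The operations of the Cartan calculus at \<open>p\<close> are given by the local coordinate formulas in
  the chart \<open>chart_at A p\<close>, in which the components of tangent vectors at \<open>p\<close> are taken:
  \<open>[X,Y]\<^sup>i = X\<^sup>j \<partial>\<^sub>j Y\<^sup>i - Y\<^sup>j \<partial>\<^sub>j X\<^sup>i\<close>,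
  \<open>(L\<^sub>X \<alpha>)\<^sub>i = X\<^sup>j \<partial>\<^sub>j \<alpha>\<^sub>i + \<alpha>\<^sub>j \<partial>\<^sub>i X\<^sup>j\<close>, and
  \<open>(i\<^sub>Y d\<alpha>)\<^sub>i = Y\<^sup>j (\<partial>\<^sub>j \<alpha>\<^sub>i - \<partial>\<^sub>i \<alpha>\<^sub>j)\<close>.
\<close>

definition lie_bracket ::
  "('a, 'e::real_normed_vector) chart set \<Rightarrow> ('a, 'e) vfield \<Rightarrow> ('a, 'e) vfield \<Rightarrow>
   ('a, 'e) vfield" where
  "lie_bracket A X Y p =
     (let c = chart_at A p; u = cmap c p
      in fderiv (vrep A c Y) u (vrep A c X u) - fderiv (vrep A c X) u (vrep A c Y u))"

definition lie_deriv ::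
  "('a, 'e::real_normed_vector) chart set \<Rightarrow> ('a, 'e) vfield \<Rightarrow> ('a, 'e) oneform \<Rightarrow>
   ('a, 'e) oneform" where
  "lie_deriv A X \<alpha> p =
     (let c = chart_at A p; u = cmap c p
      in fderiv (crep A c \<alpha>) u (vrep A c X u) + (crep A c \<alpha> u o\<^sub>L fderiv (vrep A c X) u))"

definition ext_deriv ::
  "('a, 'e::real_normed_vector) chart set \<Rightarrow> ('a, 'e) oneform \<Rightarrow> 'a \<Rightarrow> 'e \<Rightarrow> 'e \<Rightarrow> real" where
  "ext_deriv A \<alpha> p v w =
     (let c = chart_at A p; u = cmap c p
      in fderiv (crep A c \<alpha>) u v w - fderiv (crep A c \<alpha>) u w v)"

definition contract_ext_deriv ::
  "('a, 'e::real_normed_vector) chart set \<Rightarrow> ('a, 'e) vfield \<Rightarrow> ('a, 'e) oneform \<Rightarrow>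
   ('a, 'e) oneform" where
  "contract_ext_deriv A Y \<alpha> p = Blinfun (ext_deriv A \<alpha> p (Y p))"

section \<open>Dirac structures\<close>

text \<open>The fibre of \<open>TM \<oplus> T\<^sup>*M\<close> at any point is \<open>'e \<times> ('e \<Rightarrow>\<^sub>L real)\<close>.\<close>

type_synonym ('a, 'e) gen_section = "('a, 'e) vfield \<times> ('a, 'e) oneform"
type_synonym ('a, 'e) gen_distribution = "'a \<Rightarrow> ('e \<times> ('e \<Rightarrow>\<^sub>L real)) set"

definition pairing ::
  "'e::real_normed_vector \<times> ('e \<Rightarrow>\<^sub>L real) \<Rightarrow> 'e \<times> ('e \<Rightarrow>\<^sub>L real) \<Rightarrow> real" where
  "pairing a b = snd b (fst a) + snd a (fst b)"

definition orth ::
  "('e::real_normed_vector \<times> ('e \<Rightarrow>\<^sub>L real)) set \<Rightarrow> ('e \<times> ('e \<Rightarrow>\<^sub>L real)) set" where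
  "orth V = {a. \<forall>b\<in>V. pairing a b = 0}"

definition courant_bracket ::
  "('a, 'e::real_normed_vector) chart set \<Rightarrow> ('a, 'e) gen_section \<Rightarrow> ('a, 'e) gen_section \<Rightarrow>
   ('a, 'e) gen_section" where
  "courant_bracket A = (\<lambda>(X, \<alpha>) (Y, \<beta>).
     (lie_bracket A X Y, \<lambda>p. lie_deriv A X \<beta> p - contract_ext_deriv A Y \<alpha> p))"

definition smooth_gen_section_on ::
  "('a, 'e::real_normed_vector) chart set \<Rightarrow> 'a set \<Rightarrow> ('a, 'e) gen_section \<Rightarrow> bool" where
  "smooth_gen_section_on A U = (\<lambda>(X, \<alpha>). smooth_vfield_on A U X \<and> smooth_oneform_on A U \<alpha>)"

abbreviation at_point :: "('a, 'e::real_normed_vector) gen_section \<Rightarrow> 'a \<Rightarrow> 'e \<times> ('e \<Rightarrow>\<^sub>L real)" where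
  "at_point \<sigma> p \<equiv> (fst \<sigma> p, snd \<sigma> p)"

text \<open>A smooth subbundle of some constant rank \<open>k\<close>: it has smooth local frames.\<close>

definition subbundle ::
  "('a::topological_space, 'e::real_normed_vector) chart set \<Rightarrow> ('a, 'e) gen_distribution \<Rightarrow> bool" where
  "subbundle A L \<longleftrightarrow>
     (\<exists>k::nat. \<forall>p. \<exists>U \<sigma>. open U \<and> p \<in> U \<and>
        (\<forall>i<k. smooth_gen_section_on A U (\<sigma> i)) \<and>
        (\<forall>q\<in>U. inj_on (\<lambda>i. at_point (\<sigma> i) q) {..<k} \<and>
                independent ((\<lambda>i. at_point (\<sigma> i) q) ` {..<k}) \<and>
                span ((\<lambda>i. at_point (\<sigma> i) q) ` {..<k}) = L q))"

definition sections ::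
  "('a, 'e::real_normed_vector) chart set \<Rightarrow> ('a, 'e) gen_distribution \<Rightarrow> ('a, 'e) gen_section set" where
  "sections A L = {\<sigma>. smooth_gen_section_on A UNIV \<sigma> \<and> (\<forall>p. at_point \<sigma> p \<in> L p)}"

definition dirac_structure ::
  "('a::topological_space, 'e::real_normed_vector) chart set \<Rightarrow> ('a, 'e) gen_distribution \<Rightarrow> bool" where
  "dirac_structure A L \<longleftrightarrow>
     subbundle A L \<and>
     (\<forall>p. L p = orth (L p)) \<and>
     (\<forall>\<sigma>\<in>sections A L. \<forall>\<tau>\<in>sections A L. courant_bracket A \<sigma> \<tau> \<in> sections A L)"

definition dirac_manifold ::
  "('a::{t2_space, second_countable_topology}, 'e::real_inner) chart set \<Rightarrow>
   ('a, 'e) gen_distribution \<Rightarrow> bool" where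
  "dirac_manifold A L \<longleftrightarrow> smooth_manifold A \<and> dirac_structure A L"

definition forward_dirac_map ::
  "('a::topological_space, 'e::real_normed_vector) chart set \<Rightarrow> ('a, 'e) gen_distribution \<Rightarrow>
   ('b::topological_space, 'f::real_normed_vector) chart set \<Rightarrow> ('b, 'f) gen_distribution \<Rightarrow>
   ('a \<Rightarrow> 'b) \<Rightarrow> bool" where
  "forward_dirac_map A L\<^sub>M B L\<^sub>N \<psi> \<longleftrightarrow>
     smooth_map A B \<psi> \<and>
     (\<forall>x. L\<^sub>N (\<psi> x) =
        {(tangent_map A B \<psi> x v, \<beta>) | v \<beta>. (v, \<beta> o\<^sub>L tangent_map A B \<psi> x) \<in> L\<^sub>M x})"

definition surjective_submersion ::
  "('a::topological_space, 'e::real_normed_vector) chart set \<Rightarrow>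
   ('b::topological_space, 'f::real_normed_vector) chart set \<Rightarrow> ('a \<Rightarrow> 'b) \<Rightarrow> bool" where
  "surjective_submersion A B \<psi> \<longleftrightarrow>
     smooth_map A B \<psi> \<and> surj \<psi> \<and> (\<forall>x. surj (blinfun_apply (tangent_map A B \<psi> x)))"

section \<open>Compatibility with a vector-valued one-form\<close>

definition app :: "('a, 'e::real_normed_vector) endofield \<Rightarrow> ('a, 'e) vfield \<Rightarrow> ('a, 'e) vfield" where
  "app r X p = r p (X p)"

definition app_dual ::
  "('a, 'e::real_normed_vector) endofield \<Rightarrow> ('a, 'e) oneform \<Rightarrow> ('a, 'e) oneform" where
  "app_dual r \<alpha> p = \<alpha> p o\<^sub>L r p"

definition D_vec ::
  "('a, 'e::real_normed_vector) chart set \<Rightarrow> ('a, 'e) endofield \<Rightarrow> ('a, 'e) vfield \<Rightarrow>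
   ('a, 'e) vfield \<Rightarrow> ('a, 'e) vfield" where
  "D_vec A r X Y p = lie_bracket A Y (app r X) p - app r (lie_bracket A Y X) p"

definition D_dual ::
  "('a, 'e::real_normed_vector) chart set \<Rightarrow> ('a, 'e) endofield \<Rightarrow> ('a, 'e) vfield \<Rightarrow>
   ('a, 'e) oneform \<Rightarrow> ('a, 'e) oneform" where
  "D_dual A r X \<alpha> p = lie_deriv A X (app_dual r \<alpha>) p - lie_deriv A (app r X) \<alpha> p"

definition D_gen ::
  "('a, 'e::real_normed_vector) chart set \<Rightarrow> ('a, 'e) endofield \<Rightarrow> ('a, 'e) vfield \<Rightarrow>
   ('a, 'e) gen_section \<Rightarrow> ('a, 'e) gen_section" where
  "D_gen A r X = (\<lambda>(Y, \<alpha>). (D_vec A r X Y, D_dual A r X \<alpha>))"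

definition compatible ::
  "('a, 'e::real_normed_vector) chart set \<Rightarrow> ('a, 'e) gen_distribution \<Rightarrow>
   ('a, 'e) endofield \<Rightarrow> bool" where
  "compatible A L r \<longleftrightarrow>
     (\<forall>p. (\<lambda>(v, \<alpha>). (r p v, \<alpha> o\<^sub>L r p)) ` L p \<subseteq> L p) \<and>
     (\<forall>X. smooth_vfield_on A UNIV X \<longrightarrow> D_gen A r X ` sections A L \<subseteq> sections A L)"

definition related_by ::
  "('a, 'e::real_normed_vector) chart set \<Rightarrow> ('b, 'f::real_normed_vector) chart set \<Rightarrow>
   ('a \<Rightarrow> 'b) \<Rightarrow> ('a, 'e) endofield \<Rightarrow> ('b, 'f) endofield \<Rightarrow> bool" where
  "related_by A B \<psi> r\<^sub>M r\<^sub>N \<longleftrightarrow>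
     (\<forall>x. r\<^sub>N (\<psi> x) o\<^sub>L tangent_map A B \<psi> x = tangent_map A B \<psi> x o\<^sub>L r\<^sub>M x)"

end

theory Submission
  imports Defs
begin

text \<open>
  In a chart, the terms of \<open>\<bbbD>\<^sup>r\<^sub>X(Y, \<alpha>)\<close> containing derivatives of \<open>X\<close> cancel. So its value at a point depends
  only on \<open>X\<close> at that point and on the first derivatives of \<open>(Y, \<alpha>)\<close>; it satisfies a Leibniz rule in
  \<open>(Y, \<alpha>)\<close>, and it is natural under smooth maps that relate the data, because the second derivative of
  the map is symmetric. Hence, if a section \<open>(Y, \<beta>)\<close> of \<open>L\<^sub>N\<close> lifts near \<open>x\<close> to a combination of
  sections of \<open>L\<^sub>M\<close> whose coefficients are differentiable at \<open>x\<close>, the compatibility of \<open>L\<^sub>M\<close> yields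
  \<open>\<bbbD>\<^sup>r\<^sub>X(Y, \<beta>) \<in> L\<^sub>N\<close> at \<open>\<psi> x\<close>.

  Such a lift need not exist at every point: the rank of \<open>ker T\<psi> \<inter> L\<^sub>M\<close> may jump. It does exist wherever
  the rank of the linear system for the coefficients is locally maximal, and every nonempty open subset of
  \<open>M\<close> contains such a point. Their images are dense in \<open>N\<close>, and \<open>L\<^sub>N = L\<^sub>N\<^sup>\<bottom>\<close> is a closed condition.
\<close>

section \<open>Finite-dimensional inner product spaces\<close>

text \<open>\<open>compatible\<close> quantifies over global sections and global fields, while
  frames of L_M are local and the lift of (Y, \<beta>) has coefficients that are differentiable at
  one point only. The lift is thus not a section to which the hypothesis on L_M applies. The Leibniz
  rule gets around this: the operator applied to \<Sum> g_i \<sigma>_i consists of multiples of its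
  values on the \<sigma>_i, of the \<sigma>_i, and of their images under r and its dual. The first
  lie in L_M by the second condition of compatibility, the last by the first condition, and only
  first derivatives of the g_i at that point enter. The rank enters because the g_i solve \<Sum> g_i
  (T\<psi>(y_i), a_i) = (Y o \<psi>, pullback of \<beta>) for \<sigma>_i = (y_i, a_i). The forward
  Dirac property makes this solvable at each point, but an element of ker T\<psi> in L_M is a
  relation among the columns, and where their rank drops there may be no continuous choice of
  solution. As X matters only through its value, it is lifted by a field on M through one preimage
  of X(\<psi> x).\<close>

text \<open>
  Finite Parseval families stand in for \<open>Basis\<close>, since the model spaces are not of class
  \<open>euclidean_space\<close>.
\<close>

definition parseval_on :: "'e::real_inner set \<Rightarrow> 'e set \<Rightarrow> bool" where
  "parseval_on V b \<longleftrightarrow> finite b \<and> b \<subseteq> V \<and> (\<forall>x\<in>V. x = (\<Sum>e\<in>b. (x \<bullet> e) *\<^sub>R e))"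

text \<open>\<open>parseval_on\<close> does not demand orthonormality. Orthogonality of the residual
  to V comes from expanding y instead: the coefficients of a and of y enter the two sums
  symmetrically.\<close>

lemma parseval_on_residual:
  assumes "parseval_on V b" and "y \<in> V"
  shows "(a - (\<Sum>e\<in>b. (a \<bullet> e) *\<^sub>R e)) \<bullet> y = 0"
proof -
  have "a \<bullet> y = a \<bullet> (\<Sum>e\<in>b. (y \<bullet> e) *\<^sub>R e)"
    using assms by (metis parseval_on_def)
  then show ?thesis
    by (simp add: inner_diff_left inner_sum_left inner_sum_right inner_commute[of y] mult.commute)
qed

text \<open>Gram-Schmidt: the residual of the new vector is normalised and adjoined, or nothing is
  adjoined if it vanishes.\<close>

lemma parseval_on_span_exists:
  assumes "finite S"
  shows "\<exists>b. parseval_on (span S) b"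
  using assms
proof (induction S)
  case empty
  then show ?case by (intro exI[of _ "{}"]) (simp add: parseval_on_def)
next
  case (insert a S)
  then obtain b where b: "parseval_on (span S) b" by blast
  define r where "r = a - (\<Sum>e\<in>b. (a \<bullet> e) *\<^sub>R e)"
  have proj: "(\<Sum>e\<in>b. (a \<bullet> e) *\<^sub>R e) \<in> span S"
    using b by (auto simp: parseval_on_def intro!: span_sum span_scale)
  have orth: "r \<bullet> y = 0" if "y \<in> span S" for y
    unfolding r_def using parseval_on_residual[OF b that] .
  have sub: "span S \<subseteq> span (insert a S)" by (simp add: span_mono subset_insertI)
  have dec: "\<exists>k. x - k *\<^sub>R r \<in> span S" if x: "x \<in> span (insert a S)" for x
  proof -
    from x obtain k where "x - k *\<^sub>R a \<in> span S" using span_breakdown_eq by blast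
    then have "x - k *\<^sub>R a + k *\<^sub>R (\<Sum>e\<in>b. (a \<bullet> e) *\<^sub>R e) \<in> span S"
      using proj span_add span_scale by blast
    then show ?thesis unfolding r_def by (intro exI[of _ k]) (simp add: algebra_simps)
  qed
  show ?case
  proof (cases "r = 0")
    case True
    then have "span (insert a S) = span S" using dec sub by auto
    then show ?thesis using b by auto
  next
    case False
    define n where "n = (1 / norm r) *\<^sub>R r"
    have nn: "n \<bullet> n = 1" using False
      by (simp add: n_def power2_norm_eq_inner[symmetric] power2_eq_square)
    have no: "n \<bullet> y = 0" if "y \<in> span S" for y using orth[OF that] by (simp add: n_def)
    have rn: "r = norm r *\<^sub>R n" using False by (simp add: n_def)
    have nb: "n \<notin> b" using nn no b by (auto simp: parseval_on_def)
    have "parseval_on (span (insert a S)) (insert n b)"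
      unfolding parseval_on_def
    proof (intro conjI ballI)
      show "finite (insert n b)" using b by (simp add: parseval_on_def)
      have "a \<in> span (insert a S)" by (simp add: span_base)
      then have "n \<in> span (insert a S)"
        unfolding n_def r_def using sub proj by (auto intro!: span_scale span_diff)
      then show "insert n b \<subseteq> span (insert a S)" using b sub by (auto simp: parseval_on_def)
      fix x assume "x \<in> span (insert a S)"
      then obtain k where "x - k *\<^sub>R r \<in> span S" using dec by blast
      then obtain y where y: "y \<in> span S" "x = (k * norm r) *\<^sub>R n + y"
        using rn by (metis add.commute diff_add_cancel scaleR_scaleR)
      have "(\<Sum>e\<in>b. (x \<bullet> e) *\<^sub>R e) = (\<Sum>e\<in>b. (y \<bullet> e) *\<^sub>R e)"
        using b no by (intro sum.cong) (auto simp: y(2) inner_add_left parseval_on_def subset_iff)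
      also have "\<dots> = y" using b y(1) by (simp add: parseval_on_def)
      finally show "x = (\<Sum>e\<in>insert n b. (x \<bullet> e) *\<^sub>R e)"
        using b nb nn no[OF y(1)]
        by (simp add: parseval_on_def y(2) inner_add_left inner_commute[of y n])
    qed
    then show ?thesis by blast
  qed
qed

abbreviation parseval :: "'e::real_inner set \<Rightarrow> bool" where
  "parseval b \<equiv> parseval_on UNIV b"

lemma parseval_finite: "parseval b \<Longrightarrow> finite b"
  by (simp add: parseval_on_def)

lemma parseval_expand: "parseval b \<Longrightarrow> (\<Sum>e\<in>b. (x \<bullet> e) *\<^sub>R e) = x"
  by (simp add: parseval_on_def)

lemma parseval_real: "parseval {1::real}"
  by (simp add: parseval_on_def)

lemma parseval_linear_expand:
  fixes f :: "'e::real_inner \<Rightarrow> 'g::real_vector" and b :: "'e set"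
  assumes "parseval b" and "linear f"
  shows "f x = (\<Sum>e\<in>b. (x \<bullet> e) *\<^sub>R f e)"
  by (metis (no_types, lifting) assms linear_scale linear_sum parseval_expand sum.cong)

text \<open>The vector that represents a covector.
  \<open>generic_differentiable_coefficients\<close> takes dual vectors with respect to an inner
  product, and covectors carry only the operator norm, so they are moved into the model
  space.\<close>

definition riesz :: "'e::real_inner set \<Rightarrow> ('e \<Rightarrow>\<^sub>L real) \<Rightarrow> 'e" where
  "riesz b \<alpha> = (\<Sum>e\<in>b. \<alpha> e *\<^sub>R e)"

lemma bounded_linear_riesz: "bounded_linear (riesz b)"
  unfolding riesz_def[abs_def]
  by (intro bounded_linear_sum bounded_linear_scaleR_const blinfun.bounded_linear_left)

lemma riesz_inner:
  assumes "parseval b"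
  shows "riesz b \<alpha> \<bullet> x = \<alpha> x"
  using parseval_linear_expand[OF assms bounded_linear.linear[OF blinfun.bounded_linear_right], of \<alpha> x]
  by (simp add: riesz_def inner_sum_left inner_commute[of x] mult.commute)

lemma riesz_inject: "parseval b \<Longrightarrow> riesz b \<alpha> = riesz b \<beta> \<Longrightarrow> \<alpha> = \<beta>"
  by (intro blinfun_eqI) (metis riesz_inner)

section \<open>Calculus of smooth maps\<close>

lemma has_derivative_fderiv:
  assumes "f differentiable (at x)"
  shows "(f has_derivative blinfun_apply (fderiv f x)) (at x)"
proof -
  have "(f has_derivative frechet_derivative f (at x)) (at x)"
    using assms by (rule frechet_derivative_works[THEN iffD1])
  then show ?thesis
    unfolding fderiv_def by (simp add: bounded_linear_Blinfun_apply has_derivative_bounded_linear)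
qed

lemma fderiv_apply:
  assumes "(f has_derivative D) (at x)"
  shows "blinfun_apply (fderiv f x) = D"
  using assms has_derivative_fderiv[of f x] has_derivative_unique differentiable_def by blast

lemma fderiv_eqI:
  assumes "(f has_derivative blinfun_apply D) (at x)"
  shows "fderiv f x = D"
  using fderiv_apply[OF assms] by (simp add: blinfun_apply_inject)

lemma fderiv_frechet:
  assumes "f differentiable (at x)"
  shows "frechet_derivative f (at x) = blinfun_apply (fderiv f x)"
  by (rule frechet_derivative_at[OF has_derivative_fderiv[OF assms], symmetric])

section \<open>Closure properties of the classes C^k\<close>

lemma Ck_on_cong:
  assumes "open S" "Ck_on S k f" "\<And>x. x \<in> S \<Longrightarrow> f x = g x"
  shows "Ck_on S k g"
  using assms(2,3)
proof (induction k arbitrary: f g)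
  case 0
  then show ?case by (simp cong: continuous_on_cong)
next
  case (Suc k)
  have d: "f differentiable (at x)" "g differentiable (at x)"
    "frechet_derivative f (at x) = frechet_derivative g (at x)" if "x \<in> S" for x
  proof -
    show f: "f differentiable (at x)" using Suc.prems that by simp
    then have "(g has_derivative frechet_derivative f (at x)) (at x)"
      using Suc.prems(2)
      by (intro has_derivative_transform_within_open[OF frechet_derivative_works[THEN iffD1, OF f] assms(1) that])
    then show "g differentiable (at x)" "frechet_derivative f (at x) = frechet_derivative g (at x)"
      by (rule differentiableI, rule frechet_derivative_at)
  qed
  have "Ck_on S k (\<lambda>x. frechet_derivative g (at x) v)" for v
    by (rule Suc.IH[of "\<lambda>x. frechet_derivative f (at x) v"]) (use Suc.prems(1) d(3) in simp_all)
  then show ?case using d(2) by simp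
qed

lemma Ck_on_subset:
  assumes "T \<subseteq> S" "Ck_on S k f"
  shows "Ck_on T k f"
  using assms(2)
proof (induction k arbitrary: f)
  case 0
  then show ?case using assms(1) continuous_on_subset by auto
next
  case (Suc k)
  then show ?case using assms(1) by auto
qed

lemma Ck_on_local:
  assumes "open S" "\<And>x. x \<in> S \<Longrightarrow> \<exists>T. open T \<and> x \<in> T \<and> Ck_on T k f"
  shows "Ck_on S k f"
  using assms(2)
proof (induction k arbitrary: f)
  case 0
  have "continuous (at x) f" if "x \<in> S" for x
    using 0[OF that] continuous_on_eq_continuous_at by (auto simp del: continuous_on_open_vimage)
  then show ?case using assms(1) by (simp add: continuous_on_eq_continuous_at)
next
  case (Suc k)
  have "Ck_on S k (\<lambda>x. frechet_derivative f (at x) v)" for v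
  proof (rule Suc.IH)
    fix x assume "x \<in> S"
    from Suc.prems[OF this] obtain T where T: "open T" "x \<in> T" "Ck_on T (Suc k) f" by blast
    then show "\<exists>T. open T \<and> x \<in> T \<and> Ck_on T k (\<lambda>x. frechet_derivative f (at x) v)"
      by (intro exI[of _ T]) simp
  qed
  moreover have "f differentiable (at x)" if x: "x \<in> S" for x
  proof -
    from Suc.prems[OF x] obtain T where T: "open T" "x \<in> T" "Ck_on T (Suc k) f" by blast
    then show ?thesis by simp
  qed
  ultimately show ?case by simp
qed

lemma Ck_on_Suc_imp_continuous:
  "Ck_on S (Suc k) f \<Longrightarrow> continuous_on S f"
  by (simp add: continuous_at_imp_continuous_on differentiable_imp_continuous_within)

lemma Ck_on_pred:
  assumes "Ck_on S (Suc k) f"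
  shows "Ck_on S k f"
  using assms
proof (induction k arbitrary: f)
  case 0
  then show ?case using Ck_on_Suc_imp_continuous by (simp del: Ck_on.simps(2))
next
  case (Suc k)
  from Suc.prems have d: "\<forall>x\<in>S. f differentiable (at x)"
    using Ck_on.simps(2)[of S "Suc k" f] by blast
  from Suc.prems have p: "Ck_on S (Suc k) (\<lambda>x. frechet_derivative f (at x) v)" for v
    using Ck_on.simps(2)[of S "Suc k" f] by blast
  show ?case
    unfolding Ck_on.simps(2)[of S k f] using d Suc.IH[OF p] by blast
qed

lemma Ck_on_const: "Ck_on S k (\<lambda>x. c)"
  by (induction k arbitrary: c) (auto simp: frechet_derivative_const)

text \<open>Lets the inductions below supply the formula of a product or chain rule in place of
  \<open>frechet_derivative\<close>; the two agree on the open set S, which suffices by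
  \<open>Ck_on_cong\<close>.\<close>

lemma Ck_on_SucI:
  assumes "open S" "\<And>x. x \<in> S \<Longrightarrow> (f has_derivative f' x) (at x)"
    and "\<And>v. Ck_on S k (\<lambda>x. f' x v)"
  shows "Ck_on S (Suc k) f"
proof -
  have eq: "frechet_derivative f (at x) = f' x" if "x \<in> S" for x
    by (rule frechet_derivative_at[OF assms(2)[OF that], symmetric])
  have "Ck_on S k (\<lambda>x. frechet_derivative f (at x) v)" for v
    by (rule Ck_on_cong[OF assms(1) assms(3)[of v]]) (simp add: eq)
  moreover have "f differentiable (at x)" if "x \<in> S" for x
    using assms(2)[OF that] by (rule differentiableI)
  ultimately show ?thesis by simp
qed

lemma Ck_on_SucD:
  assumes "Ck_on S (Suc k) f"
  shows "x \<in> S \<Longrightarrow> (f has_derivative frechet_derivative f (at x)) (at x)"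
    and "Ck_on S k (\<lambda>x. frechet_derivative f (at x) v)"
proof -
  show "(f has_derivative frechet_derivative f (at x)) (at x)" if "x \<in> S"
  proof -
    have "f differentiable (at x)" using assms that by simp
    then show ?thesis by (rule frechet_derivative_works[THEN iffD1])
  qed
  show "Ck_on S k (\<lambda>x. frechet_derivative f (at x) v)"
    using assms by simp
qed

lemma Ck_on_add:
  assumes "open S" "Ck_on S k f" "Ck_on S k g"
  shows "Ck_on S k (\<lambda>x. f x + g x)"
  using assms(2,3)
proof (induction k arbitrary: f g)
  case 0
  then show ?case by (simp add: continuous_on_add)
next
  case (Suc k)
  note f = Suc.prems(1) and g = Suc.prems(2)
  let ?f = "\<lambda>x. frechet_derivative f (at x)" and ?g = "\<lambda>x. frechet_derivative g (at x)"
  show ?case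
  proof (rule Ck_on_SucI[OF assms(1)])
    show "((\<lambda>x. f x + g x) has_derivative (\<lambda>v. ?f x v + ?g x v)) (at x)" if "x \<in> S" for x
      by (rule has_derivative_add[OF Ck_on_SucD(1)[OF f that] Ck_on_SucD(1)[OF g that]])
    show "Ck_on S k (\<lambda>x. ?f x v + ?g x v)" for v
      by (rule Suc.IH[OF Ck_on_SucD(2)[OF f] Ck_on_SucD(2)[OF g]])
  qed
qed

lemma Ck_on_bilinear:
  assumes "bounded_bilinear h" "open S" "Ck_on S k f" "Ck_on S k g"
  shows "Ck_on S k (\<lambda>x. h (f x) (g x))"
  using assms(3,4)
proof (induction k arbitrary: f g)
  case 0
  then show ?case using bounded_bilinear.continuous_on[OF assms(1)] by simp
next
  case (Suc k)
  note f = Suc.prems(1) and g = Suc.prems(2)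
  let ?f = "\<lambda>x. frechet_derivative f (at x)" and ?g = "\<lambda>x. frechet_derivative g (at x)"
  show ?case
  proof (rule Ck_on_SucI[OF assms(2)])
    show "((\<lambda>x. h (f x) (g x)) has_derivative (\<lambda>v. h (f x) (?g x v) + h (?f x v) (g x))) (at x)"
      if "x \<in> S" for x
      by (rule bounded_bilinear.FDERIV[OF assms(1) Ck_on_SucD(1)[OF f that] Ck_on_SucD(1)[OF g that]])
    \<comment> \<open>Each summand of the product rule has one factor that is not differentiated;
      \<open>Ck_on_pred\<close> lowers it to class C^k so that the induction hypothesis covers both
      factors.\<close>
    show "Ck_on S k (\<lambda>x. h (f x) (?g x v) + h (?f x v) (g x))" for v
      by (rule Ck_on_add[OF assms(2) Suc.IH[OF Ck_on_pred[OF f] Ck_on_SucD(2)[OF g]]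
            Suc.IH[OF Ck_on_SucD(2)[OF f] Ck_on_pred[OF g]]])
  qed
qed

text \<open>A linear map is a bilinear one with the scalar 1 as its other argument, which saves a
  separate induction.\<close>

lemma Ck_on_linear:
  assumes "bounded_linear h" "open S" "Ck_on S k f"
  shows "Ck_on S k (\<lambda>x. h (f x))"
proof -
  have b: "bounded_bilinear (\<lambda>(r::real) x. r *\<^sub>R h x)"
    using bounded_bilinear.comp[OF bounded_bilinear_scaleR bounded_linear_ident assms(1)] by blast
  have c: "Ck_on S k (\<lambda>x. 1::real)" by (rule Ck_on_const)
  have "Ck_on S k (\<lambda>x. (1::real) *\<^sub>R h (f x))"
    by (rule Ck_on_bilinear[OF b assms(2) c assms(3)])
  then show ?thesis by (simp only: scaleR_one)
qed

lemma Ck_on_sum: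
  assumes "open S" "\<And>i. i \<in> I \<Longrightarrow> Ck_on S k (f i)"
  shows "Ck_on S k (\<lambda>x. \<Sum>i\<in>I. f i x)"
  using assms(2)
proof (induction I rule: infinite_finite_induct)
  case (insert i I)
  then show ?case by (simp add: Ck_on_add[OF assms(1)])
qed (simp_all add: Ck_on_const)

text \<open>\<open>Ck_on\<close> controls derivatives in fixed directions, but the chain rule
  differentiates f in the direction Dg(x)v, which moves with x. Expanding that direction in the
  Parseval family leaves derivatives of f in the fixed directions e, with C^k coefficients.\<close>

lemma Ck_on_compose:
  fixes g :: "'e::real_normed_vector \<Rightarrow> 'f::real_inner"
  assumes b: "parseval (b::'f set)" and "open S" "open T" "g ` S \<subseteq> T"
    and "Ck_on T k f" "Ck_on S k g"
  shows "Ck_on S k (\<lambda>x. f (g x))"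
  using assms(5,6)
proof (induction k arbitrary: f)
  case 0
  then show ?case using assms(4) continuous_on_compose2 by (auto simp: image_subset_iff)
next
  case (Suc k)
  let ?f = "\<lambda>y. frechet_derivative f (at y)" and ?g = "\<lambda>x. frechet_derivative g (at x)"
  show ?case
  proof (rule Ck_on_SucI[OF assms(2)])
    fix x assume x: "x \<in> S"
    then have gx: "g x \<in> T" using assms(4) by blast
    show "((\<lambda>x. f (g x)) has_derivative (\<lambda>v. \<Sum>e\<in>b. (?g x v \<bullet> e) *\<^sub>R ?f (g x) e)) (at x)"
    proof -
      have f: "(f has_derivative ?f (g x)) (at (g x))" using Ck_on_SucD(1)[OF Suc.prems(1) gx] .
      have "((\<lambda>x. f (g x)) has_derivative (\<lambda>v. ?f (g x) (?g x v))) (at x)"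
        using has_derivative_compose[OF Ck_on_SucD(1)[OF Suc.prems(2) x] f] .
      moreover have "?f (g x) (?g x v) = (\<Sum>e\<in>b. (?g x v \<bullet> e) *\<^sub>R ?f (g x) e)" for v
        by (rule parseval_linear_expand[OF b has_derivative_linear[OF f]])
      ultimately show ?thesis by simp
    qed
  next
    fix v
    have 1: "Ck_on S k (\<lambda>x. ?f (g x) e)" for e
      by (rule Suc.IH) (use Suc.prems Ck_on_pred in auto)
    have 2: "Ck_on S k (\<lambda>x. ?g x v \<bullet> e)" for e
      by (rule Ck_on_linear[OF bounded_linear_inner_left assms(2)]) (use Suc.prems in auto)
    show "Ck_on S k (\<lambda>x. \<Sum>e\<in>b. (?g x v \<bullet> e) *\<^sub>R ?f (g x) e)"
      by (intro Ck_on_sum[OF assms(2)] Ck_on_bilinear[OF bounded_bilinear_scaleR assms(2)] 1 2)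
  qed
qed

section \<open>The same closure properties for smooth maps\<close>

lemma smooth_onI: "(\<And>k. Ck_on S k f) \<Longrightarrow> smooth_on S f"
  by (simp add: smooth_on_def)

lemma smooth_onD: "smooth_on S f \<Longrightarrow> Ck_on S k f"
  unfolding smooth_on_def by (rule spec)

lemma smooth_on_cong:
  assumes "open S" "smooth_on S f" "\<And>x. x \<in> S \<Longrightarrow> f x = g x"
  shows "smooth_on S g"
  by (rule smooth_onI, rule Ck_on_cong[OF assms(1) smooth_onD[OF assms(2)] assms(3)])

lemma smooth_on_subset:
  assumes "T \<subseteq> S" "smooth_on S f"
  shows "smooth_on T f"
  by (rule smooth_onI, rule Ck_on_subset[OF assms(1) smooth_onD[OF assms(2)]])

lemma smooth_on_local:
  assumes "open S" "\<And>x. x \<in> S \<Longrightarrow> \<exists>T. open T \<and> x \<in> T \<and> smooth_on T f"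
  shows "smooth_on S f"
  by (rule smooth_onI, rule Ck_on_local[OF assms(1)]) (use assms(2) smooth_onD in blast)

lemma smooth_on_const: "smooth_on S (\<lambda>x. c)"
  by (rule smooth_onI, rule Ck_on_const)

lemma smooth_on_add:
  assumes "open S" "smooth_on S f" "smooth_on S g"
  shows "smooth_on S (\<lambda>x. f x + g x)"
  by (rule smooth_onI, rule Ck_on_add[OF assms(1) smooth_onD[OF assms(2)] smooth_onD[OF assms(3)]])

lemma smooth_on_bilinear:
  assumes "bounded_bilinear h" "open S" "smooth_on S f" "smooth_on S g"
  shows "smooth_on S (\<lambda>x. h (f x) (g x))"
  by (rule smooth_onI,
      rule Ck_on_bilinear[OF assms(1,2) smooth_onD[OF assms(3)] smooth_onD[OF assms(4)]])

lemma smooth_on_linear: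
  assumes "bounded_linear h" "open S" "smooth_on S f"
  shows "smooth_on S (\<lambda>x. h (f x))"
  by (rule smooth_onI, rule Ck_on_linear[OF assms(1,2) smooth_onD[OF assms(3)]])

lemma smooth_on_diff:
  assumes "open S" "smooth_on S f" "smooth_on S g"
  shows "smooth_on S (\<lambda>x. f x - g x)"
proof -
  have "smooth_on S (\<lambda>x. - g x)"
    by (rule smooth_on_linear[OF bounded_linear_minus[OF bounded_linear_ident] assms(1,3)])
  then have "smooth_on S (\<lambda>x. f x + - g x)"
    by (rule smooth_on_add[OF assms(1,2)])
  then show ?thesis by (simp only: add_uminus_conv_diff)
qed

lemma smooth_on_sum:
  assumes "open S" "\<And>i. i \<in> I \<Longrightarrow> smooth_on S (f i)"
  shows "smooth_on S (\<lambda>x. \<Sum>i\<in>I. f i x)"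
  by (rule smooth_onI, rule Ck_on_sum[OF assms(1) smooth_onD[OF assms(2)]])

lemma smooth_on_compose:
  fixes g :: "'e::real_normed_vector \<Rightarrow> 'f::real_inner"
  assumes "parseval (b::'f set)" "open S" "open T" "g ` S \<subseteq> T" "smooth_on T f" "smooth_on S g"
  shows "smooth_on S (\<lambda>x. f (g x))"
  by (rule smooth_onI,
      rule Ck_on_compose[OF assms(1-4) smooth_onD[OF assms(5)] smooth_onD[OF assms(6)]])

lemma smooth_on_imp_continuous_on: "smooth_on S f \<Longrightarrow> continuous_on S f"
  by (drule smooth_onD[where k=0]) simp

lemma smooth_on_differentiable: "smooth_on S f \<Longrightarrow> x \<in> S \<Longrightarrow> f differentiable (at x)"
  by (drule smooth_onD[where k="Suc 0"]) simp

lemma smooth_on_has_derivative: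
  "smooth_on S f \<Longrightarrow> x \<in> S \<Longrightarrow> (f has_derivative blinfun_apply (fderiv f x)) (at x)"
  by (simp add: has_derivative_fderiv smooth_on_differentiable)

lemma smooth_on_fderiv_apply:
  assumes "open S" "smooth_on S f"
  shows "smooth_on S (\<lambda>x. fderiv f x v)"
proof (rule smooth_onI)
  fix k
  have "Ck_on S k (\<lambda>x. frechet_derivative f (at x) v)"
    by (rule Ck_on_SucD(2)[OF smooth_onD[OF assms(2)]])
  then show "Ck_on S k (\<lambda>x. fderiv f x v)"
    by (rule Ck_on_cong[OF assms(1)])
      (simp add: fderiv_frechet smooth_on_differentiable[OF assms(2)])
qed

lemma blinfun_parseval_expand:
  fixes f :: "'e::real_inner \<Rightarrow>\<^sub>L 'f::real_normed_vector"
  assumes "parseval b"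
  shows "f = (\<Sum>e\<in>b. blinfun_scaleR_left (f e) o\<^sub>L blinfun_inner_left e)"
proof (rule blinfun_eqI)
  fix x
  have "f x = (\<Sum>e\<in>b. (x \<bullet> e) *\<^sub>R f e)"
    by (rule parseval_linear_expand[OF assms bounded_linear.linear[OF blinfun.bounded_linear_right]])
  then show "f x = (\<Sum>e\<in>b. blinfun_scaleR_left (f e) o\<^sub>L blinfun_inner_left e) x"
    by (simp add: blinfun.sum_left inner_commute)
qed

text \<open>In finite dimension an operator is a finite sum of rank one operators built linearly
  from its values on the family b, so smoothness of each value gives smoothness in the operator
  norm. This makes \<open>fderiv f\<close> itself differentiable, as second derivatives
  require.\<close>

lemma smooth_on_blinfunI:
  fixes f :: "'d::real_normed_vector \<Rightarrow> 'e::real_inner \<Rightarrow>\<^sub>L 'f::real_normed_vector"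
  assumes "parseval (b::'e set)" "open S" "\<And>v. smooth_on S (\<lambda>x. f x v)"
  shows "smooth_on S f"
proof -
  have l: "bounded_linear (\<lambda>y::'f. blinfun_scaleR_left y o\<^sub>L blinfun_inner_left e)" for e :: 'e
    by (rule bounded_linear_compose[OF bounded_bilinear.bounded_linear_left[OF
            bounded_bilinear_blinfun_compose] bounded_linear_blinfun_scaleR_left])
  have "smooth_on S (\<lambda>x. \<Sum>e\<in>b. blinfun_scaleR_left (f x e) o\<^sub>L blinfun_inner_left e)"
    by (intro smooth_on_sum[OF assms(2)] smooth_on_linear[OF l assms(2)] assms(3))
  moreover have "(\<lambda>x. \<Sum>e\<in>b. blinfun_scaleR_left (f x e) o\<^sub>L blinfun_inner_left e) = f"
    by (rule ext, rule sym, rule blinfun_parseval_expand[OF assms(1)])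
  ultimately show ?thesis by (simp only:)
qed

lemma smooth_on_fderiv:
  assumes "parseval (b::'e::real_inner set)" "open S" "smooth_on S (f :: 'e \<Rightarrow> _)"
  shows "smooth_on S (fderiv f)"
  by (rule smooth_on_blinfunI[OF assms(1,2) smooth_on_fderiv_apply[OF assms(2,3)]])

text \<open>The mean value inequality for g(x) = f(x + tb) - f(x) - f''(tb)x on the segment from u
  to u + ta. The derivative of g is the difference of the first-order remainders of Df at x + tb and
  at x, so differentiability of Df at the single point u is enough.\<close>

lemma second_difference_estimate:
  fixes f :: "'e::real_normed_vector \<Rightarrow> 'f::real_normed_vector"
  assumes S: "open S" "u \<in> S" and f: "\<And>x. x \<in> S \<Longrightarrow> f differentiable (at x)"
    and f'': "(fderiv f has_derivative f'') (at u)" and "\<epsilon> > 0"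
  shows "\<exists>\<delta>>0. \<forall>t. 0 < t \<and> t < \<delta> \<longrightarrow>
    norm (f (u + t *\<^sub>R a + t *\<^sub>R b) - f (u + t *\<^sub>R a) - f (u + t *\<^sub>R b) + f u - t\<^sup>2 *\<^sub>R f'' b a)
      \<le> \<epsilon> * t\<^sup>2"
proof -
  \<comment> \<open>t * M bounds the distance from u of all points x and x + tb that occur, and also
    the length of the segment. Two remainders of size \<eta> * t * M along it give 2 * \<eta> * (t *
    M)^2, which the choice of \<eta> turns into \<epsilon> * t^2.\<close>
  define M where "M = norm a + norm b + 1"
  have M: "M > 0" by (simp add: M_def add_nonneg_pos)
  define \<eta> where "\<eta> = \<epsilon> / (2 * M * M)"
  have \<eta>: "\<eta> > 0" using M assms(5) by (simp add: \<eta>_def)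
  obtain d1 where d1: "d1 > 0" "\<And>x. norm (x - u) < d1 \<Longrightarrow>
      norm (fderiv f x - fderiv f u - f'' (x - u)) \<le> \<eta> * norm (x - u)"
    using f'' \<eta> unfolding has_derivative_at_alt by blast
  obtain d2 where d2: "d2 > 0" "ball u d2 \<subseteq> S" using S open_contains_ball by blast
  define \<delta> where "\<delta> = min d1 d2 / M"
  have lin: "linear f''" using f'' has_derivative_linear by blast
  have "norm (f (u + t *\<^sub>R a + t *\<^sub>R b) - f (u + t *\<^sub>R a) - f (u + t *\<^sub>R b) + f u - t\<^sup>2 *\<^sub>R f'' b a)
      \<le> \<epsilon> * t\<^sup>2" if t: "0 < t" "t < \<delta>" for t
  proof -
    have tM: "t * M < min d1 d2" using t M by (simp add: \<delta>_def pos_less_divide_eq)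
    define I where "I = (\<lambda>s. u + s *\<^sub>R (t *\<^sub>R a)) ` {0..1}"
    define g where "g x = f (x + t *\<^sub>R b) - f x - blinfun_apply (f'' (t *\<^sub>R b)) x" for x
    have near: "norm (x - u) \<le> t * M" "norm (x + t *\<^sub>R b - u) \<le> t * M" if x: "x \<in> I" for x
    proof -
      obtain s where s: "0 \<le> s" "s \<le> 1" "x = u + s *\<^sub>R (t *\<^sub>R a)" using x by (auto simp: I_def)
      have 1: "norm (s *\<^sub>R (t *\<^sub>R a)) \<le> t * norm a"
        using s t by (simp add: mult_left_le_one_le)
      have 2: "norm (t *\<^sub>R b) = t * norm b" using t by simp
      have 3: "norm (s *\<^sub>R (t *\<^sub>R a) + t *\<^sub>R b) \<le> norm (s *\<^sub>R (t *\<^sub>R a)) + norm (t *\<^sub>R b)"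
        by (rule norm_triangle_ineq)
      have 4: "t * norm b \<ge> 0" "t * 1 \<ge> 0" using t by simp_all
      have 5: "x - u = s *\<^sub>R (t *\<^sub>R a)" "x + t *\<^sub>R b - u = s *\<^sub>R (t *\<^sub>R a) + t *\<^sub>R b"
        using s(3) by simp_all
      show "norm (x - u) \<le> t * M" "norm (x + t *\<^sub>R b - u) \<le> t * M"
        unfolding M_def distrib_left 5 using 1 2 3 4 by linarith+
    qed
    have inS: "x \<in> S" "x + t *\<^sub>R b \<in> S" if "x \<in> I" for x
      using near[OF that] tM d2(2) by (auto simp: dist_norm norm_minus_commute subset_iff)
    have dg: "(g has_derivative (\<lambda>v. fderiv f (x + t *\<^sub>R b) v - fderiv f x v - f'' (t *\<^sub>R b) v)) (at x within I)"
      if x: "x \<in> I" for x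
    proof -
      have s: "((\<lambda>x. x + t *\<^sub>R b) has_derivative (\<lambda>v. v)) (at x)"
        by (auto intro!: derivative_eq_intros)
      have "((\<lambda>x. f (x + t *\<^sub>R b)) has_derivative (\<lambda>v. fderiv f (x + t *\<^sub>R b) v)) (at x)"
        using has_derivative_compose[OF s has_derivative_fderiv[OF f[OF inS(2)[OF x]]]] by simp
      then have "(g has_derivative (\<lambda>v. fderiv f (x + t *\<^sub>R b) v - fderiv f x v - f'' (t *\<^sub>R b) v)) (at x)"
        unfolding g_def
        by (intro has_derivative_diff has_derivative_fderiv[OF f[OF inS(1)[OF x]]]
            bounded_linear_imp_has_derivative blinfun.bounded_linear_right)
      then show ?thesis by (rule has_derivative_at_withinI)
    qed
    have B: "onorm (\<lambda>v. fderiv f (x + t *\<^sub>R b) v - fderiv f x v - f'' (t *\<^sub>R b) v) \<le> 2 * \<eta> * (t * M)"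
      if x: "x \<in> I" for x
    proof -
      let ?p = "fderiv f (x + t *\<^sub>R b) - fderiv f u - f'' (x + t *\<^sub>R b - u)"
      let ?q = "fderiv f x - fderiv f u - f'' (x - u)"
      have e: "fderiv f (x + t *\<^sub>R b) - fderiv f x - f'' (t *\<^sub>R b) = ?p - ?q"
        using linear_diff[OF lin, of "x + t *\<^sub>R b - u" "x - u"] by (simp add: algebra_simps)
      have "norm ?p \<le> \<eta> * (t * M)" "norm ?q \<le> \<eta> * (t * M)"
        using order_trans[OF d1(2) mult_left_mono[OF near(2)[OF x], of \<eta>]]
          order_trans[OF d1(2) mult_left_mono[OF near(1)[OF x], of \<eta>]] near[OF x] tM \<eta>
        by simp_all
      then have "norm (fderiv f (x + t *\<^sub>R b) - fderiv f x - f'' (t *\<^sub>R b)) \<le> 2 * \<eta> * (t * M)"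
        unfolding e using norm_triangle_ineq4[of ?p ?q] by linarith
      moreover have "(\<lambda>v. fderiv f (x + t *\<^sub>R b) v - fderiv f x v - f'' (t *\<^sub>R b) v)
        = blinfun_apply (fderiv f (x + t *\<^sub>R b) - fderiv f x - f'' (t *\<^sub>R b))"
        by (rule ext) (simp add: blinfun.diff_left)
      ultimately show ?thesis
        by (simp only: norm_blinfun.rep_eq)
    qed
    have "norm (g (u + t *\<^sub>R a) - g u) \<le> norm (t *\<^sub>R a) * (2 * \<eta> * (t * M))"
    proof (rule differentiable_bound_segment[OF _ dg])
      show I: "u + s *\<^sub>R (t *\<^sub>R a) \<in> I" if "s \<in> {0..1}" for s
        unfolding I_def using that by (rule imageI)
      show "onorm (\<lambda>v. fderiv f (u + s *\<^sub>R t *\<^sub>R a + t *\<^sub>R b) v - fderiv f (u + s *\<^sub>R t *\<^sub>R a) v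
          - f'' (t *\<^sub>R b) v) \<le> 2 * \<eta> * (t * M)" if "s \<in> {0..1}" for s
        by (rule B[OF I[OF that]])
    qed
    also have "\<dots> \<le> (t * M) * (2 * \<eta> * (t * M))"
      using t M \<eta> by (intro mult_right_mono) (auto simp: M_def)
    also have "\<dots> = \<epsilon> * t\<^sup>2" using M by (simp add: \<eta>_def power2_eq_square field_simps)
    finally have "norm (g (u + t *\<^sub>R a) - g u) \<le> \<epsilon> * t\<^sup>2" .
    moreover have "g (u + t *\<^sub>R a) - g u
      = f (u + t *\<^sub>R a + t *\<^sub>R b) - f (u + t *\<^sub>R a) - f (u + t *\<^sub>R b) + f u - t\<^sup>2 *\<^sub>R f'' b a"
      using linear_scale[OF lin]
      by (simp add: g_def blinfun.bilinear_simps power2_eq_square algebra_simps)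
    ultimately show ?thesis by simp
  qed
  moreover have "\<delta> > 0" using d1 d2 M by (simp add: \<delta>_def)
  ultimately show ?thesis by blast
qed

text \<open>The second difference is symmetric in a and b, and t^2 times either value approximates
  it. Taking \<epsilon> as a third of the supposed discrepancy leaves 3\<epsilon> t^2 against two
  errors of size \<epsilon> t^2.\<close>

lemma second_derivative_symmetric:
  fixes f :: "'e::real_normed_vector \<Rightarrow> 'f::real_normed_vector"
  assumes S: "open S" "u \<in> S" and f: "\<And>x. x \<in> S \<Longrightarrow> f differentiable (at x)"
    and f'': "(fderiv f has_derivative f'') (at u)"
  shows "f'' a b = f'' b a"
proof (rule ccontr)
  assume ne: "blinfun_apply (f'' a) b \<noteq> f'' b a"
  define \<epsilon> where "\<epsilon> = norm (f'' a b - f'' b a) / 3"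
  have \<epsilon>: "\<epsilon> > 0" using ne by (simp add: \<epsilon>_def)
  let ?\<phi> = "\<lambda>t a b. f (u + t *\<^sub>R a + t *\<^sub>R b) - f (u + t *\<^sub>R a) - f (u + t *\<^sub>R b) + f u"
  obtain d1 where d1: "d1 > 0" "\<And>t. 0 < t \<Longrightarrow> t < d1 \<Longrightarrow> norm (?\<phi> t a b - t\<^sup>2 *\<^sub>R f'' b a) \<le> \<epsilon> * t\<^sup>2"
    using second_difference_estimate[OF S f f'' \<epsilon>, of a b] by auto
  obtain d2 where d2: "d2 > 0" "\<And>t. 0 < t \<Longrightarrow> t < d2 \<Longrightarrow> norm (?\<phi> t b a - t\<^sup>2 *\<^sub>R f'' a b) \<le> \<epsilon> * t\<^sup>2"
    using second_difference_estimate[OF S f f'' \<epsilon>, of b a] by auto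
  define t where "t = min d1 d2 / 2"
  have t: "0 < t" "t < d1" "t < d2" using d1(1) d2(1) by (auto simp: t_def)
  have eq: "?\<phi> t a b = ?\<phi> t b a" by (simp add: algebra_simps)
  have "norm (t\<^sup>2 *\<^sub>R f'' a b - t\<^sup>2 *\<^sub>R f'' b a) \<le> 2 * (\<epsilon> * t\<^sup>2)"
    using norm_triangle_ineq4[of "?\<phi> t a b - t\<^sup>2 *\<^sub>R f'' b a" "?\<phi> t b a - t\<^sup>2 *\<^sub>R f'' a b"]
      d1(2)[OF t(1,2)] d2(2)[OF t(1,3)] unfolding eq by simp
  moreover have "norm (t\<^sup>2 *\<^sub>R f'' a b - t\<^sup>2 *\<^sub>R f'' b a) = t\<^sup>2 * (3 * \<epsilon>)"
    by (simp add: \<epsilon>_def scaleR_diff_right[symmetric])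
  ultimately have "t\<^sup>2 * (3 * \<epsilon>) \<le> 2 * (\<epsilon> * t\<^sup>2)" by simp
  moreover have "t\<^sup>2 * \<epsilon> > 0" using t \<epsilon> by simp
  ultimately show False by (simp add: algebra_simps)
qed

section \<open>The operator of a vector-valued one-form in coordinates\<close>

text \<open>What remains of [Y, RX] - R[Y, X] after expansion: both parts contain R(DX(Y)). Hence X
  is a single vector here, not a field.\<close>

definition D_vec_coord :: "('e::real_normed_vector \<Rightarrow> 'e \<Rightarrow>\<^sub>L 'e) \<Rightarrow> 'e \<Rightarrow> ('e \<Rightarrow> 'e) \<Rightarrow> 'e \<Rightarrow> 'e" where
  "D_vec_coord R X Y u = fderiv R u (Y u) X - fderiv Y u (R u X) + R u (fderiv Y u X)"

text \<open>The difference of the two Lie derivatives, evaluated at W; here the common term is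
  \<alpha>(R(DX(W))). Giving values on W postpones the question of bounded linearity in W to where
  an actual covector is available.\<close>

definition D_dual_coord :: "('e::real_normed_vector \<Rightarrow> 'e \<Rightarrow>\<^sub>L 'e) \<Rightarrow> 'e \<Rightarrow> ('e \<Rightarrow> 'e \<Rightarrow>\<^sub>L real) \<Rightarrow> 'e \<Rightarrow> 'e \<Rightarrow> real" where
  "D_dual_coord R X \<alpha> u W = fderiv \<alpha> u X (R u W) - fderiv \<alpha> u (R u X) W
     + \<alpha> u (fderiv R u X W) - \<alpha> u (fderiv R u W X)"

section \<open>Relatedness under a smooth map, differentiated\<close>

lemma has_derivative_unique_open:
  assumes "open S" "u \<in> S" "\<And>x. x \<in> S \<Longrightarrow> f x = g x"
    and "(f has_derivative f') (at u)" "(g has_derivative g') (at u)"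
  shows "f' Z = g' Z"
  using has_derivative_unique[OF has_derivative_transform_within_open[OF assms(4,1,2,3)] assms(5)]
  by simp

lemma related_fields_deriv:
  fixes f :: "'e::real_normed_vector \<Rightarrow> 'f::real_normed_vector"
  assumes S: "open S" "u \<in> S" and f: "f differentiable (at u)" "fderiv f differentiable (at u)"
    and "y differentiable (at u)" "Y differentiable (at (f u))"
    and rel: "\<And>x. x \<in> S \<Longrightarrow> fderiv f x (y x) = Y (f x)"
  shows "fderiv (fderiv f) u Z (y u) + fderiv f u (fderiv y u Z) = fderiv Y (f u) (fderiv f u Z)"
proof -
  have d1: "((\<lambda>x. fderiv f x (y x)) has_derivative
      (\<lambda>Z. fderiv f u (fderiv y u Z) + fderiv (fderiv f) u Z (y u))) (at u)"
    by (intro blinfun.FDERIV has_derivative_fderiv f assms)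
  have d2: "((\<lambda>x. Y (f x)) has_derivative (\<lambda>Z. fderiv Y (f u) (fderiv f u Z))) (at u)"
    by (rule has_derivative_compose[OF has_derivative_fderiv[OF f(1)] has_derivative_fderiv[OF assms(6)]])
  show ?thesis
    using has_derivative_unique_open[OF S rel d1 d2] by (simp add: add.commute)
qed

lemma related_endo_deriv:
  fixes f :: "'e::real_normed_vector \<Rightarrow> 'f::real_normed_vector"
  assumes S: "open S" "u \<in> S" and f: "f differentiable (at u)" "fderiv f differentiable (at u)"
    and RM: "RM differentiable (at u)" and RN: "RN differentiable (at (f u))"
    and rel: "\<And>x. x \<in> S \<Longrightarrow> RN (f x) o\<^sub>L fderiv f x = fderiv f x o\<^sub>L RM x"
  shows "fderiv RN (f u) (fderiv f u Z) (fderiv f u W) + RN (f u) (fderiv (fderiv f) u Z W)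
    = fderiv (fderiv f) u Z (RM u W) + fderiv f u (fderiv RM u Z W)"
proof -
  note comp = bounded_bilinear.FDERIV[OF bounded_bilinear_blinfun_compose]
  have RN': "((\<lambda>x. RN (f x)) has_derivative (\<lambda>Z. fderiv RN (f u) (fderiv f u Z))) (at u)"
    by (rule has_derivative_compose[OF has_derivative_fderiv[OF f(1)] has_derivative_fderiv[OF RN]])
  have "(RN (f u) o\<^sub>L fderiv (fderiv f) u Z) + (fderiv RN (f u) (fderiv f u Z) o\<^sub>L fderiv f u)
    = (fderiv f u o\<^sub>L fderiv RM u Z) + (fderiv (fderiv f) u Z o\<^sub>L RM u)"
    by (rule has_derivative_unique_open[OF S rel comp[OF RN' has_derivative_fderiv[OF f(2)]]
          comp[OF has_derivative_fderiv[OF f(2)] has_derivative_fderiv[OF RM]]])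
  then have "((RN (f u) o\<^sub>L fderiv (fderiv f) u Z) + (fderiv RN (f u) (fderiv f u Z) o\<^sub>L fderiv f u)) W
    = ((fderiv f u o\<^sub>L fderiv RM u Z) + (fderiv (fderiv f) u Z o\<^sub>L RM u)) W"
    by (simp only:)
  then show ?thesis by (simp add: blinfun.add_left add.commute)
qed

lemma related_oneforms_deriv:
  fixes f :: "'e::real_normed_vector \<Rightarrow> 'f::real_normed_vector"
  assumes S: "open S" "u \<in> S" and f: "f differentiable (at u)" "fderiv f differentiable (at u)"
    and a: "a differentiable (at u)" and \<beta>: "\<beta> differentiable (at (f u))"
    and rel: "\<And>x. x \<in> S \<Longrightarrow> a x = \<beta> (f x) o\<^sub>L fderiv f x"
  shows "fderiv a u Z W = fderiv \<beta> (f u) (fderiv f u Z) (fderiv f u W) + \<beta> (f u) (fderiv (fderiv f) u Z W)"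
proof -
  note comp = bounded_bilinear.FDERIV[OF bounded_bilinear_blinfun_compose]
  have \<beta>': "((\<lambda>x. \<beta> (f x)) has_derivative (\<lambda>Z. fderiv \<beta> (f u) (fderiv f u Z))) (at u)"
    by (rule has_derivative_compose[OF has_derivative_fderiv[OF f(1)] has_derivative_fderiv[OF \<beta>]])
  have "fderiv a u Z = (\<beta> (f u) o\<^sub>L fderiv (fderiv f) u Z) + (fderiv \<beta> (f u) (fderiv f u Z) o\<^sub>L fderiv f u)"
    by (rule has_derivative_unique_open[OF S rel has_derivative_fderiv[OF a]
          comp[OF \<beta>' has_derivative_fderiv[OF f(2)]]])
  then show ?thesis by (simp add: blinfun.add_left add.commute)
qed

text \<open>Differentiating the two relations brings in second derivatives of f. Those under RN are
  D^2 f(y, X) and D^2 f(X, y), the others D^2 f(y, RM X) and D^2 f(RM X, y); each pair has opposite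
  signs and cancels by symmetry. The fields y and Y need a derivative only at the point, which is
  all that a lift with generic coefficients offers.\<close>

lemma D_vec_coord_natural:
  fixes f :: "'e::real_normed_vector \<Rightarrow> 'f::real_normed_vector"
  assumes S: "open S" "u \<in> S" and f: "\<And>x. x \<in> S \<Longrightarrow> f differentiable (at x)" "fderiv f differentiable (at u)"
    and R: "RM differentiable (at u)" "RN differentiable (at (f u))"
      "\<And>x. x \<in> S \<Longrightarrow> RN (f x) o\<^sub>L fderiv f x = fderiv f x o\<^sub>L RM x"
    and y: "y differentiable (at u)" "Y differentiable (at (f u))"
      "\<And>x. x \<in> S \<Longrightarrow> fderiv f x (y x) = Y (f x)"
  shows "fderiv f u (D_vec_coord RM X y u) = D_vec_coord RN (fderiv f u X) Y (f u)"
proof -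
  note fu = f(1)[OF S(2)]
  note sym = second_derivative_symmetric[OF S f(1) has_derivative_fderiv[OF f(2)]]
  note e1 = related_fields_deriv[OF S fu f(2) y]
  note e2 = related_endo_deriv[OF S fu f(2) R]
  have rel: "RN (f u) (fderiv f u Z) = fderiv f u (RM u Z)" for Z
    using R(3)[OF S(2)] by (metis blinfun_apply_blinfun_compose)
  have "fderiv f u (D_vec_coord RM X y u) = fderiv f u (fderiv RM u (y u) X) - fderiv f u (fderiv y u (RM u X))
      + RN (f u) (fderiv f u (fderiv y u X))"
    by (simp add: D_vec_coord_def blinfun.add_right blinfun.diff_right rel)
  also have "fderiv f u (fderiv RM u (y u) X) = fderiv RN (f u) (Y (f u)) (fderiv f u X)
      + RN (f u) (fderiv (fderiv f) u (y u) X) - fderiv (fderiv f) u (y u) (RM u X)"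
    using e2[of "y u" X] y(3)[OF S(2)] by (simp add: algebra_simps)
  also have "fderiv f u (fderiv y u (RM u X))
      = fderiv Y (f u) (RN (f u) (fderiv f u X)) - fderiv (fderiv f) u (RM u X) (y u)"
    using e1[of "RM u X"] by (simp add: algebra_simps rel)
  also have "RN (f u) (fderiv f u (fderiv y u X))
      = RN (f u) (fderiv Y (f u) (fderiv f u X)) - RN (f u) (fderiv (fderiv f) u X (y u))"
    unfolding blinfun.diff_right[symmetric]
    by (rule arg_cong[where f = "blinfun_apply (RN (f u))"]) (use e1[of X] in \<open>simp add: eq_diff_eq add.commute\<close>)
  finally show ?thesis
    by (simp add: D_vec_coord_def sym[of "y u" X] sym[of "y u" "RM u X"] rel)
qed

text \<open>All second derivatives of f occur under \<beta>. D^2 f(X, RM W) cancels outright; the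
  pairs D^2 f(RM X, W), D^2 f(W, RM X) and, behind RN, D^2 f(X, W), D^2 f(W, X) cancel by
  symmetry.\<close>

lemma D_dual_coord_natural:
  fixes f :: "'e::real_normed_vector \<Rightarrow> 'f::real_normed_vector"
  assumes S: "open S" "u \<in> S" and f: "\<And>x. x \<in> S \<Longrightarrow> f differentiable (at x)" "fderiv f differentiable (at u)"
    and R: "RM differentiable (at u)" "RN differentiable (at (f u))"
      "\<And>x. x \<in> S \<Longrightarrow> RN (f x) o\<^sub>L fderiv f x = fderiv f x o\<^sub>L RM x"
    and a: "a differentiable (at u)" "\<beta> differentiable (at (f u))"
      "\<And>x. x \<in> S \<Longrightarrow> a x = \<beta> (f x) o\<^sub>L fderiv f x"
  shows "D_dual_coord RM X a u W = D_dual_coord RN (fderiv f u X) \<beta> (f u) (fderiv f u W)"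
proof -
  note fu = f(1)[OF S(2)]
  note sym = second_derivative_symmetric[OF S f(1) has_derivative_fderiv[OF f(2)]]
  have e1: "fderiv a u Z W = fderiv \<beta> (f u) (fderiv f u Z) (fderiv f u W)
      + \<beta> (f u) (fderiv (fderiv f) u Z W)" for Z W
    by (rule related_oneforms_deriv[OF S fu f(2) a])
  note e2 = related_endo_deriv[OF S fu f(2) R]
  have rel: "RN (f u) (fderiv f u Z) = fderiv f u (RM u Z)" for Z
    using R(3)[OF S(2)] by (metis blinfun_apply_blinfun_compose)
  have e2': "fderiv f u (fderiv RM u Z W) = fderiv RN (f u) (fderiv f u Z) (fderiv f u W)
      + RN (f u) (fderiv (fderiv f) u Z W) - fderiv (fderiv f) u Z (RM u W)" for Z W
    using e2[of Z W] by (simp add: algebra_simps)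
  have au: "a u Z = \<beta> (f u) (fderiv f u Z)" for Z
    using a(3)[OF S(2)] by simp
  show ?thesis
    by (simp add: D_dual_coord_def e1 au e2' rel blinfun.add_right blinfun.diff_right sym[of W X] sym[of W "RM u X"])
qed

text \<open>The Leibniz rule. The corrections are multiples of y and of R y, and
  \<open>D_dual_coord_sum\<close> has the same scalars in front of a and of a composed with R. The
  pair is therefore corrected by multiples of a section and of its image under R and the dual of
  R.\<close>

lemma D_vec_coord_sum:
  assumes "finite I" and c: "\<And>i. i \<in> I \<Longrightarrow> c i differentiable (at u)"
    and y: "\<And>i. i \<in> I \<Longrightarrow> y i differentiable (at u)"
  shows "D_vec_coord R X (\<lambda>x. \<Sum>i\<in>I. c i x *\<^sub>R y i x) u
    = (\<Sum>i\<in>I. c i u *\<^sub>R D_vec_coord R X (y i) u - fderiv (c i) u (R u X) *\<^sub>R y i u + fderiv (c i) u X *\<^sub>R R u (y i u))"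
proof -
  have "((\<lambda>x. \<Sum>i\<in>I. c i x *\<^sub>R y i x) has_derivative
      (\<lambda>Z. \<Sum>i\<in>I. c i u *\<^sub>R fderiv (y i) u Z + fderiv (c i) u Z *\<^sub>R y i u)) (at u)"
    by (intro has_derivative_sum has_derivative_scaleR has_derivative_fderiv c y)
  from fderiv_apply[OF this] show ?thesis
    by (simp add: D_vec_coord_def blinfun.sum_right blinfun.add_right blinfun.scaleR_right blinfun.scaleR_left
        blinfun.sum_left sum.distrib sum_subtractf algebra_simps)
qed

lemma D_dual_coord_sum:
  assumes "finite I" and c: "\<And>i. i \<in> I \<Longrightarrow> c i differentiable (at u)"
    and a: "\<And>i. i \<in> I \<Longrightarrow> a i differentiable (at u)"
  shows "D_dual_coord R X (\<lambda>x. \<Sum>i\<in>I. c i x *\<^sub>R a i x) u W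
    = (\<Sum>i\<in>I. c i u * D_dual_coord R X (a i) u W - fderiv (c i) u (R u X) * a i u W + fderiv (c i) u X * a i u (R u W))"
proof -
  have "((\<lambda>x. \<Sum>i\<in>I. c i x *\<^sub>R a i x) has_derivative
      (\<lambda>Z. \<Sum>i\<in>I. c i u *\<^sub>R fderiv (a i) u Z + fderiv (c i) u Z *\<^sub>R a i u)) (at u)"
    by (intro has_derivative_sum has_derivative_scaleR has_derivative_fderiv c a)
  from fderiv_apply[OF this] show ?thesis
    by (simp add: D_dual_coord_def blinfun.add_left blinfun.scaleR_left blinfun.sum_left
        sum.distrib sum_subtractf algebra_simps)
qed

section \<open>Differentiable solutions of linear systems at generic points\<close>

text \<open>Indexed families, because distinct indices may give equal vectors at some points;
  independence of the image set would not notice such a relation.\<close>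

definition indep_fam :: "'i set \<Rightarrow> ('i \<Rightarrow> 'v::real_vector) \<Rightarrow> bool" where
  "indep_fam I v \<longleftrightarrow> (\<forall>d. (\<Sum>i\<in>I. d i *\<^sub>R v i) = 0 \<longrightarrow> (\<forall>i\<in>I. d i = 0))"

lemma span_image_coeff:
  assumes "finite J" "x \<in> span (v ` J)"
  obtains c where "x = (\<Sum>i\<in>J. c i *\<^sub>R v i)"
proof -
  have "span (v ` J) \<subseteq> {x. \<exists>c. x = (\<Sum>i\<in>J. c i *\<^sub>R v i)}" (is "_ \<subseteq> ?T")
  proof (rule span_minimal)
    show "v ` J \<subseteq> ?T"
    proof (clarsimp)
      fix j assume "j \<in> J"
      then have "v j = (\<Sum>i\<in>J. (if i = j then 1 else 0) *\<^sub>R v i)"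
        using assms(1) by (simp add: if_distrib[of "\<lambda>r. r *\<^sub>R _"] cong: if_cong)
      then show "\<exists>c. v j = (\<Sum>i\<in>J. c i *\<^sub>R v i)"
        by (rule exI[where P = "\<lambda>c. v j = (\<Sum>i\<in>J. c i *\<^sub>R v i)"])
    qed
    show "subspace ?T"
    proof (rule subspaceI)
      show "0 \<in> ?T" by (auto intro!: exI[of _ "\<lambda>_. 0"])
      fix x y assume "x \<in> ?T" "y \<in> ?T"
      then obtain c d where "x = (\<Sum>i\<in>J. c i *\<^sub>R v i)" "y = (\<Sum>i\<in>J. d i *\<^sub>R v i)" by blast
      then show "x + y \<in> ?T"
        by (auto intro!: exI[of _ "\<lambda>i. c i + d i"] simp: scaleR_add_left sum.distrib)
    next
      fix k x assume "x \<in> ?T"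
      then obtain c where "x = (\<Sum>i\<in>J. c i *\<^sub>R v i)" by blast
      then show "k *\<^sub>R x \<in> ?T"
        by (auto intro!: exI[of _ "\<lambda>i. k * c i"] simp: scaleR_sum_right)
    qed
  qed
  then show ?thesis using assms(2) that by blast
qed

text \<open>The residual r of \<open>v j\<close> against the span of the other vectors is orthogonal
  to them, and r \<bullet> v j = r \<bullet> r; dividing r by this number gives the dual
  vector.\<close>

lemma indep_fam_dual:
  fixes v :: "'i \<Rightarrow> 'v::real_inner"
  assumes "finite I" "indep_fam I v"
  obtains n where "\<And>i j. i \<in> I \<Longrightarrow> j \<in> I \<Longrightarrow> n j \<bullet> v i = (if i = j then 1 else 0)"
proof -
  have "\<exists>w. \<forall>i\<in>I. w \<bullet> v i = (if i = j then 1 else 0)" if j: "j \<in> I" for j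
  proof -
    let ?S = "v ` (I - {j})"
    obtain b where b: "parseval_on (span ?S) b"
      using parseval_on_span_exists[of ?S] assms(1) by auto
    define p where "p = (\<Sum>e\<in>b. (v j \<bullet> e) *\<^sub>R e)"
    define r where "r = v j - p"
    have p: "p \<in> span ?S"
      using b by (auto simp: p_def parseval_on_def intro!: span_sum span_scale)
    have r: "r \<bullet> y = 0" if "y \<in> span ?S" for y
      unfolding r_def p_def using parseval_on_residual[OF b that] .
    have "r \<noteq> 0"
    proof
      assume "r = 0"
      then have "v j \<in> span ?S" using p by (simp add: r_def)
      then obtain c where c: "v j = (\<Sum>i\<in>I - {j}. c i *\<^sub>R v i)"
        using span_image_coeff assms(1) by (metis finite_Diff)
      \<comment> \<open>The coefficient -1 at j turns the expansion of \<open>v j\<close> into a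
        nontrivial relation of the whole family.\<close>
      define d where "d = c(j := -1)"
      have "(\<Sum>i\<in>I. d i *\<^sub>R v i) = d j *\<^sub>R v j + (\<Sum>i\<in>I - {j}. d i *\<^sub>R v i)"
        by (rule sum.remove[OF assms(1) j])
      also have "(\<Sum>i\<in>I - {j}. d i *\<^sub>R v i) = v j"
        unfolding c by (rule sum.cong) (auto simp: d_def)
      finally have "(\<Sum>i\<in>I. d i *\<^sub>R v i) = 0" by (simp add: d_def)
      then have "d j = 0" using assms(2) j unfolding indep_fam_def by blast
      then show False by (simp add: d_def)
    qed
    have rj: "r \<bullet> v j = r \<bullet> r" using r[OF p] by (simp add: r_def inner_diff_right)
    show ?thesis
    proof (intro exI ballI)
      fix i assume "i \<in> I"
      show "((1 / (r \<bullet> r)) *\<^sub>R r) \<bullet> v i = (if i = j then 1 else 0)"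
        using \<open>r \<noteq> 0\<close> rj r[of "v i"] \<open>i \<in> I\<close> by (auto simp: span_base)
    qed
  qed
  then show ?thesis using that by metis
qed

text \<open>Continuity of p suffices where q vanishes: with h = y - x, the error is p(x)(q(y) -
  q'(h)) + (p(y) - p(x)) q(y), and q(y) = O(h) makes the second part o(h) too. This is the passage
  from continuous to differentiable coefficients.\<close>

lemma has_derivative_mult_vanishing:
  fixes p q :: "'e::real_normed_vector \<Rightarrow> real"
  assumes p: "isCont p x" and q: "(q has_derivative q') (at x)" "q x = 0"
  shows "((\<lambda>y. p y * q y) has_derivative (\<lambda>h. p x * q' h)) (at x)"
  unfolding has_derivative_at_alt
proof (intro conjI allI impI)
  have bl: "bounded_linear q'" using q(1) by (rule has_derivative_bounded_linear)
  then show "bounded_linear (\<lambda>h. p x * q' h)" by (rule bounded_linear_const_mult)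
  obtain K where K: "K > 0" "\<And>h. norm (q' h) \<le> norm h * K"
    using bounded_linear.pos_bounded[OF bl] by blast
  fix e :: real assume e: "0 < e"
  \<comment> \<open>M dominates both |p x| and K + 1. The latter bounds |q y| / |y - x| once e1
    \<le> 1, and e1 * M \<le> e / 2 gives each of the two errors half of e.\<close>
  define M where "M = \<bar>p x\<bar> + K + 1"
  have M: "M > 0" "\<bar>p x\<bar> \<le> M" "K + 1 \<le> M" using K by (auto simp: M_def)
  define e1 where "e1 = min 1 (e / (2 * M))"
  have e1: "e1 > 0" "e1 \<le> 1" "e1 * M \<le> e / 2"
    using e M by (auto simp: e1_def min_def field_simps)
  obtain d1 where d1: "d1 > 0" "\<And>y. norm (y - x) < d1 \<Longrightarrow> norm (q y - q x - q' (y - x)) \<le> e1 * norm (y - x)"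
    using q(1) e1(1) unfolding has_derivative_at_alt by blast
  obtain d2 where d2: "d2 > 0" "\<And>y. norm (y - x) < d2 \<Longrightarrow> norm (p y - p x) < e1"
    using p e1(1) unfolding continuous_at_eps_delta dist_norm by blast
  have "norm (p y * q y - p x * q x - p x * q' (y - x)) \<le> e * norm (y - x)"
    if y: "norm (y - x) < min d1 d2" for y
  proof -
    have 1: "\<bar>q y - q' (y - x)\<bar> \<le> e1 * norm (y - x)" using d1(2)[of y] y q(2) by simp
    have 2: "\<bar>p y - p x\<bar> \<le> e1" using d2(2)[of y] y by simp
    have "e1 * norm (y - x) \<le> norm (y - x)" using e1 by (simp add: mult_left_le_one_le)
    then have 3: "\<bar>q y\<bar> \<le> norm (y - x) * (K + 1)"
      using 1 K(2)[of "y - x"] unfolding distrib_left real_norm_def by linarith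
    have "p y * q y - p x * q x - p x * q' (y - x) = p x * (q y - q' (y - x)) + (p y - p x) * q y"
      using q(2) by (simp add: algebra_simps)
    also have "\<bar>\<dots>\<bar> \<le> \<bar>p x\<bar> * \<bar>q y - q' (y - x)\<bar> + \<bar>p y - p x\<bar> * \<bar>q y\<bar>"
      by (metis abs_mult abs_triangle_ineq)
    also have "\<dots> \<le> M * (e1 * norm (y - x)) + e1 * (norm (y - x) * M)"
      using 1 2 3 M e1 by (intro add_mono mult_mono order_trans[OF 3] mult_left_mono) auto
    also have "\<dots> = 2 * (e1 * M) * norm (y - x)" by (simp add: algebra_simps)
    also have "\<dots> \<le> e * norm (y - x)" using e1(3) by (intro mult_right_mono) auto
    finally show ?thesis by simp
  qed
  then show "\<exists>d>0. \<forall>y. norm (y - x) < d \<longrightarrow>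
      norm (p y * q y - p x * q x - p x * q' (y - x)) \<le> e * norm (y - x)"
    using d1(1) d2(1) by (intro exI[of _ "min d1 d2"]) simp
qed

lemma dual_coeff_identity:
  fixes v v0 :: "'i \<Rightarrow> 'v::real_inner"
  assumes "finite I" and n: "\<And>i j. i \<in> I \<Longrightarrow> j \<in> I \<Longrightarrow> n j \<bullet> v0 i = (if i = j then 1 else 0)" and "j \<in> I"
  shows "d j = n j \<bullet> (\<Sum>i\<in>I. d i *\<^sub>R v i) - (\<Sum>i\<in>I. d i * (n j \<bullet> (v i - v0 i)))"
proof -
  have "(\<Sum>i\<in>I. d i * (n j \<bullet> v0 i)) = (\<Sum>i\<in>I. if i = j then d i else 0)"
    using n assms(3) by (intro sum.cong) auto
  also have "\<dots> = d j" using assms by simp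
  finally show ?thesis
    by (simp add: inner_sum_right inner_diff_right algebra_simps sum_subtractf)
qed

text \<open>Summed over j, the perturbation terms of \<open>dual_coeff_identity\<close> amount to at
  most half of the left-hand side, which absorbs them; this is the origin of the threshold. The 1
  added to \<open>card I\<close> keeps it meaningful for empty I.\<close>

lemma dual_coeff_bound:
  fixes v v0 :: "'i \<Rightarrow> 'v::real_inner"
  assumes "finite I" and n: "\<And>i j. i \<in> I \<Longrightarrow> j \<in> I \<Longrightarrow> n j \<bullet> v0 i = (if i = j then 1 else 0)"
    and small: "\<And>i j. i \<in> I \<Longrightarrow> j \<in> I \<Longrightarrow> \<bar>n j \<bullet> (v i - v0 i)\<bar> \<le> 1 / (2 * real (card I + 1))"
  shows "(\<Sum>j\<in>I. \<bar>d j\<bar>) \<le> 2 * (\<Sum>j\<in>I. \<bar>n j \<bullet> (\<Sum>i\<in>I. d i *\<^sub>R v i)\<bar>)"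
proof -
  let ?w = "\<Sum>i\<in>I. d i *\<^sub>R v i" and ?D = "\<Sum>j\<in>I. \<bar>d j\<bar>" and ?\<epsilon> = "1 / (2 * real (card I + 1))"
  have "\<bar>d j\<bar> \<le> \<bar>n j \<bullet> ?w\<bar> + ?\<epsilon> * ?D" if j: "j \<in> I" for j
  proof -
    have "\<bar>\<Sum>i\<in>I. d i * (n j \<bullet> (v i - v0 i))\<bar> \<le> (\<Sum>i\<in>I. \<bar>d i * (n j \<bullet> (v i - v0 i))\<bar>)"
      by (rule sum_abs)
    also have "\<dots> \<le> (\<Sum>i\<in>I. \<bar>d i\<bar> * ?\<epsilon>)"
      unfolding abs_mult using small[OF _ j] by (intro sum_mono mult_left_mono) auto
    also have "\<dots> = ?\<epsilon> * ?D" by (subst mult.commute) (rule sum_distrib_right[symmetric])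
    finally show ?thesis
      using dual_coeff_identity[OF assms(1) n j, where v=v and d=d] by linarith
  qed
  then have "?D \<le> (\<Sum>j\<in>I. \<bar>n j \<bullet> ?w\<bar> + ?\<epsilon> * ?D)" by (rule sum_mono)
  also have "\<dots> = (\<Sum>j\<in>I. \<bar>n j \<bullet> ?w\<bar>) + real (card I) * ?\<epsilon> * ?D" by (simp add: sum.distrib)
  also have "real (card I) * ?\<epsilon> * ?D \<le> (1/2) * ?D"
    by (intro mult_right_mono sum_nonneg) (auto simp: field_simps)
  finally show ?thesis by simp
qed

text \<open>
  At a point \<open>u\<close> where the number of independent vectors \<open>a i u\<close> is maximal over \<open>U\<close>, these vectors still
  span all others nearby. With \<open>n\<close> dual to them at \<open>u\<close>, the coefficients satisfy
  \<open>c\<^sub>j = n\<^sub>j \<bullet> b - (\<Sum>i. c\<^sub>i g\<^sub>j\<^sub>i)\<close> with \<open>g\<^sub>j\<^sub>i u = 0\<close>. They are therefore bounded near \<open>u\<close>, then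
  continuous at \<open>u\<close>, then differentiable at \<open>u\<close>.
\<close>

lemma generic_differentiable_coefficients:
  fixes a :: "'i \<Rightarrow> 'e::real_normed_vector \<Rightarrow> 'v::real_inner"
  assumes K: "finite K" and U: "open U" "U \<noteq> {}"
    and a: "\<And>i x. i \<in> K \<Longrightarrow> x \<in> U \<Longrightarrow> a i differentiable (at x)"
    and b: "\<And>x. x \<in> U \<Longrightarrow> b differentiable (at x)"
    and sol: "\<And>x. x \<in> U \<Longrightarrow> \<exists>c. b x = (\<Sum>i\<in>K. c i *\<^sub>R a i x)"
  shows "\<exists>u V c. open V \<and> u \<in> V \<and> V \<subseteq> U \<and> (\<forall>i\<in>K. c i differentiable (at u)) \<and>
    (\<forall>x\<in>V. b x = (\<Sum>i\<in>K. c i x *\<^sub>R a i x))"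
proof -
  define P where "P m \<longleftrightarrow> (\<exists>I x. I \<subseteq> K \<and> x \<in> U \<and> indep_fam I (\<lambda>i. a i x) \<and> card I = m)" for m
  have "P 0" using U(2) by (auto simp: P_def indep_fam_def intro!: exI[of _ "{}"])
  moreover have bd: "m \<le> card K" if "P m" for m
    using that K by (auto simp: P_def card_mono)
  ultimately obtain m where m: "P m" "\<And>k. P k \<Longrightarrow> k \<le> m"
    by (metis Greatest_le_nat GreatestI_nat)
  then obtain I u where I: "I \<subseteq> K" "u \<in> U" "indep_fam I (\<lambda>i. a i u)" "card I = m"
    unfolding P_def by blast
  have fI: "finite I" using I(1) K finite_subset by blast
  obtain n where n: "\<And>i j. i \<in> I \<Longrightarrow> j \<in> I \<Longrightarrow> n j \<bullet> a i u = (if i = j then 1 else 0)"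
    using indep_fam_dual[OF fI I(3)] by blast
  let ?\<epsilon> = "1 / (2 * real (card I + 1))"
  define g where "g j i x = n j \<bullet> (a i x - a i u)" for i j x
  have ev: "\<forall>\<^sub>F x in nhds u. x \<in> U \<and> (\<forall>i\<in>I. \<forall>j\<in>I. \<bar>g j i x\<bar> < ?\<epsilon>)"
  proof (intro eventually_conj eventually_ball_finite fI ballI)
    show "\<forall>\<^sub>F x in nhds u. x \<in> U" using U(1) I(2) by (simp add: eventually_nhds_in_open)
    fix i j assume ij: "i \<in> I" "j \<in> I"
    have "isCont (a i) u" using a[of i u] ij I by (auto intro: differentiable_imp_continuous_within)
    then have "isCont (\<lambda>x. \<bar>g j i x\<bar>) u" unfolding g_def by (intro continuous_intros)
    then have t: "((\<lambda>x. \<bar>g j i x\<bar>) \<longlongrightarrow> \<bar>g j i u\<bar>) (nhds u)"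
      unfolding isCont_def by (rule tendsto_at_iff_tendsto_nhds[THEN iffD1])
    have "\<bar>g j i u\<bar> < ?\<epsilon>" by (simp add: g_def)
    from order_tendstoD(2)[OF t this] show "\<forall>\<^sub>F x in nhds u. \<bar>g j i x\<bar> < ?\<epsilon>" .
  qed
  then obtain V where V: "open V" "u \<in> V" "\<And>x. x \<in> V \<Longrightarrow> x \<in> U"
    "\<And>x i j. x \<in> V \<Longrightarrow> i \<in> I \<Longrightarrow> j \<in> I \<Longrightarrow> \<bar>g j i x\<bar> < ?\<epsilon>"
    unfolding eventually_nhds by blast
  have bound: "(\<Sum>j\<in>I. \<bar>d j\<bar>) \<le> 2 * (\<Sum>j\<in>I. \<bar>n j \<bullet> (\<Sum>i\<in>I. d i *\<^sub>R a i x)\<bar>)" if "x \<in> V" for d x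
    by (rule dual_coeff_bound[OF fI n]) (use V(4)[OF that] in \<open>auto simp: g_def less_imp_le\<close>)
  \<comment> \<open>A relation at x makes the right-hand side of \<open>bound\<close> zero, so all
    its coefficients vanish: independence persists on V.\<close>
  have ind: "indep_fam I (\<lambda>i. a i x)" if x: "x \<in> V" for x
    unfolding indep_fam_def
  proof (intro allI impI ballI)
    fix d i assume 0: "(\<Sum>i\<in>I. d i *\<^sub>R a i x) = 0" and i: "i \<in> I"
    have "(\<Sum>j\<in>I. \<bar>d j\<bar>) \<le> 0" using bound[OF x, of d] by (simp add: 0)
    moreover have "\<bar>d i\<bar> \<le> (\<Sum>j\<in>I. \<bar>d j\<bar>)" using i fI by (intro member_le_sum) auto
    ultimately show "d i = 0" by simp
  qed
  have spans: "a k x \<in> span ((\<lambda>i. a i x) ` I)" if x: "x \<in> V" and k: "k \<in> K" for k x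
  proof (cases "k \<in> I")
    case True
    then show ?thesis by (simp add: span_base)
  next
    case False
    \<comment> \<open>Otherwise a larger independent family would exist at a point of U, against the
      maximality of m over all of U. In a resulting relation k must take part, as I alone is still
      independent at x.\<close>
    have "\<not> indep_fam (insert k I) (\<lambda>i. a i x)"
    proof
      assume "indep_fam (insert k I) (\<lambda>i. a i x)"
      then have "P (card (insert k I))" unfolding P_def using I(1) k V(3)[OF x] by blast
      then show False using m(2) I(4) False fI by fastforce
    qed
    then obtain d i where d: "(\<Sum>i\<in>insert k I. d i *\<^sub>R a i x) = 0" "i \<in> insert k I" "d i \<noteq> 0"
      unfolding indep_fam_def by blast
    then have s: "d k *\<^sub>R a k x + (\<Sum>i\<in>I. d i *\<^sub>R a i x) = 0" using False fI by simp
    have "d k \<noteq> 0"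
    proof
      assume "d k = 0"
      then have "(\<Sum>i\<in>I. d i *\<^sub>R a i x) = 0" using s by simp
      then show False using ind[OF x] d(2,3) \<open>d k = 0\<close> unfolding indep_fam_def by blast
    qed
    then have "a k x = (1 / d k) *\<^sub>R (d k *\<^sub>R a k x)" by simp
    also have "d k *\<^sub>R a k x = - (\<Sum>i\<in>I. d i *\<^sub>R a i x)"
      using s by (simp only: eq_neg_iff_add_eq_0)
    finally show ?thesis by (auto intro!: span_scale span_neg span_sum intro: span_base)
  qed
  have "\<exists>c. b x = (\<Sum>i\<in>I. c i *\<^sub>R a i x)" if x: "x \<in> V" for x
  proof -
    obtain c where "b x = (\<Sum>i\<in>K. c i *\<^sub>R a i x)" using sol V(3)[OF x] by blast
    then have "b x \<in> span ((\<lambda>i. a i x) ` I)" using spans[OF x] by (auto intro!: span_sum span_scale)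
    then show ?thesis using span_image_coeff[OF fI] by metis
  qed
  \<comment> \<open>The coefficients are chosen separately at each point, so regularity can come
    only from the identity \<open>id\<close> below.\<close>
  then obtain c' where c': "\<And>x. x \<in> V \<Longrightarrow> b x = (\<Sum>i\<in>I. c' x i *\<^sub>R a i x)" by metis
  have bu: "isCont b u" using b I(2) by (auto intro: differentiable_imp_continuous_within)
  have gu: "isCont (g j i) u" if "i \<in> I" for i j
  proof -
    have "isCont (a i) u" using a[of i u] that I by (auto intro: differentiable_imp_continuous_within)
    then show ?thesis unfolding g_def by (intro continuous_intros)
  qed
  have id: "c' x j = n j \<bullet> b x - (\<Sum>i\<in>I. c' x i * g j i x)" if "x \<in> V" "j \<in> I" for x j
    using dual_coeff_identity[OF fI n that(2), where d = "c' x" and v = "\<lambda>i. a i x"] c'[OF that(1)]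
    by (simp add: g_def)
  have nearV: "\<forall>\<^sub>F x in at u. x \<in> V" using V(1,2) by (rule eventually_at_in_open')
  have cont: "isCont (\<lambda>x. c' x j) u" if j: "j \<in> I" for j
  proof -
    \<comment> \<open>B bounds every coefficient and converges at u, so the products of coefficients
      with the vanishing g tend to 0 although no limit of the coefficients is known yet.\<close>
    define B where "B x = 2 * (\<Sum>j\<in>I. \<bar>n j \<bullet> b x\<bar>)" for x
    have Bc: "(B \<longlongrightarrow> B u) (at u)"
      using bu unfolding B_def isCont_def by (intro tendsto_intros)
    have "((\<lambda>x. c' x i * g j i x) \<longlongrightarrow> 0) (at u)" if i: "i \<in> I" for i
    proof (rule Lim_null_comparison)
      show "\<forall>\<^sub>F x in at u. norm (c' x i * g j i x) \<le> B x * \<bar>g j i x\<bar>"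
        using nearV
      proof eventually_elim
        case (elim x)
        have "\<bar>c' x i\<bar> \<le> (\<Sum>j\<in>I. \<bar>c' x j\<bar>)" using i fI by (intro member_le_sum) auto
        also have "\<dots> \<le> B x" using bound[OF elim, of "c' x"] by (simp add: B_def c'[OF elim])
        finally show ?case by (simp add: abs_mult mult_right_mono)
      qed
      have "(g j i \<longlongrightarrow> 0) (at u)" using gu[OF i, of j] by (simp add: isCont_def g_def[of j i u])
      from tendsto_mult[OF Bc tendsto_rabs[OF this]]
      show "((\<lambda>x. B x * \<bar>g j i x\<bar>) \<longlongrightarrow> 0) (at u)" by simp
    qed
    then have "((\<lambda>x. n j \<bullet> b x - (\<Sum>i\<in>I. c' x i * g j i x)) \<longlongrightarrow> n j \<bullet> b u - (\<Sum>i\<in>I. 0)) (at u)"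
      using bu unfolding isCont_def by (intro tendsto_intros) auto
    then have "((\<lambda>x. c' x j) \<longlongrightarrow> n j \<bullet> b u - (\<Sum>i\<in>I. 0)) (at u)"
      by (rule Lim_transform_eventually) (rule eventually_mono[OF nearV id[OF _ j, symmetric]])
    moreover have "c' u j = n j \<bullet> b u" using id[OF V(2) j] by (simp add: g_def)
    ultimately show ?thesis by (simp add: isCont_def)
  qed
  have diff: "(\<lambda>x. c' x j) differentiable (at u)" if j: "j \<in> I" for j
  proof -
    have g': "(g j i has_derivative (\<lambda>h. n j \<bullet> fderiv (a i) u h)) (at u)" if "i \<in> I" for i
      unfolding g_def using a[of i u] that I
      by (auto intro!: derivative_eq_intros has_derivative_fderiv)
    have "((\<lambda>x. n j \<bullet> b x - (\<Sum>i\<in>I. c' x i * g j i x)) has_derivative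
       (\<lambda>h. n j \<bullet> fderiv b u h - (\<Sum>i\<in>I. c' u i * (n j \<bullet> fderiv (a i) u h)))) (at u)"
      by (intro has_derivative_diff has_derivative_sum has_derivative_inner_right has_derivative_fderiv
          has_derivative_mult_vanishing cont g' b I) (simp_all add: g_def)
    then show ?thesis
      by (rule differentiableI[OF has_derivative_transform_within_open[OF _ V(1,2) id[OF _ j, symmetric]]])
  qed
  \<comment> \<open>Coefficients outside the chosen independent subfamily are set to 0.\<close>
  define c where "c i x = (if i \<in> I then c' x i else 0)" for i x
  show ?thesis
  proof (intro exI[of _ u] exI[of _ V] exI[of _ c] conjI ballI)
    show "open V" "u \<in> V" by (fact V)+
    show "V \<subseteq> U" using V(3) by blast
    show "c i differentiable (at u)" if "i \<in> K" for i
      unfolding c_def using diff by (cases "i \<in> I") auto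
    show "b x = (\<Sum>i\<in>K. c i x *\<^sub>R a i x)" if "x \<in> V" for x
    proof -
      have "(\<Sum>i\<in>K. c i x *\<^sub>R a i x) = (\<Sum>i\<in>I. c i x *\<^sub>R a i x)"
        by (rule sum.mono_neutral_right[OF K I(1)]) (auto simp: c_def)
      also have "\<dots> = b x" unfolding c'[OF that] by (rule sum.cong) (auto simp: c_def)
      finally show ?thesis by simp
    qed
  qed
qed

section \<open>Charts and transition maps\<close>

lemma smooth_manifold_parseval:
  fixes A :: "('a::{t2_space, second_countable_topology}, 'e::real_inner) chart set"
  assumes "smooth_manifold A"
  obtains b :: "'e set" where "parseval b"
  using assms parseval_on_span_exists unfolding smooth_manifold_def by metis

lemma smooth_manifold_chart:
  assumes "smooth_manifold A" "c \<in> A"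
  shows "is_chart c"
  using assms unfolding smooth_manifold_def by blast

lemma chart_at:
  assumes "smooth_manifold A"
  shows "chart_at A p \<in> A" "p \<in> cdom (chart_at A p)"
proof -
  obtain c where "c \<in> A \<and> p \<in> cdom c" using assms unfolding smooth_manifold_def by blast
  from someI[of "\<lambda>c. c \<in> A \<and> p \<in> cdom c", OF this]
  show "chart_at A p \<in> A" "p \<in> cdom (chart_at A p)" by (simp_all add: chart_at_def)
qed

lemma chart_open: "is_chart c \<Longrightarrow> open (cdom c)" "is_chart c \<Longrightarrow> open (cmap c ` cdom c)"
  by (simp_all add: is_chart_def)

lemma cinv_cmap: "is_chart c \<Longrightarrow> p \<in> cdom c \<Longrightarrow> cinv c (cmap c p) = p"
  by (auto simp: is_chart_def homeomorphism_def)

lemma cinv_in: "is_chart c \<Longrightarrow> u \<in> cmap c ` cdom c \<Longrightarrow> cinv c u \<in> cdom c"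
  by (auto simp: is_chart_def homeomorphism_def)

lemma chart_continuous:
  "is_chart c \<Longrightarrow> continuous_on (cdom c) (cmap c)"
  "is_chart c \<Longrightarrow> continuous_on (cmap c ` cdom c) (cinv c)"
  by (auto simp: is_chart_def homeomorphism_def)

lemma chart_image_eq:
  assumes "is_chart c"
  shows "cmap c ` (cdom c \<inter> U) = cmap c ` cdom c \<inter> cinv c -` U"
  using cinv_cmap[OF assms] by auto

lemma chart_image_open:
  assumes "is_chart c" "open U"
  shows "open (cmap c ` (cdom c \<inter> U))"
  unfolding chart_image_eq[OF assms(1)]
  using continuous_open_preimage[OF chart_continuous(2)[OF assms(1)] chart_open(2)[OF assms(1)] assms(2)] .

lemma chart_preimage_open:
  assumes "is_chart c" "open V"
  shows "open (cdom c \<inter> cmap c -` V)"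
  using continuous_open_preimage[OF chart_continuous(1)[OF assms(1)] chart_open(1)[OF assms(1)] assms(2)] .

definition lrep :: "('a, 'e) chart \<Rightarrow> ('b, 'f) chart \<Rightarrow> ('a \<Rightarrow> 'b) \<Rightarrow> 'e \<Rightarrow> 'f" where
  "lrep c d \<phi> = cmap d \<circ> \<phi> \<circ> cinv c"

text \<open>The derivative between two freely chosen charts. \<open>dchart\<close> and
  \<open>dchart_inv\<close> are the case of the identity map and \<open>tangent_map\<close> that of
  the preferred charts, so the one chain rule \<open>jac_chain\<close> governs all changes of
  coordinates.\<close>

definition jac :: "('a, 'e::real_normed_vector) chart \<Rightarrow> ('b, 'f::real_normed_vector) chart \<Rightarrow>
    ('a \<Rightarrow> 'b) \<Rightarrow> 'a \<Rightarrow> ('e \<Rightarrow>\<^sub>L 'f)" where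
  "jac c d \<phi> p = fderiv (lrep c d \<phi>) (cmap c p)"

lemma smooth_map_ident:
  assumes "smooth_manifold A"
  shows "smooth_map A A (\<lambda>x. x)"
  using assms unfolding smooth_map_def smooth_manifold_def by (simp add: o_def)

lemma lrep_smooth:
  assumes "smooth_map A B \<phi>" "c \<in> A" "d \<in> B"
  shows "smooth_on (cmap c ` (cdom c \<inter> \<phi> -` cdom d)) (lrep c d \<phi>)"
  using assms unfolding smooth_map_def lrep_def by blast

lemma lrep_domain_open:
  assumes "smooth_manifold A" "smooth_manifold B" "smooth_map A B \<phi>" "c \<in> A" "d \<in> B"
  shows "open (cmap c ` (cdom c \<inter> \<phi> -` cdom d))"
proof -
  have "open (\<phi> -` cdom d)"
    using assms by (intro open_vimage chart_open smooth_manifold_chart) (auto simp: smooth_map_def)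
  then show ?thesis by (intro chart_image_open smooth_manifold_chart[OF assms(1,4)])
qed

lemma lrep_cmap:
  assumes "is_chart c" "p \<in> cdom c"
  shows "lrep c d \<phi> (cmap c p) = cmap d (\<phi> p)"
  by (simp add: lrep_def cinv_cmap[OF assms])

lemma jac_has_derivative:
  assumes "smooth_map A B \<phi>" "c \<in> A" "d \<in> B" "p \<in> cdom c" "\<phi> p \<in> cdom d"
  shows "(lrep c d \<phi> has_derivative blinfun_apply (jac c d \<phi> p)) (at (cmap c p))"
  unfolding jac_def by (rule smooth_on_has_derivative[OF lrep_smooth[OF assms(1-3)]]) (use assms(4,5) in blast)

lemma jac_chain:
  assumes A: "smooth_manifold A" and B: "smooth_manifold B" and C: "smooth_manifold C"
    and \<phi>: "smooth_map A B \<phi>" and \<xi>: "smooth_map B C \<xi>"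
    and c: "c \<in> A" and d: "d \<in> B" and e: "e \<in> C"
    and p: "p \<in> cdom c" "\<phi> p \<in> cdom d" "\<xi> (\<phi> p) \<in> cdom e"
  shows "jac c e (\<lambda>x. \<xi> (\<phi> x)) p = jac d e \<xi> (\<phi> p) o\<^sub>L jac c d \<phi> p"
proof -
  note ch = smooth_manifold_chart[OF A c] smooth_manifold_chart[OF B d]
  have h: "((\<lambda>u. lrep d e \<xi> (lrep c d \<phi> u)) has_derivative
      (\<lambda>v. jac d e \<xi> (\<phi> p) (jac c d \<phi> p v))) (at (cmap c p))"
    using jac_has_derivative[OF \<xi> d e p(2,3)]
    by (intro has_derivative_compose[OF jac_has_derivative[OF \<phi> c d p(1,2)]])
      (simp add: lrep_cmap[OF ch(1) p(1)])
  have eq: "lrep d e \<xi> (lrep c d \<phi> u) = lrep c e (\<lambda>x. \<xi> (\<phi> x)) u"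
    if "u \<in> cmap c ` (cdom c \<inter> \<phi> -` cdom d)" for u
    using that by (auto simp: lrep_cmap[OF ch(1)] lrep_cmap[OF ch(2)])
  have "(lrep c e (\<lambda>x. \<xi> (\<phi> x)) has_derivative (\<lambda>v. jac d e \<xi> (\<phi> p) (jac c d \<phi> p v))) (at (cmap c p))"
    by (rule has_derivative_transform_within_open[OF h lrep_domain_open[OF A B \<phi> c d] _ eq])
      (use p in blast)
  moreover have "blinfun_apply (jac d e \<xi> (\<phi> p) o\<^sub>L jac c d \<phi> p) = (\<lambda>v. jac d e \<xi> (\<phi> p) (jac c d \<phi> p v))"
    by (rule ext) simp
  ultimately show ?thesis
    unfolding jac_def[of c e] by (intro fderiv_eqI) (simp only:)
qed

lemma jac_ident:
  assumes "smooth_manifold A" "c \<in> A" "p \<in> cdom c"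
  shows "jac c c (\<lambda>x. x) p = id_blinfun"
  unfolding jac_def
proof (rule fderiv_eqI)
  note ch = smooth_manifold_chart[OF assms(1,2)]
  show "(lrep c c (\<lambda>x. x) has_derivative blinfun_apply id_blinfun) (at (cmap c p))"
    by (rule has_derivative_transform_within_open[OF _ chart_open(2)[OF ch], of "\<lambda>x. x"])
      (use assms(3) in \<open>auto simp: lrep_cmap[OF ch]\<close>)
qed

lemma dchart_jac: "dchart A c p = jac (chart_at A p) c (\<lambda>x. x) p"
  by (simp add: dchart_def jac_def lrep_def o_def)

lemma dchart_inv_jac: "dchart_inv A c p = jac c (chart_at A p) (\<lambda>x. x) p"
  by (simp add: dchart_inv_def jac_def lrep_def o_def)

lemma tangent_map_jac: "tangent_map A B \<psi> p = jac (chart_at A p) (chart_at B (\<psi> p)) \<psi> p"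
  by (simp add: tangent_map_def jac_def lrep_def o_def)

lemma dchart_dchart_inv:
  assumes A: "smooth_manifold A" and c: "c \<in> A" "p \<in> cdom c"
  shows "dchart A c p o\<^sub>L dchart_inv A c p = id_blinfun"
    and "dchart_inv A c p o\<^sub>L dchart A c p = id_blinfun"
  using jac_chain[OF A A A smooth_map_ident[OF A] smooth_map_ident[OF A] c(1) chart_at(1)[OF A] c(1) c(2)
      chart_at(2)[OF A] c(2)]
    jac_chain[OF A A A smooth_map_ident[OF A] smooth_map_ident[OF A] chart_at(1)[OF A] c(1) chart_at(1)[OF A]
      chart_at(2)[OF A] c(2) chart_at(2)[OF A]]
  by (simp_all add: dchart_jac dchart_inv_jac jac_ident[OF A c] jac_ident[OF A chart_at[OF A]])

lemma dchart_cancel: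
  assumes A: "smooth_manifold A" and c: "c \<in> A" "p \<in> cdom c"
  shows "dchart A c p (dchart_inv A c p v) = v" "dchart_inv A c p (dchart A c p v) = v"
  using dchart_dchart_inv[OF assms] by (metis blinfun_apply_blinfun_compose blinfun_apply_id_blinfun)+

lemma dchart_chart_at:
  assumes "smooth_manifold A"
  shows "dchart A (chart_at A p) p = id_blinfun" "dchart_inv A (chart_at A p) p = id_blinfun"
  by (simp_all add: dchart_jac dchart_inv_jac jac_ident[OF assms chart_at[OF assms]])

text \<open>Both sides are the Jacobian of \<phi> from the preferred chart at p to d, factored
  through c or through the preferred chart at \<phi> p.\<close>

lemma jac_dchart:
  assumes A: "smooth_manifold A" and B: "smooth_manifold B" and \<phi>: "smooth_map A B \<phi>"
    and c: "c \<in> A" "p \<in> cdom c" and d: "d \<in> B" "\<phi> p \<in> cdom d"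
  shows "jac c d \<phi> p o\<^sub>L dchart A c p = dchart B d (\<phi> p) o\<^sub>L tangent_map A B \<phi> p"
  unfolding dchart_jac tangent_map_jac
  using jac_chain[OF A A B smooth_map_ident[OF A] \<phi> chart_at(1)[OF A] c(1) d(1) chart_at(2)[OF A] c(2) d(2)]
    jac_chain[OF A B B \<phi> smooth_map_ident[OF B] chart_at(1)[OF A] chart_at(1)[OF B] d(1) chart_at(2)[OF A]
      chart_at(2)[OF B] d(2)]
  by simp

lemma jac_dchart_apply:
  assumes "smooth_manifold A" "smooth_manifold B" "smooth_map A B \<phi>"
    "c \<in> A" "p \<in> cdom c" "d \<in> B" "\<phi> p \<in> cdom d"
  shows "jac c d \<phi> p (dchart A c p v) = dchart B d (\<phi> p) (tangent_map A B \<phi> p v)"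
  using jac_dchart[OF assms] by (metis blinfun_apply_blinfun_compose)

lemma tangent_map_dchart_inv:
  assumes A: "smooth_manifold A" and B: "smooth_manifold B" and \<phi>: "smooth_map A B \<phi>"
    and c: "c \<in> A" "p \<in> cdom c" and d: "d \<in> B" "\<phi> p \<in> cdom d"
  shows "tangent_map A B \<phi> p (dchart_inv A c p v) = dchart_inv B d (\<phi> p) (jac c d \<phi> p v)"
  using jac_dchart_apply[OF assms, of "dchart_inv A c p v"]
  by (metis dchart_cancel[OF A c] dchart_cancel[OF B d])

lemma tangent_map_ident:
  assumes "smooth_manifold A"
  shows "tangent_map A A (\<lambda>x. x) p = id_blinfun"
  by (simp add: tangent_map_jac jac_ident[OF assms chart_at[OF assms]])

section \<open>Local representations of related fields\<close>

lemma vrep_cmap: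
  assumes "is_chart c" "p \<in> cdom c"
  shows "vrep A c X (cmap c p) = dchart A c p (X p)"
  by (simp add: vrep_def cinv_cmap[OF assms])

lemma crep_cmap:
  assumes "is_chart c" "p \<in> cdom c"
  shows "crep A c \<alpha> (cmap c p) = \<alpha> p o\<^sub>L dchart_inv A c p"
  by (simp add: crep_def cinv_cmap[OF assms])

lemma erep_cmap:
  assumes "is_chart c" "p \<in> cdom c"
  shows "erep A c r (cmap c p) = dchart A c p o\<^sub>L r p o\<^sub>L dchart_inv A c p"
  by (simp add: erep_def cinv_cmap[OF assms])

lemma vrep_app:
  assumes A: "smooth_manifold A" "c \<in> A" and u: "u \<in> cmap c ` cdom c"
  shows "vrep A c (app r X) u = erep A c r u (vrep A c X u)"
  using cinv_in[OF smooth_manifold_chart[OF A] u]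
  by (simp add: vrep_def erep_def app_def dchart_cancel[OF A])

lemma crep_app_dual:
  assumes A: "smooth_manifold A" "c \<in> A" and u: "u \<in> cmap c ` cdom c"
  shows "crep A c (app_dual r \<alpha>) u = crep A c \<alpha> u o\<^sub>L erep A c r u"
  using cinv_in[OF smooth_manifold_chart[OF A] u]
  by (intro blinfun_eqI) (simp add: crep_def erep_def app_dual_def dchart_cancel[OF A])

context
  fixes A :: "('a::{t2_space, second_countable_topology}, 'e::real_inner) chart set"
    and B :: "('b::{t2_space, second_countable_topology}, 'f::real_inner) chart set"
    and \<phi> :: "'a \<Rightarrow> 'b" and c d p
  assumes A: "smooth_manifold A" and B: "smooth_manifold B" and \<phi>: "smooth_map A B \<phi>"
    and c: "c \<in> A" "p \<in> cdom c" and d: "d \<in> B" "\<phi> p \<in> cdom d"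
begin

text \<open>This lemma and the next two serve twice: with the map between the manifolds, and with
  the identity, where they express a change of charts.\<close>

lemma vrep_related:
  assumes "tangent_map A B \<phi> p (X p) = Y (\<phi> p)"
  shows "jac c d \<phi> p (vrep A c X (cmap c p)) = vrep B d Y (cmap d (\<phi> p))"
  by (simp add: vrep_cmap[OF smooth_manifold_chart[OF A c(1)] c(2)] jac_dchart_apply[OF A B \<phi> c d]
      vrep_cmap[OF smooth_manifold_chart[OF B d(1)] d(2)] assms)

lemma crep_related:
  assumes "\<alpha> p = \<beta> (\<phi> p) o\<^sub>L tangent_map A B \<phi> p"
  shows "crep A c \<alpha> (cmap c p) = crep B d \<beta> (cmap d (\<phi> p)) o\<^sub>L jac c d \<phi> p"
  by (rule blinfun_eqI)
    (simp add: crep_cmap[OF smooth_manifold_chart[OF A c(1)] c(2)] tangent_map_dchart_inv[OF A B \<phi> c d]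
      crep_cmap[OF smooth_manifold_chart[OF B d(1)] d(2)] assms)

lemma erep_related:
  assumes "r\<^sub>N (\<phi> p) o\<^sub>L tangent_map A B \<phi> p = tangent_map A B \<phi> p o\<^sub>L r\<^sub>M p"
  shows "erep B d r\<^sub>N (cmap d (\<phi> p)) o\<^sub>L jac c d \<phi> p = jac c d \<phi> p o\<^sub>L erep A c r\<^sub>M (cmap c p)"
proof (rule blinfun_eqI)
  fix v
  have "r\<^sub>N (\<phi> p) (tangent_map A B \<phi> p w) = tangent_map A B \<phi> p (r\<^sub>M p w)" for w
    using assms by (metis blinfun_apply_blinfun_compose)
  then show "(erep B d r\<^sub>N (cmap d (\<phi> p)) o\<^sub>L jac c d \<phi> p) v = (jac c d \<phi> p o\<^sub>L erep A c r\<^sub>M (cmap c p)) v"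
    by (simp add: erep_cmap[OF smooth_manifold_chart[OF A c(1)] c(2)] jac_dchart_apply[OF A B \<phi> c d]
      erep_cmap[OF smooth_manifold_chart[OF B d(1)] d(2)] flip: tangent_map_dchart_inv[OF A B \<phi> c d])
qed

end

section \<open>The operator in an arbitrary chart\<close>

lemma smooth_vfield_on_vrep:
  "smooth_vfield_on A UNIV X \<Longrightarrow> c \<in> A \<Longrightarrow> smooth_on (cmap c ` cdom c) (vrep A c X)"
  by (simp add: smooth_vfield_on_def)

lemma smooth_oneform_on_crep:
  "smooth_oneform_on A UNIV \<alpha> \<Longrightarrow> c \<in> A \<Longrightarrow> smooth_on (cmap c ` cdom c) (crep A c \<alpha>)"
  by (simp add: smooth_oneform_on_def)

lemma smooth_endofield_erep:
  "smooth_endofield A r \<Longrightarrow> c \<in> A \<Longrightarrow> smooth_on (cmap c ` cdom c) (erep A c r)"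
  by (simp add: smooth_endofield_def)

text \<open>In the preferred chart at p, \<open>dchart\<close> is the identity at p, so the defining
  formulas are already the coordinate ones. The product rule for \<open>app r X\<close> produces the
  derivative of X that cancels against the second bracket.\<close>

lemma D_vec_chart_at:
  fixes p
  assumes A: "smooth_manifold A" and r: "smooth_endofield A r"
    and X: "smooth_vfield_on A UNIV X" and Y: "smooth_vfield_on A UNIV Y"
  defines "c \<equiv> chart_at A p"
  defines "u \<equiv> cmap c p"
  shows "D_vec A r X Y p = D_vec_coord (erep A c r) (vrep A c X u) (vrep A c Y) u"
proof -
  have c: "c \<in> A" "p \<in> cdom c" unfolding c_def by (rule chart_at[OF A])+
  note ch = smooth_manifold_chart[OF A c(1)]
  have u: "u \<in> cmap c ` cdom c" unfolding u_def using c(2) by (rule imageI)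
  have rp: "r p = erep A c r u"
  proof (rule blinfun_eqI)
    have "erep A c r u = dchart A c p o\<^sub>L r p o\<^sub>L dchart_inv A c p"
      unfolding u_def by (rule erep_cmap[OF ch c(2)])
    moreover have "dchart A c p = id_blinfun" "dchart_inv A c p = id_blinfun"
      unfolding c_def by (rule dchart_chart_at[OF A])+
    ultimately show "r p v = erep A c r u v" for v by simp
  qed
  have "((\<lambda>v. erep A c r v (vrep A c X v)) has_derivative
      (\<lambda>Z. erep A c r u (fderiv (vrep A c X) u Z) + fderiv (erep A c r) u Z (vrep A c X u))) (at u)"
    by (intro blinfun.FDERIV smooth_on_has_derivative[OF _ u] smooth_endofield_erep r X c
        smooth_vfield_on_vrep)
  then have "(vrep A c (app r X) has_derivative
      (\<lambda>Z. erep A c r u (fderiv (vrep A c X) u Z) + fderiv (erep A c r) u Z (vrep A c X u))) (at u)"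
    by (rule has_derivative_transform_within_open[OF _ chart_open(2)[OF ch] u])
      (simp add: vrep_app[OF A c(1)])
  from fderiv_apply[OF this] show ?thesis
    by (simp add: D_vec_def lie_bracket_def D_vec_coord_def Let_def app_def rp vrep_app[OF A c(1) u]
        blinfun.diff_right flip: c_def u_def)
qed

lemma D_dual_chart_at:
  fixes p
  assumes A: "smooth_manifold A" and r: "smooth_endofield A r"
    and X: "smooth_vfield_on A UNIV X" and \<alpha>: "smooth_oneform_on A UNIV \<alpha>"
  defines "c \<equiv> chart_at A p"
  defines "u \<equiv> cmap c p"
  shows "D_dual A r X \<alpha> p W = D_dual_coord (erep A c r) (vrep A c X u) (crep A c \<alpha>) u W"
proof -
  have c: "c \<in> A" "p \<in> cdom c" unfolding c_def by (rule chart_at[OF A])+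
  note ch = smooth_manifold_chart[OF A c(1)]
  have u: "u \<in> cmap c ` cdom c" unfolding u_def using c(2) by (rule imageI)
  have "((\<lambda>v. erep A c r v (vrep A c X v)) has_derivative
      (\<lambda>Z. erep A c r u (fderiv (vrep A c X) u Z) + fderiv (erep A c r) u Z (vrep A c X u))) (at u)"
    by (intro blinfun.FDERIV smooth_on_has_derivative[OF _ u] smooth_endofield_erep r X c
        smooth_vfield_on_vrep)
  then have 1: "(vrep A c (app r X) has_derivative
      (\<lambda>Z. erep A c r u (fderiv (vrep A c X) u Z) + fderiv (erep A c r) u Z (vrep A c X u))) (at u)"
    by (rule has_derivative_transform_within_open[OF _ chart_open(2)[OF ch] u])
      (simp add: vrep_app[OF A c(1)])
  have "((\<lambda>v. crep A c \<alpha> v o\<^sub>L erep A c r v) has_derivative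
      (\<lambda>Z. (crep A c \<alpha> u o\<^sub>L fderiv (erep A c r) u Z) + (fderiv (crep A c \<alpha>) u Z o\<^sub>L erep A c r u))) (at u)"
    by (intro bounded_bilinear.FDERIV[OF bounded_bilinear_blinfun_compose] smooth_on_has_derivative[OF _ u]
        smooth_endofield_erep r \<alpha> c smooth_oneform_on_crep)
  then have 2: "(crep A c (app_dual r \<alpha>) has_derivative
      (\<lambda>Z. (crep A c \<alpha> u o\<^sub>L fderiv (erep A c r) u Z) + (fderiv (crep A c \<alpha>) u Z o\<^sub>L erep A c r u))) (at u)"
    by (rule has_derivative_transform_within_open[OF _ chart_open(2)[OF ch] u])
      (simp add: crep_app_dual[OF A c(1)])
  show ?thesis
    by (simp add: D_dual_def lie_deriv_def D_dual_coord_def Let_def fderiv_apply[OF 1] fderiv_apply[OF 2]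
        vrep_app[OF A c(1) u] crep_app_dual[OF A c(1) u] blinfun.add_left blinfun.diff_left blinfun.add_right
        flip: c_def u_def)
qed

text \<open>The definitions compute at p in \<open>chart_at A p\<close>, which may jump with p.
  Naturality under the transition map f from that chart to c gives the same formula at all points of
  one fixed chart, which smoothness and comparison of derivatives require.\<close>

lemma D_gen_local:
  fixes A :: "('a::{t2_space, second_countable_topology}, 'e::real_inner) chart set"
  assumes A: "smooth_manifold A" and r: "smooth_endofield A r" and X: "smooth_vfield_on A UNIV X"
    and c: "c \<in> A" and u: "u \<in> cmap c ` cdom c"
  shows "smooth_vfield_on A UNIV Y \<Longrightarrow>
      vrep A c (D_vec A r X Y) u = D_vec_coord (erep A c r) (vrep A c X u) (vrep A c Y) u"
    and "smooth_oneform_on A UNIV \<alpha> \<Longrightarrow>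
      crep A c (D_dual A r X \<alpha>) u W = D_dual_coord (erep A c r) (vrep A c X u) (crep A c \<alpha>) u W"
proof -
  obtain p where p: "p \<in> cdom c" "u = cmap c p" using u by blast
  define c' where "c' = chart_at A p"
  define u' where "u' = cmap c' p"
  have c': "c' \<in> A" "p \<in> cdom c'" unfolding c'_def by (rule chart_at[OF A])+
  note ch = smooth_manifold_chart[OF A c] and ch' = smooth_manifold_chart[OF A c'(1)]
  note id = smooth_map_ident[OF A]
  define S where "S = cmap c' ` (cdom c' \<inter> cdom c)"
  define f where "f = lrep c' c (\<lambda>x. x)"
  have S: "open S" "u' \<in> S"
    using chart_image_open[OF ch' chart_open(1)[OF ch]] c'(2) p(1) by (auto simp: S_def u'_def)
  have fS: "smooth_on S f"
    using lrep_smooth[OF id c'(1) c] by (simp add: S_def f_def)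
  obtain b :: "'e set" where b: "parseval b" using smooth_manifold_parseval[OF A] .
  have f1: "f differentiable (at x)" if "x \<in> S" for x using smooth_on_differentiable[OF fS that] .
  have f2: "fderiv f differentiable (at u')"
    using smooth_on_differentiable[OF smooth_on_fderiv[OF b S(1) fS] S(2)] .
  have fu: "f u' = u" by (simp add: f_def u'_def lrep_cmap[OF ch' c'(2)] p(2))
  have u': "u' \<in> cmap c' ` cdom c'" using c'(2) by (simp add: u'_def)
  have R1: "erep A c' r differentiable (at u')"
    by (rule smooth_on_differentiable[OF smooth_endofield_erep[OF r c'(1)] u'])
  have R2: "erep A c r differentiable (at (f u'))"
    unfolding fu by (rule smooth_on_differentiable[OF smooth_endofield_erep[OF r c] u])
  have R3: "erep A c r (f x) o\<^sub>L fderiv f x = fderiv f x o\<^sub>L erep A c' r x" if "x \<in> S" for x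
  proof -
    obtain q where q: "q \<in> cdom c'" "q \<in> cdom c" "x = cmap c' q" using \<open>x \<in> S\<close> by (auto simp: S_def)
    have "erep A c r (cmap c q) o\<^sub>L jac c' c (\<lambda>x. x) q = jac c' c (\<lambda>x. x) q o\<^sub>L erep A c' r (cmap c' q)"
      by (rule erep_related[OF A A id c'(1) q(1) c q(2)])
        (rule blinfun_eqI, simp add: tangent_map_ident[OF A])
    then show ?thesis by (simp add: f_def q(3) lrep_cmap[OF ch' q(1)] jac_def)
  qed
  have J: "fderiv f u' = dchart A c p"
    by (simp add: f_def u'_def dchart_jac jac_def c'_def)
  have X': "fderiv f u' (vrep A c' X u') = vrep A c X u"
    using vrep_related[OF A A id c' c p(1), of X X]
    by (simp add: tangent_map_ident[OF A] f_def u'_def p(2) jac_def)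
  {
    assume Y: "smooth_vfield_on A UNIV Y"
    have y: "vrep A c' Y differentiable (at u')" "vrep A c Y differentiable (at (f u'))"
      unfolding fu by (rule smooth_on_differentiable[OF smooth_vfield_on_vrep[OF Y]]; fact)+
    have y3: "fderiv f x (vrep A c' Y x) = vrep A c Y (f x)" if "x \<in> S" for x
    proof -
      obtain q where q: "q \<in> cdom c'" "q \<in> cdom c" "x = cmap c' q" using \<open>x \<in> S\<close> by (auto simp: S_def)
      show ?thesis
        using vrep_related[OF A A id c'(1) q(1) c q(2), of Y Y]
        by (simp add: tangent_map_ident[OF A] f_def q(3) lrep_cmap[OF ch' q(1)] jac_def)
    qed
    have "vrep A c (D_vec A r X Y) u = dchart A c p (D_vec A r X Y p)"
      unfolding p(2) by (rule vrep_cmap[OF ch p(1)])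
    also have "\<dots> = fderiv f u' (D_vec_coord (erep A c' r) (vrep A c' X u') (vrep A c' Y) u')"
      by (simp only: D_vec_chart_at[OF A r X Y, of p, folded c'_def, folded u'_def] J)
    also have "\<dots> = D_vec_coord (erep A c r) (vrep A c X u) (vrep A c Y) u"
      using D_vec_coord_natural[OF S f1 f2 R1 R2 R3 y y3, of "vrep A c' X u'"] by (simp only: X' fu)
    finally show "vrep A c (D_vec A r X Y) u = D_vec_coord (erep A c r) (vrep A c X u) (vrep A c Y) u" .
  }
  {
    assume \<alpha>: "smooth_oneform_on A UNIV \<alpha>"
    have a: "crep A c' \<alpha> differentiable (at u')" "crep A c \<alpha> differentiable (at (f u'))"
      unfolding fu by (rule smooth_on_differentiable[OF smooth_oneform_on_crep[OF \<alpha>]]; fact)+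
    have a3: "crep A c' \<alpha> x = crep A c \<alpha> (f x) o\<^sub>L fderiv f x" if "x \<in> S" for x
    proof -
      obtain q where q: "q \<in> cdom c'" "q \<in> cdom c" "x = cmap c' q" using \<open>x \<in> S\<close> by (auto simp: S_def)
      have "\<alpha> q = \<alpha> q o\<^sub>L tangent_map A A (\<lambda>x. x) q"
        by (rule blinfun_eqI) (simp add: tangent_map_ident[OF A])
      from crep_related[OF A A id c'(1) q(1) c q(2), of \<alpha> \<alpha>, OF this]
      show ?thesis by (simp add: f_def q(3) lrep_cmap[OF ch' q(1)] jac_def)
    qed
    \<comment> \<open>\<open>D_dual_coord_natural\<close> evaluates only on vectors in the image of
      Df, so W is first written as such an image.\<close>
    have W: "fderiv f u' (dchart_inv A c p W) = W"
      by (simp add: J dchart_cancel[OF A c p(1)])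
    have "crep A c (D_dual A r X \<alpha>) u W = D_dual A r X \<alpha> p (dchart_inv A c p W)"
      unfolding p(2) by (simp add: crep_cmap[OF ch p(1)])
    also have "\<dots> = D_dual_coord (erep A c' r) (vrep A c' X u') (crep A c' \<alpha>) u' (dchart_inv A c p W)"
      by (simp only: D_dual_chart_at[OF A r X \<alpha>, of p, folded c'_def, folded u'_def])
    also have "\<dots> = D_dual_coord (erep A c r) (vrep A c X u) (crep A c \<alpha>) u W"
      using D_dual_coord_natural[OF S f1 f2 R1 R2 R3 a a3, of "vrep A c' X u'" "dchart_inv A c p W"]
      by (simp only: X' fu W)
    finally show "crep A c (D_dual A r X \<alpha>) u W = D_dual_coord (erep A c r) (vrep A c X u) (crep A c \<alpha>) u W" .
  }
qed

section \<open>Bump functions and global sections\<close>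

text \<open>The powers of t in the denominator make the family closed under differentiation: the
  derivative of \<open>flat n\<close> is a combination of \<open>flat (n + 2)\<close> and
  \<open>flat (n + 1)\<close>, so smoothness follows by induction for all n at once.\<close>

definition flat :: "nat \<Rightarrow> real \<Rightarrow> real" where
  "flat n t = (if t > 0 then exp (- (1 / t)) / t ^ n else 0)"

text \<open>This is the difference quotient at 0. From the right, s = 1/t reduces it to s^(n+1) /
  exp s at infinity.\<close>

lemma flat_over_self_tendsto:
  "((\<lambda>t. flat n t / t) \<longlongrightarrow> 0) (at 0)"
proof -
  have "((\<lambda>s::real. s ^ Suc n / exp s) \<longlongrightarrow> 0) at_top"
    by (rule tendsto_power_div_exp_0)
  from filterlim_compose[OF this filterlim_inverse_at_top_right]
  have r: "((\<lambda>t::real. inverse t ^ Suc n / exp (inverse t)) \<longlongrightarrow> 0) (at_right 0)" .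
  have "((\<lambda>t. flat n t / t) \<longlongrightarrow> 0) (at_right 0)"
  proof (rule Lim_transform_eventually[OF r])
    show "\<forall>\<^sub>F t in at_right 0. inverse t ^ Suc n / exp (inverse t) = flat n t / t"
      using eventually_at_right_less[of 0]
      by eventually_elim (simp add: flat_def exp_minus field_simps)
  qed
  moreover have "((\<lambda>t. flat n t / t) \<longlongrightarrow> 0) (at_left 0)"
  proof (rule Lim_transform_eventually[OF tendsto_const])
    show "\<forall>\<^sub>F t in at_left 0. 0 = flat n t / t"
      unfolding eventually_at_filter by (auto simp: flat_def)
  qed
  ultimately show ?thesis by (simp add: filterlim_at_split)
qed

lemma flat_has_derivative:
  "(flat n has_derivative (\<lambda>v. flat (n + 2) t * v + flat (n + 1) t * (- real n * v))) (at t)"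
proof -
  have "(flat n has_field_derivative (flat (n + 2) t - real n * flat (n + 1) t)) (at t)"
  proof (cases t "0::real" rule: linorder_cases)
    case greater
    have "((\<lambda>t. exp (- (1 / t)) / t ^ n) has_field_derivative (flat (n + 2) t - real n * flat (n + 1) t)) (at t)"
    proof -
      let ?D = "(exp (- (1 / t)) * (1 / (t * t)) * t ^ n - exp (- (1 / t)) * (real n * t ^ (n - 1))) / (t ^ n * t ^ n)"
      have "((\<lambda>t. exp (- (1 / t)) / t ^ n) has_field_derivative ?D) (at t)"
        using greater by (auto intro!: derivative_eq_intros)
      \<comment> \<open>For n = 0 the exponent n - 1 is truncated to 0, but the factor n makes both
        sides vanish.\<close>
      moreover have "real n * t ^ (n - 1) = real n * t ^ n / t"
        using greater by (cases n) auto
      then have "?D = flat (n + 2) t - real n * flat (n + 1) t"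
        using greater by (simp only:) (simp add: flat_def field_simps)
      ultimately show ?thesis by (simp only:)
    qed
    then show ?thesis
      by (rule has_field_derivative_transform_within_open[of _ _ _ "{0<..}"])
        (use greater in \<open>auto simp: flat_def\<close>)
  next
    case less
    have "((\<lambda>t. 0) has_field_derivative (flat (n + 2) t - real n * flat (n + 1) t)) (at t)"
      using less by (simp add: flat_def)
    then show ?thesis
      by (rule has_field_derivative_transform_within_open[of _ _ _ "{..<0}"])
        (use less in \<open>auto simp: flat_def\<close>)
  next
    case equal
    then show ?thesis
      using flat_over_self_tendsto[of n] by (simp add: has_field_derivative_iff flat_def)
  qed
  then show ?thesis
    unfolding has_field_derivative_def by (rule has_derivative_eq_rhs) (simp add: fun_eq_iff algebra_simps)
qed

lemma flat_smooth: "smooth_on UNIV (flat n)"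
proof (rule smooth_onI)
  fix k
  show "Ck_on UNIV k (flat n)"
  proof (induction k arbitrary: n)
    case 0
    have "isCont (flat n) t" for t using flat_has_derivative has_derivative_continuous by blast
    then show ?case by (simp add: continuous_at_imp_continuous_on)
  next
    case (Suc k)
    show ?case
    proof (rule Ck_on_SucI[OF open_UNIV flat_has_derivative])
      show "Ck_on UNIV k (\<lambda>t. flat (n + 2) t * v + flat (n + 1) t * (- real n * v))" for v
        by (rule Ck_on_add[OF open_UNIV Ck_on_linear[OF bounded_linear_mult_left open_UNIV Suc.IH]
              Ck_on_linear[OF bounded_linear_mult_left open_UNIV Suc.IH]])
    qed
  qed
qed

text \<open>A finite sum of compact segments, one per vector of b.\<close>

lemma compact_parseval_box:
  assumes "finite (b :: 'e::real_normed_vector set)"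
  shows "compact {\<Sum>e\<in>b. t e *\<^sub>R e |t. \<forall>e\<in>b. \<bar>t e\<bar> \<le> R e}"
  using assms
proof (induction b)
  case empty
  then show ?case by simp
next
  case (insert a b)
  let ?S = "(\<lambda>t. t *\<^sub>R a) ` {- R a .. R a}" and ?T = "{\<Sum>e\<in>b. t e *\<^sub>R e |t. \<forall>e\<in>b. \<bar>t e\<bar> \<le> R e}"
  have "compact ?S"
    by (intro compact_continuous_image continuous_intros compact_Icc)
  from compact_sums[OF this insert.IH] have "compact {x + y |x y. x \<in> ?S \<and> y \<in> ?T}" .
  moreover have "{x + y |x y. x \<in> ?S \<and> y \<in> ?T}
      = {\<Sum>e\<in>insert a b. t e *\<^sub>R e |t. \<forall>e\<in>insert a b. \<bar>t e\<bar> \<le> R e}" (is "?L = ?R")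
  proof (intro equalityI subsetI)
    fix z assume "z \<in> ?L"
    then obtain s t where st: "z = s *\<^sub>R a + (\<Sum>e\<in>b. t e *\<^sub>R e)" "\<bar>s\<bar> \<le> R a" "\<forall>e\<in>b. \<bar>t e\<bar> \<le> R e"
      by (auto simp: abs_le_iff)
    have "(\<Sum>e\<in>b. (t(a := s)) e *\<^sub>R e) = (\<Sum>e\<in>b. t e *\<^sub>R e)"
      using insert.hyps by (intro sum.cong) auto
    then have "z = (\<Sum>e\<in>insert a b. (t(a := s)) e *\<^sub>R e)" "\<forall>e\<in>insert a b. \<bar>(t(a := s)) e\<bar> \<le> R e"
      using st insert.hyps by auto
    then show "z \<in> ?R" by blast
  next
    fix z assume "z \<in> ?R"
    then obtain t where t: "z = t a *\<^sub>R a + (\<Sum>e\<in>b. t e *\<^sub>R e)" "\<bar>t a\<bar> \<le> R a" "\<forall>e\<in>b. \<bar>t e\<bar> \<le> R e"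
      using insert.hyps by auto
    have "t a *\<^sub>R a \<in> ?S" using t(2) by (auto simp: abs_le_iff)
    moreover have "(\<Sum>e\<in>b. t e *\<^sub>R e) \<in> ?T" using t(3) by blast
    ultimately show "z \<in> ?L" unfolding t(1) by blast
  qed
  ultimately show ?case by simp
qed

text \<open>By Cauchy-Schwarz the coefficients of a point of the ball are bounded, so the ball is a
  closed subset of a compact box.\<close>

lemma parseval_compact_cball:
  assumes "parseval (b :: 'e::real_inner set)"
  shows "compact (cball (x::'e) r)"
proof -
  let ?B = "{\<Sum>e\<in>b. t e *\<^sub>R e |t. \<forall>e\<in>b. \<bar>t e\<bar> \<le> (norm x + r) * norm e}"
  have "cball x r \<subseteq> ?B"
  proof
    fix y assume "y \<in> cball x r"
    then have "norm y \<le> norm x + r"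
      using norm_triangle_sub[of y x] by (simp add: dist_norm norm_minus_commute)
    then have "\<bar>y \<bullet> e\<bar> \<le> (norm x + r) * norm e" for e
      by (rule order_trans[OF Cauchy_Schwarz_ineq2 mult_right_mono[OF _ norm_ge_zero]])
    moreover have "y = (\<Sum>e\<in>b. (y \<bullet> e) *\<^sub>R e)" using parseval_expand[OF assms] by simp
    ultimately show "y \<in> ?B" by blast
  qed
  then have "?B \<inter> cball x r = cball x r" by (rule Int_absorb1)
  moreover have "compact (?B \<inter> cball x r)"
    by (rule compact_Int_closed[OF compact_parseval_box[OF parseval_finite[OF assms]] closed_cball])
  ultimately show ?thesis by (simp only:)
qed

text \<open>The closed set K separates the support from the boundary of U, so extension by zero is
  smooth. On W the function is only nonzero, not 1: spans survive multiplication by it, and a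
  prescribed value at p is reached by dividing by \<open>\<rho> p\<close>.\<close>

definition is_bump ::
  "('a::topological_space, 'e::real_normed_vector) chart set \<Rightarrow> 'a set \<Rightarrow> 'a \<Rightarrow> 'a set \<Rightarrow> 'a set \<Rightarrow>
    ('a \<Rightarrow> real) \<Rightarrow> bool" where
  "is_bump A U p W K \<rho> \<longleftrightarrow> open W \<and> p \<in> W \<and> closed K \<and> K \<subseteq> U \<and>
    (\<forall>q\<in>W. \<rho> q \<noteq> 0) \<and> (\<forall>q. q \<notin> K \<longrightarrow> \<rho> q = 0) \<and>
    (\<forall>c\<in>A. smooth_on (cmap c ` cdom c) (\<lambda>u. \<rho> (cinv c u)))"

lemma is_bumpD:
  assumes "is_bump A U p W K \<rho>"
  shows "open W" "p \<in> W" "closed K" "K \<subseteq> U" "\<And>q. q \<in> W \<Longrightarrow> \<rho> q \<noteq> 0" "\<And>q. q \<notin> K \<Longrightarrow> \<rho> q = 0"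
    "\<And>c. c \<in> A \<Longrightarrow> smooth_on (cmap c ` cdom c) (\<lambda>u. \<rho> (cinv c u))"
  using assms unfolding is_bump_def by simp_all

lemma manifold_bump:
  fixes A :: "('a::{t2_space, second_countable_topology}, 'e::real_inner) chart set"
  assumes A: "smooth_manifold A" and U: "open U" "p \<in> U"
  shows "\<exists>W K \<rho>. is_bump A U p W K \<rho>"
proof -
  obtain b :: "'e set" where b: "parseval b" using smooth_manifold_parseval[OF A] .
  define c where "c = chart_at A p"
  have c: "c \<in> A" "p \<in> cdom c" unfolding c_def by (rule chart_at[OF A])+
  note ch = smooth_manifold_chart[OF A c(1)]
  define u0 where "u0 = cmap c p"
  have "open (cmap c ` (cdom c \<inter> U))" "u0 \<in> cmap c ` (cdom c \<inter> U)"
    using chart_image_open[OF ch U(1)] c(2) U(2) by (auto simp: u0_def)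
  then obtain r where r: "r > 0" "cball u0 r \<subseteq> cmap c ` (cdom c \<inter> U)"
    using open_contains_cball by blast
  define \<rho> where "\<rho> q = (if q \<in> cdom c then flat 0 (r\<^sup>2 - (cmap c q - u0) \<bullet> (cmap c q - u0)) else 0)" for q
  define W where "W = cdom c \<inter> cmap c -` ball u0 r"
  define K where "K = cinv c ` cball u0 r"
  have W: "open W" "p \<in> W"
    using chart_preimage_open[OF ch open_ball] c(2) r(1) by (auto simp: W_def u0_def)
  have "compact K"
    unfolding K_def using r(2)
    by (intro compact_continuous_image parseval_compact_cball[OF b] continuous_on_subset[OF chart_continuous(2)[OF ch]])
      blast
  \<comment> \<open>The Hausdorff property is essential here: closedness of the ball in the model
    space alone would not make its image closed in the manifold.\<close>
  then have K: "closed K" by (rule compact_imp_closed)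
  have KU: "K \<subseteq> cdom c \<inter> U"
    unfolding K_def using r(2) cinv_cmap[OF ch] by fastforce
  have inW: "q \<in> W \<longleftrightarrow> q \<in> cdom c \<and> r\<^sup>2 - (cmap c q - u0) \<bullet> (cmap c q - u0) > 0" for q
  proof -
    have "norm (cmap c q - u0) < r \<longleftrightarrow> (norm (cmap c q - u0))\<^sup>2 < r\<^sup>2"
      using r(1) by (intro iffI power_strict_mono) (auto intro: power_less_imp_less_base)
    then show ?thesis by (simp add: W_def dist_norm norm_minus_commute[of u0 "cmap c q"] power2_norm_eq_inner)
  qed
  have \<rho>W: "\<rho> q \<noteq> 0 \<longleftrightarrow> q \<in> W" for q
    unfolding inW by (simp add: \<rho>_def flat_def)
  have WK: "W \<subseteq> K"
  proof
    fix q assume q: "q \<in> W"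
    then have "q = cinv c (cmap c q)" by (simp add: W_def cinv_cmap[OF ch])
    then show "q \<in> K" using q by (auto simp: K_def W_def intro!: image_eqI[of q])
  qed
  have \<rho>0: "\<rho> q = 0" if "q \<notin> K" for q using \<rho>W[of q] WK that by blast
  have sm: "smooth_on (cmap c' ` cdom c') (\<lambda>u. \<rho> (cinv c' u))" if c': "c' \<in> A" for c'
  proof (rule smooth_on_local)
    note ch' = smooth_manifold_chart[OF A c']
    show "open (cmap c' ` cdom c')" by (rule chart_open(2)[OF ch'])
    fix v assume "v \<in> cmap c' ` cdom c'"
    then obtain q where q: "q \<in> cdom c'" "v = cmap c' q" by blast
    show "\<exists>T. open T \<and> v \<in> T \<and> smooth_on T (\<lambda>u. \<rho> (cinv c' u))"
    \<comment> \<open>Near a point of K the transition map to c is available, as K lies in the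
      domain of c; off K, which is closed, the function is zero nearby.\<close>
    proof (cases "q \<in> K")
      case True
      define T where "T = cmap c' ` (cdom c' \<inter> cdom c)"
      have oT: "open T" unfolding T_def by (rule chart_image_open[OF ch' chart_open(1)[OF ch]])
      have "smooth_on T (lrep c' c (\<lambda>x. x))"
        using lrep_smooth[OF smooth_map_ident[OF A] c' c(1)] by (simp add: T_def)
      then have 1: "smooth_on T (\<lambda>u. lrep c' c (\<lambda>x. x) u - u0)"
        by (rule smooth_on_diff[OF oT _ smooth_on_const])
      have "smooth_on T (\<lambda>u. r\<^sup>2 - (lrep c' c (\<lambda>x. x) u - u0) \<bullet> (lrep c' c (\<lambda>x. x) u - u0))"
        by (rule smooth_on_diff[OF oT smooth_on_const smooth_on_bilinear[OF bounded_bilinear_inner oT 1 1]])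
      then have "smooth_on T (\<lambda>u. flat 0 (r\<^sup>2 - (lrep c' c (\<lambda>x. x) u - u0) \<bullet> (lrep c' c (\<lambda>x. x) u - u0)))"
        by (rule smooth_on_compose[OF parseval_real oT open_UNIV subset_UNIV flat_smooth])
      then have "smooth_on T (\<lambda>u. \<rho> (cinv c' u))"
        by (rule smooth_on_cong[OF oT])
          (auto simp: T_def \<rho>_def lrep_cmap[OF ch'] cinv_cmap[OF ch'])
      moreover have "v \<in> T" using q True KU by (auto simp: T_def)
      ultimately show ?thesis using oT by blast
    next
      case False
      define T where "T = cmap c' ` (cdom c' \<inter> - K)"
      have oT: "open T" unfolding T_def using K by (intro chart_image_open[OF ch']) auto
      have "smooth_on T (\<lambda>u. \<rho> (cinv c' u))"
        by (rule smooth_on_cong[OF oT smooth_on_const[of T 0]])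
          (auto simp: T_def cinv_cmap[OF ch'] \<rho>0)
      moreover have "v \<in> T" using q False by (auto simp: T_def)
      ultimately show ?thesis using oT by blast
    qed
  qed
  have "is_bump A U p W K \<rho>"
    unfolding is_bump_def using W K KU \<rho>W \<rho>0 sm by simp
  then show ?thesis by blast
qed

text \<open>The preimages of U and of the complement of K cover the chart; the product is smooth on
  the first and zero on the second.\<close>

lemma smooth_scale_extend:
  fixes A :: "('a::{t2_space, second_countable_topology}, 'e::real_inner) chart set"
  assumes A: "smooth_manifold A" and U: "open U" and K: "closed K" "K \<subseteq> U" "\<And>q. q \<notin> K \<Longrightarrow> \<rho> q = 0"
    and \<rho>: "\<And>c. c \<in> A \<Longrightarrow> smooth_on (cmap c ` cdom c) (\<lambda>u. \<rho> (cinv c u))"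
    and c: "c \<in> A" and g: "smooth_on (cmap c ` (cdom c \<inter> U)) g"
  shows "smooth_on (cmap c ` cdom c) (\<lambda>u. \<rho> (cinv c u) *\<^sub>R g u)"
proof (rule smooth_on_local)
  note ch = smooth_manifold_chart[OF A c]
  show "open (cmap c ` cdom c)" by (rule chart_open(2)[OF ch])
  fix v assume "v \<in> cmap c ` cdom c"
  then obtain q where q: "q \<in> cdom c" "v = cmap c q" by blast
  show "\<exists>T. open T \<and> v \<in> T \<and> smooth_on T (\<lambda>u. \<rho> (cinv c u) *\<^sub>R g u)"
  proof (cases "q \<in> K")
    case True
    define T where "T = cmap c ` (cdom c \<inter> U)"
    have oT: "open T" unfolding T_def by (rule chart_image_open[OF ch U])
    have "smooth_on T (\<lambda>u. \<rho> (cinv c u))"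
      by (rule smooth_on_subset[OF _ \<rho>[OF c]]) (auto simp: T_def)
    then have "smooth_on T (\<lambda>u. \<rho> (cinv c u) *\<^sub>R g u)"
      by (rule smooth_on_bilinear[OF bounded_bilinear_scaleR oT]) (use g in \<open>simp add: T_def\<close>)
    moreover have "v \<in> T" using q True K(2) by (auto simp: T_def)
    ultimately show ?thesis using oT by blast
  next
    case False
    define T where "T = cmap c ` (cdom c \<inter> - K)"
    have oT: "open T" unfolding T_def using K by (intro chart_image_open[OF ch]) auto
    have "smooth_on T (\<lambda>u. \<rho> (cinv c u) *\<^sub>R g u)"
      by (rule smooth_on_cong[OF oT smooth_on_const[of T 0]])
        (use K in \<open>auto simp: T_def cinv_cmap[OF ch]\<close>)
    moreover have "v \<in> T" using q False by (auto simp: T_def)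
    ultimately show ?thesis using oT by blast
  qed
qed

lemma vrep_scale: "vrep A c (\<lambda>q. \<rho> q *\<^sub>R X q) = (\<lambda>u. \<rho> (cinv c u) *\<^sub>R vrep A c X u)"
  by (simp add: vrep_def blinfun.scaleR_right fun_eq_iff)

lemma crep_scale: "crep A c (\<lambda>q. \<rho> q *\<^sub>R \<alpha> q) = (\<lambda>u. \<rho> (cinv c u) *\<^sub>R crep A c \<alpha> u)"
  by (rule ext, rule blinfun_eqI) (simp add: crep_def blinfun.scaleR_left)

lemma subbundle_subspace:
  assumes "subbundle A L"
  shows "subspace (L p)"
proof -
  obtain S where "span S = L p" using assms unfolding subbundle_def by blast
  then show ?thesis by (metis subspace_span)
qed

text \<open>Turns a local frame into global sections, as \<open>compatible\<close> speaks only of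
  these. Scaling by a bump function keeps the sections in L and, where it is nonzero, does not
  change their span.\<close>

lemma global_frame:
  fixes A :: "('a::{t2_space, second_countable_topology}, 'e::real_inner) chart set"
  assumes A: "smooth_manifold A" and L: "subbundle A L"
  shows "\<exists>W (k::nat) \<sigma>. open W \<and> p \<in> W \<and> (\<forall>i<k. \<sigma> i \<in> sections A L) \<and>
    (\<forall>q\<in>W. L q = span ((\<lambda>i. at_point (\<sigma> i) q) ` {..<k}))"
proof -
  let ?frame = "\<lambda>(k::nat) p U s. open U \<and> p \<in> U \<and> (\<forall>i<k. smooth_gen_section_on A U (s i)) \<and>
    (\<forall>q\<in>U. inj_on (\<lambda>i. at_point (s i) q) {..<k} \<and> independent ((\<lambda>i. at_point (s i) q) ` {..<k}) \<and>
      span ((\<lambda>i. at_point (s i) q) ` {..<k}) = L q)"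
  obtain k where "\<forall>p. \<exists>U s. ?frame k p U s"
    using L unfolding subbundle_def by (elim exE) (rule that)
  from spec[OF this, of p] obtain U s where Us: "?frame k p U s"
    by (elim exE) (rule that)
  have U: "open U" "p \<in> U"
    using Us by simp_all
  have s: "smooth_gen_section_on A U (s i)" if "i < k" for i
    using Us that by simp
  have sp: "span ((\<lambda>i. at_point (s i) q) ` {..<k}) = L q" if "q \<in> U" for q
    using Us that by simp
  obtain W K \<rho> where "is_bump A U p W K \<rho>"
    using manifold_bump[OF A U] by blast
  note W = is_bumpD(1,2)[OF this] and K = is_bumpD(3,4)[OF this] and \<rho>W = is_bumpD(5)[OF this]
    and \<rho>K = is_bumpD(6)[OF this] and \<rho> = is_bumpD(7)[OF this]
  define \<sigma> where "\<sigma> i = ((\<lambda>q. \<rho> q *\<^sub>R fst (s i) q), (\<lambda>q. \<rho> q *\<^sub>R snd (s i) q))" for i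
  have at: "at_point (\<sigma> i) q = \<rho> q *\<^sub>R at_point (s i) q" for i q by (simp add: \<sigma>_def)
  have WK: "W \<subseteq> U" using \<rho>W \<rho>K K(2) by blast
  have sec: "\<sigma> i \<in> sections A L" if i: "i < k" for i
  proof -
    have "smooth_vfield_on A U (fst (s i))" "smooth_oneform_on A U (snd (s i))"
      using s[OF i] by (auto simp: smooth_gen_section_on_def split: prod.splits)
    then have v: "smooth_on (cmap c ` (cdom c \<inter> U)) (vrep A c (fst (s i)))"
      and a: "smooth_on (cmap c ` (cdom c \<inter> U)) (crep A c (snd (s i)))" if "c \<in> A" for c
      using that by (auto simp: smooth_vfield_on_def smooth_oneform_on_def)
    have "smooth_vfield_on A UNIV (fst (\<sigma> i))"
      unfolding smooth_vfield_on_def \<sigma>_def fst_conv Int_UNIV_right vrep_scale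
      by (intro ballI smooth_scale_extend[OF A U(1) K \<rho>K \<rho>] v)
    moreover have "smooth_oneform_on A UNIV (snd (\<sigma> i))"
      unfolding smooth_oneform_on_def \<sigma>_def snd_conv Int_UNIV_right crep_scale
      by (intro ballI smooth_scale_extend[OF A U(1) K \<rho>K \<rho>] a)
    moreover have "at_point (\<sigma> i) q \<in> L q" for q
    proof (cases "q \<in> U")
      case True
      have "at_point (s i) q \<in> L q" unfolding sp[OF True, symmetric] using i by (auto intro: span_base)
      then show ?thesis unfolding at by (rule subspace_scale[OF subbundle_subspace[OF L]])
    next
      case False
      then have "\<rho> q = 0" using K(2) \<rho>K by blast
      then show ?thesis unfolding at using subspace_0[OF subbundle_subspace[OF L]] by (simp flip: zero_prod_def)
    qed
    ultimately show ?thesis by (auto simp: sections_def smooth_gen_section_on_def split: prod.splits)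
  qed
  have span: "L q = span ((\<lambda>i. at_point (\<sigma> i) q) ` {..<k})" if q: "q \<in> W" for q
  proof (rule antisym)
    have "at_point (s i) q \<in> span ((\<lambda>i. at_point (\<sigma> i) q) ` {..<k})" if "i < k" for i
    proof -
      have "at_point (\<sigma> i) q \<in> (\<lambda>i. at_point (\<sigma> i) q) ` {..<k}" using that by blast
      then have "(1 / \<rho> q) *\<^sub>R at_point (\<sigma> i) q \<in> span ((\<lambda>i. at_point (\<sigma> i) q) ` {..<k})"
        by (intro span_scale span_base)
      then show ?thesis unfolding at using \<rho>W[OF q] by simp
    qed
    then have "(\<lambda>i. at_point (s i) q) ` {..<k} \<subseteq> span ((\<lambda>i. at_point (\<sigma> i) q) ` {..<k})"
      by blast
    then have "span ((\<lambda>i. at_point (s i) q) ` {..<k}) \<subseteq> span ((\<lambda>i. at_point (\<sigma> i) q) ` {..<k})"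
      by (rule span_minimal[OF _ subspace_span])
    then show "L q \<subseteq> span ((\<lambda>i. at_point (\<sigma> i) q) ` {..<k})"
      using sp[of q] q WK by blast
    show "span ((\<lambda>i. at_point (\<sigma> i) q) ` {..<k}) \<subseteq> L q"
      using sec by (intro span_minimal subbundle_subspace[OF L]) (auto simp: sections_def)
  qed
  show ?thesis
    by (intro exI[of _ W] exI[of _ k] exI[of _ \<sigma>] conjI ballI allI impI W sec span)
qed

text \<open>The field that is constant in the preferred chart at p, cut off by a bump function
  normalised at p. It supplies the lift of X at a single point of M.\<close>

lemma vfield_through:
  fixes A :: "('a::{t2_space, second_countable_topology}, 'e::real_inner) chart set"
  assumes A: "smooth_manifold A"
  obtains X where "smooth_vfield_on A UNIV X" "X p = v"
proof -
  obtain b :: "'e set" where b: "parseval b" using smooth_manifold_parseval[OF A] .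
  note id = smooth_map_ident[OF A]
  define c where "c = chart_at A p"
  have c: "c \<in> A" "p \<in> cdom c" unfolding c_def by (rule chart_at[OF A])+
  note ch = smooth_manifold_chart[OF A c(1)]
  define Y where "Y q = dchart_inv A c q v" for q
  have Y: "smooth_on (cmap c' ` (cdom c' \<inter> cdom c)) (vrep A c' Y)" if c': "c' \<in> A" for c'
  proof -
    note ch' = smooth_manifold_chart[OF A c']
    let ?S = "cmap c' ` (cdom c' \<inter> cdom c)" and ?T = "cmap c ` (cdom c \<inter> cdom c')"
    have oS: "open ?S" by (rule chart_image_open[OF ch' chart_open(1)[OF ch]])
    have oT: "open ?T" by (rule chart_image_open[OF ch chart_open(1)[OF ch']])
    have s1: "smooth_on ?S (lrep c' c (\<lambda>x. x))" using lrep_smooth[OF id c' c(1)] by simp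
    have s2: "smooth_on ?T (lrep c c' (\<lambda>x. x))" using lrep_smooth[OF id c(1) c'] by simp
    \<comment> \<open>In another chart c' the constant field is the Jacobian of the transition from
      c to c', taken at the c-coordinates of the point and applied to v.\<close>
    have "smooth_on ?S (\<lambda>u. fderiv (lrep c c' (\<lambda>x. x)) (lrep c' c (\<lambda>x. x) u) v)"
      by (rule smooth_on_compose[OF b oS oT _ smooth_on_fderiv_apply[OF oT s2] s1])
        (auto simp: lrep_cmap[OF ch'])
    then show ?thesis
    proof (rule smooth_on_cong[OF oS])
      fix u assume "u \<in> ?S"
      then obtain q where q: "q \<in> cdom c'" "q \<in> cdom c" "u = cmap c' q" by blast
      have "jac c c' (\<lambda>x. x) q = dchart A c' q o\<^sub>L dchart_inv A c q"
        using jac_chain[OF A A A id id c(1) chart_at(1)[OF A] c' q(2) chart_at(2)[OF A] q(1)]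
        by (simp add: dchart_jac dchart_inv_jac)
      then show "fderiv (lrep c c' (\<lambda>x. x)) (lrep c' c (\<lambda>x. x) u) v = vrep A c' Y u"
        by (simp add: q(3) lrep_cmap[OF ch' q(1)] vrep_cmap[OF ch' q(1)] Y_def jac_def)
    qed
  qed
  obtain W K \<rho> where "is_bump A (cdom c) p W K \<rho>"
    using manifold_bump[OF A chart_open(1)[OF ch] c(2)] by blast
  note W = is_bumpD(1,2)[OF this] and K = is_bumpD(3,4)[OF this] and \<rho>W = is_bumpD(5)[OF this]
    and \<rho>K = is_bumpD(6)[OF this] and \<rho> = is_bumpD(7)[OF this]
  define X where "X q = \<rho> q *\<^sub>R ((1 / \<rho> p) *\<^sub>R Y q)" for q
  have "smooth_on (cmap c' ` (cdom c' \<inter> cdom c)) (vrep A c' (\<lambda>q. (1 / \<rho> p) *\<^sub>R Y q))" if c': "c' \<in> A" for c'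
    unfolding vrep_scale
    by (rule smooth_on_linear[OF bounded_linear_scaleR_right
          chart_image_open[OF smooth_manifold_chart[OF A c'] chart_open(1)[OF ch]] Y[OF c']])
  then have "smooth_vfield_on A UNIV X"
    unfolding smooth_vfield_on_def X_def vrep_scale[of _ _ \<rho>] Int_UNIV_right
    by (intro ballI smooth_scale_extend[OF A chart_open(1)[OF ch] K \<rho>K \<rho>]) assumption+
  moreover have "X p = v"
    using \<rho>W[OF W(2)] by (simp add: X_def Y_def c_def dchart_chart_at[OF A])
  ultimately show ?thesis using that by blast
qed

lemma D_gen_smooth:
  fixes A :: "('a::{t2_space, second_countable_topology}, 'e::real_inner) chart set"
  assumes A: "smooth_manifold A" and r: "smooth_endofield A r" and X: "smooth_vfield_on A UNIV X"
  shows "smooth_vfield_on A UNIV Y \<Longrightarrow> smooth_vfield_on A UNIV (D_vec A r X Y)"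
    and "smooth_oneform_on A UNIV \<alpha> \<Longrightarrow> smooth_oneform_on A UNIV (D_dual A r X \<alpha>)"
proof -
  obtain b :: "'e set" where b: "parseval b" using smooth_manifold_parseval[OF A] .
  note ap = smooth_on_bilinear[OF bounded_bilinear_blinfun_apply]
  {
    assume Y: "smooth_vfield_on A UNIV Y"
    have "smooth_on (cmap c ` cdom c) (vrep A c (D_vec A r X Y))" if c: "c \<in> A" for c
    proof -
      let ?S = "cmap c ` cdom c"
      have S: "open ?S" by (rule chart_open(2)[OF smooth_manifold_chart[OF A c]])
      note R = smooth_endofield_erep[OF r c] and X' = smooth_vfield_on_vrep[OF X c]
        and Y' = smooth_vfield_on_vrep[OF Y c]
      note dR = smooth_on_fderiv[OF b S R] and dY = smooth_on_fderiv[OF b S Y']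
      have "smooth_on ?S (\<lambda>u. D_vec_coord (erep A c r) (vrep A c X u) (vrep A c Y) u)"
        unfolding D_vec_coord_def
        by (rule smooth_on_add[OF S smooth_on_diff[OF S ap[OF S ap[OF S dR Y'] X'] ap[OF S dY ap[OF S R X']]]
              ap[OF S R ap[OF S dY X']]])
      then show ?thesis
        by (rule smooth_on_cong[OF S]) (simp add: D_gen_local(1)[OF A r X c _ Y])
    qed
    then show "smooth_vfield_on A UNIV (D_vec A r X Y)" by (simp add: smooth_vfield_on_def)
  }
  {
    assume \<alpha>: "smooth_oneform_on A UNIV \<alpha>"
    have "smooth_on (cmap c ` cdom c) (crep A c (D_dual A r X \<alpha>))" if c: "c \<in> A" for c
    proof (rule smooth_on_blinfunI[OF b])
      let ?S = "cmap c ` cdom c"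
      show S: "open ?S" by (rule chart_open(2)[OF smooth_manifold_chart[OF A c]])
      note R = smooth_endofield_erep[OF r c] and X' = smooth_vfield_on_vrep[OF X c]
        and a = smooth_oneform_on_crep[OF \<alpha> c]
      note dR = smooth_on_fderiv[OF b S R] and da = smooth_on_fderiv[OF b S a]
      fix W :: 'e
      have k: "smooth_on ?S (\<lambda>u. W)" by (rule smooth_on_const)
      have "smooth_on ?S (\<lambda>u. D_dual_coord (erep A c r) (vrep A c X u) (crep A c \<alpha>) u W)"
        unfolding D_dual_coord_def
        by (rule smooth_on_diff[OF S smooth_on_add[OF S smooth_on_diff[OF S
                ap[OF S ap[OF S da X'] ap[OF S R k]] ap[OF S ap[OF S da ap[OF S R X']] k]]
                ap[OF S a ap[OF S ap[OF S dR X'] k]]] ap[OF S a ap[OF S ap[OF S dR k] X']]])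
      then show "smooth_on ?S (\<lambda>u. crep A c (D_dual A r X \<alpha>) u W)"
        by (rule smooth_on_cong[OF S]) (simp add: D_gen_local(2)[OF A r X c _ \<alpha>])
    qed
    then show "smooth_oneform_on A UNIV (D_dual A r X \<alpha>)" by (simp add: smooth_oneform_on_def)
  }
qed

section \<open>Descent of compatibility along forward Dirac maps\<close>

lemma sections_iff:
  "\<sigma> \<in> sections A L \<longleftrightarrow> smooth_vfield_on A UNIV (fst \<sigma>) \<and> smooth_oneform_on A UNIV (snd \<sigma>) \<and>
    (\<forall>p. (fst \<sigma> p, snd \<sigma> p) \<in> L p)"
  by (auto simp: sections_def smooth_gen_section_on_def split: prod.splits)

lemma compatible_D:
  assumes "compatible A L r"
  shows "(v, \<alpha>) \<in> L p \<Longrightarrow> (r p v, \<alpha> o\<^sub>L r p) \<in> L p"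
    and "smooth_vfield_on A UNIV X \<Longrightarrow> \<sigma> \<in> sections A L \<Longrightarrow>
      (D_vec A r X (fst \<sigma>) p, D_dual A r X (snd \<sigma>) p) \<in> L p"
proof -
  show "(r p v, \<alpha> o\<^sub>L r p) \<in> L p" if "(v, \<alpha>) \<in> L p"
    using assms that unfolding compatible_def by fast
  assume "smooth_vfield_on A UNIV X" "\<sigma> \<in> sections A L"
  then have "D_gen A r X \<sigma> \<in> sections A L"
    using assms unfolding compatible_def by blast
  then show "(D_vec A r X (fst \<sigma>) p, D_dual A r X (snd \<sigma>) p) \<in> L p"
    by (simp add: sections_iff D_gen_def split: prod.splits)
qed

lemma forward_dirac_iff:
  assumes "forward_dirac_map A L\<^sub>M B L\<^sub>N \<psi>"
  shows "(w, \<beta>) \<in> L\<^sub>N (\<psi> x) \<longleftrightarrow>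
    (\<exists>v. w = tangent_map A B \<psi> x v \<and> (v, \<beta> o\<^sub>L tangent_map A B \<psi> x) \<in> L\<^sub>M x)"
  using assms unfolding forward_dirac_map_def by auto

text \<open>The g i live in one chart and are differentiable at one point, so the combination is no
  global section and \<open>compatible\<close> does not apply to it. The element (m, \<mu>) of L is
  assembled from the terms of the Leibniz rule instead, and only its coordinates are identified with
  the operator.\<close>

lemma D_gen_combination:
  fixes A :: "('a::{t2_space, second_countable_topology}, 'e::real_inner) chart set" and k :: nat
  assumes A: "smooth_manifold A" and L: "subbundle A L" and r: "smooth_endofield A r"
    and comp: "compatible A L r" and X: "smooth_vfield_on A UNIV X"
    and \<sigma>: "\<And>i. i < k \<Longrightarrow> \<sigma> i \<in> sections A L"
    and c: "c \<in> A" "p \<in> cdom c" and g: "\<And>i. i < k \<Longrightarrow> g i differentiable (at (cmap c p))"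
  shows "\<exists>m \<mu>. (m, \<mu>) \<in> L p \<and>
    dchart A c p m = D_vec_coord (erep A c r) (vrep A c X (cmap c p))
      (\<lambda>u. \<Sum>i<k. g i u *\<^sub>R vrep A c (fst (\<sigma> i)) u) (cmap c p) \<and>
    (\<forall>W. \<mu> (dchart_inv A c p W) = D_dual_coord (erep A c r) (vrep A c X (cmap c p))
      (\<lambda>u. \<Sum>i<k. g i u *\<^sub>R crep A c (snd (\<sigma> i)) u) (cmap c p) W)"
proof -
  note ch = smooth_manifold_chart[OF A c(1)]
  define u where "u = cmap c p"
  define R where "R = erep A c r"
  define x where "x = vrep A c X u"
  have u: "u \<in> cmap c ` cdom c" using c(2) by (simp add: u_def)
  have cu: "cinv c u = p" by (simp add: u_def cinv_cmap[OF ch c(2)])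
  have Y: "smooth_vfield_on A UNIV (fst (\<sigma> i))" and a: "smooth_oneform_on A UNIV (snd (\<sigma> i))"
    and mem: "(fst (\<sigma> i) p, snd (\<sigma> i) p) \<in> L p" if "i < k" for i
    using \<sigma>[OF that] by (auto simp: sections_iff)
  define M where "M i = g i u *\<^sub>R (D_vec A r X (fst (\<sigma> i)) p, D_dual A r X (snd (\<sigma> i)) p)
      - fderiv (g i) u (R u x) *\<^sub>R (fst (\<sigma> i) p, snd (\<sigma> i) p)
      + fderiv (g i) u x *\<^sub>R (r p (fst (\<sigma> i) p), snd (\<sigma> i) p o\<^sub>L r p)" for i
  \<comment> \<open>The three summands lie in L by the second condition of compatibility, by the
    choice of \<sigma>, and by the first condition.\<close>
  have "M i \<in> L p" if i: "i < k" for i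
    unfolding M_def
    by (intro subspace_add subspace_diff subspace_scale subbundle_subspace[OF L] mem[OF i]
        compatible_D[OF comp] X \<sigma>[OF i])
  then have "(\<Sum>i<k. M i) \<in> L p" by (intro subspace_sum subbundle_subspace[OF L]) auto
  moreover have "dchart A c p (fst (\<Sum>i<k. M i)) = D_vec_coord R x (\<lambda>u. \<Sum>i<k. g i u *\<^sub>R vrep A c (fst (\<sigma> i)) u) u"
  proof -
    have "dchart A c p (fst (M i)) = g i u *\<^sub>R D_vec_coord R x (vrep A c (fst (\<sigma> i))) u
        - fderiv (g i) u (R u x) *\<^sub>R vrep A c (fst (\<sigma> i)) u
        + fderiv (g i) u x *\<^sub>R R u (vrep A c (fst (\<sigma> i)) u)" if i: "i < k" for i
    proof -
      have "dchart A c p (D_vec A r X (fst (\<sigma> i)) p) = D_vec_coord R x (vrep A c (fst (\<sigma> i))) u"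
        unfolding R_def x_def D_gen_local(1)[OF A r X c(1) u Y[OF i], symmetric]
        by (simp add: vrep_def cu)
      moreover have "dchart A c p (fst (\<sigma> i) p) = vrep A c (fst (\<sigma> i)) u"
        by (simp add: vrep_def cu)
      moreover have "dchart A c p (r p (fst (\<sigma> i) p)) = R u (vrep A c (fst (\<sigma> i)) u)"
        unfolding R_def vrep_app[OF A c(1) u, symmetric] by (simp add: vrep_def cu app_def)
      ultimately show ?thesis
        by (simp add: M_def blinfun.add_right blinfun.diff_right blinfun.scaleR_right)
    qed
    then have "dchart A c p (fst (\<Sum>i<k. M i)) = (\<Sum>i<k. g i u *\<^sub>R D_vec_coord R x (vrep A c (fst (\<sigma> i))) u
        - fderiv (g i) u (R u x) *\<^sub>R vrep A c (fst (\<sigma> i)) u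
        + fderiv (g i) u x *\<^sub>R R u (vrep A c (fst (\<sigma> i)) u))"
      by (simp add: fst_sum blinfun.sum_right)
    also have "\<dots> = D_vec_coord R x (\<lambda>u. \<Sum>i<k. g i u *\<^sub>R vrep A c (fst (\<sigma> i)) u) u"
      by (rule D_vec_coord_sum[symmetric])
        (use g smooth_on_differentiable[OF smooth_vfield_on_vrep[OF Y c(1)] u] in \<open>auto simp: u_def\<close>)
    finally show ?thesis .
  qed
  moreover have "snd (\<Sum>i<k. M i) (dchart_inv A c p W)
      = D_dual_coord R x (\<lambda>u. \<Sum>i<k. g i u *\<^sub>R crep A c (snd (\<sigma> i)) u) u W" for W
  proof -
    have "snd (M i) (dchart_inv A c p W) = g i u * D_dual_coord R x (crep A c (snd (\<sigma> i))) u W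
        - fderiv (g i) u (R u x) * crep A c (snd (\<sigma> i)) u W
        + fderiv (g i) u x * crep A c (snd (\<sigma> i)) u (R u W)" if i: "i < k" for i
    proof -
      have "D_dual A r X (snd (\<sigma> i)) p (dchart_inv A c p W) = D_dual_coord R x (crep A c (snd (\<sigma> i))) u W"
        unfolding R_def x_def D_gen_local(2)[OF A r X c(1) u a[OF i], symmetric]
        by (simp add: crep_def cu)
      moreover have "snd (\<sigma> i) p (dchart_inv A c p W) = crep A c (snd (\<sigma> i)) u W"
        by (simp add: crep_def cu)
      moreover have "snd (\<sigma> i) p (r p (dchart_inv A c p W)) = crep A c (snd (\<sigma> i)) u (R u W)"
        unfolding R_def blinfun_apply_blinfun_compose[symmetric] crep_app_dual[OF A c(1) u, symmetric]
        by (simp add: crep_def cu app_dual_def)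
      ultimately show ?thesis
        by (simp add: M_def blinfun.add_left blinfun.diff_left blinfun.scaleR_left)
    qed
    then have "snd (\<Sum>i<k. M i) (dchart_inv A c p W) = (\<Sum>i<k. g i u * D_dual_coord R x (crep A c (snd (\<sigma> i))) u W
        - fderiv (g i) u (R u x) * crep A c (snd (\<sigma> i)) u W
        + fderiv (g i) u x * crep A c (snd (\<sigma> i)) u (R u W))"
      by (simp add: snd_sum blinfun.sum_left)
    also have "\<dots> = D_dual_coord R x (\<lambda>u. \<Sum>i<k. g i u *\<^sub>R crep A c (snd (\<sigma> i)) u) u W"
      by (rule D_dual_coord_sum[symmetric])
        (use g smooth_on_differentiable[OF smooth_oneform_on_crep[OF a c(1)] u] in \<open>auto simp: u_def\<close>)
    finally show ?thesis .
  qed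
  ultimately show ?thesis
    unfolding u_def R_def x_def
    by (intro exI[of _ "fst (\<Sum>i<k. M i)"] exI[of _ "snd (\<Sum>i<k. M i)"]) simp
qed

text \<open>The forward Dirac property is used in both directions: it makes the linear system for
  the coefficients solvable at each point, and it sends the resulting element of L_M back to L_N. As
  U is an arbitrary neighbourhood of x0, such points x are dense.\<close>

lemma D_gen_generic_mem:
  fixes A :: "('a::{t2_space, second_countable_topology}, 'e::real_inner) chart set"
    and B :: "('b::{t2_space, second_countable_topology}, 'f::real_inner) chart set"
  assumes A: "smooth_manifold A" and B: "smooth_manifold B" and L: "subbundle A L\<^sub>M"
    and sub: "surjective_submersion A B \<psi>" and fwd: "forward_dirac_map A L\<^sub>M B L\<^sub>N \<psi>"
    and rM: "smooth_endofield A r\<^sub>M" and rN: "smooth_endofield B r\<^sub>N"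
    and rel: "related_by A B \<psi> r\<^sub>M r\<^sub>N" and comp: "compatible A L\<^sub>M r\<^sub>M"
    and X: "smooth_vfield_on B UNIV X" and \<tau>: "\<tau> \<in> sections B L\<^sub>N"
    and U: "open U" "x0 \<in> U"
  obtains x where "x \<in> U"
    "(D_vec B r\<^sub>N X (fst \<tau>) (\<psi> x), D_dual B r\<^sub>N X (snd \<tau>) (\<psi> x)) \<in> L\<^sub>N (\<psi> x)"
proof -
  have \<psi>: "smooth_map A B \<psi>" using sub by (simp add: surjective_submersion_def)
  obtain b :: "'e set" where b: "parseval b" using smooth_manifold_parseval[OF A] .
  let ?T = "tangent_map A B \<psi>"
  define Y where "Y = fst \<tau>"
  define \<beta> where "\<beta> = snd \<tau>"
  have Y: "smooth_vfield_on B UNIV Y" and \<beta>: "smooth_oneform_on B UNIV \<beta>"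
    and Y\<beta>: "(Y y, \<beta> y) \<in> L\<^sub>N y" for y
    using \<tau> by (auto simp: sections_iff Y_def \<beta>_def)
  obtain W and k :: nat and \<sigma> where fr: "open W \<and> x0 \<in> W \<and> (\<forall>i<k. \<sigma> i \<in> sections A L\<^sub>M) \<and>
      (\<forall>q\<in>W. L\<^sub>M q = span ((\<lambda>i. at_point (\<sigma> i) q) ` {..<k}))"
    using global_frame[OF A L, of x0] by (elim exE) (rule that)
  have W: "open W" "x0 \<in> W" using fr by simp_all
  have \<sigma>: "\<sigma> i \<in> sections A L\<^sub>M" if "i < k" for i using fr that by simp
  have sp: "L\<^sub>M q = span ((\<lambda>i. at_point (\<sigma> i) q) ` {..<k})" if "q \<in> W" for q using fr that by simp
  define c where "c = chart_at A x0"
  define d where "d = chart_at B (\<psi> x0)"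
  have c: "c \<in> A" "x0 \<in> cdom c" unfolding c_def by (rule chart_at[OF A])+
  have d: "d \<in> B" "\<psi> x0 \<in> cdom d" unfolding d_def by (rule chart_at[OF B])+
  note chc = smooth_manifold_chart[OF A c(1)] and chd = smooth_manifold_chart[OF B d(1)]
  define Q where "Q = W \<inter> U \<inter> \<psi> -` cdom d"
  have Q: "open Q" "x0 \<in> Q"
    using W U d(2) \<psi> by (auto simp: Q_def smooth_map_def intro!: open_Int open_vimage chart_open(1)[OF chd])
  define G where "G = cmap c ` (cdom c \<inter> Q)"
  have G: "open G" "cmap c x0 \<in> G"
    using chart_image_open[OF chc Q(1)] c(2) Q(2) by (auto simp: G_def)
  define f where "f = lrep c d \<psi>"
  have fG: "smooth_on G f"
    unfolding f_def by (rule smooth_on_subset[OF _ lrep_smooth[OF \<psi> c(1) d(1)]]) (auto simp: G_def Q_def)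
  have f1: "f differentiable (at u)" if "u \<in> G" for u
    by (rule smooth_on_differentiable[OF fG that])
  have f2: "fderiv f differentiable (at u)" if "u \<in> G" for u
    by (rule smooth_on_differentiable[OF smooth_on_fderiv[OF b G(1) fG] that])
  have Gc: "G \<subseteq> cmap c ` cdom c" by (auto simp: G_def)
  have fd: "f u \<in> cmap d ` cdom d" if "u \<in> G" for u
    using that by (auto simp: G_def Q_def f_def lrep_cmap[OF chc])
  define y where "y i = vrep A c (fst (\<sigma> i))" for i
  define a where "a i = crep A c (snd (\<sigma> i))" for i
  have y: "y i differentiable (at u)" and a: "a i differentiable (at u)" if "i < k" "u \<in> G" for i u
    using \<sigma>[OF that(1)] that(2) Gc c(1) unfolding y_def a_def sections_iff
    by (auto intro!: smooth_on_differentiable smooth_vfield_on_vrep smooth_oneform_on_crep)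
  define Y' where "Y' = vrep B d Y"
  define \<beta>' where "\<beta>' = crep B d \<beta>"
  have Y': "Y' differentiable (at v)" and \<beta>': "\<beta>' differentiable (at v)" if "v \<in> cmap d ` cdom d" for v
    unfolding Y'_def \<beta>'_def using that d(1) Y \<beta>
    by (auto intro!: smooth_on_differentiable smooth_vfield_on_vrep smooth_oneform_on_crep)
  \<comment> \<open>Columns and right-hand side of the system: the first component asks the lift to
    project to Y, the second asks its covector to be the pullback of \<beta>.\<close>
  define lhs where "lhs i u = (fderiv f u (y i u), riesz b (a i u))" for i u
  define rhs where "rhs u = (Y' (f u), riesz b (\<beta>' (f u) o\<^sub>L fderiv f u))" for u
  \<comment> \<open>At each point a preimage of (Y, \<beta>) in L_M exists, and its coefficients in
    the frame solve the system after passage to coordinates.\<close>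
  have sol: "\<exists>g. rhs u = (\<Sum>i<k. g i *\<^sub>R lhs i u)" if u: "u \<in> G" for u
  proof -
    obtain q where q: "q \<in> cdom c" "q \<in> W" "\<psi> q \<in> cdom d" "u = cmap c q"
      using u by (auto simp: G_def Q_def)
    obtain v where v: "Y (\<psi> q) = ?T q v" "(v, \<beta> (\<psi> q) o\<^sub>L ?T q) \<in> L\<^sub>M q"
      using Y\<beta>[of "\<psi> q"] unfolding forward_dirac_iff[OF fwd] by blast
    obtain g where g: "(v, \<beta> (\<psi> q) o\<^sub>L ?T q) = (\<Sum>i<k. g i *\<^sub>R at_point (\<sigma> i) q)"
      using v(2) unfolding sp[OF q(2)] by (rule span_image_coeff[OF finite_lessThan])
    have g1: "v = (\<Sum>i<k. g i *\<^sub>R fst (\<sigma> i) q)"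
      using arg_cong[OF g, of fst] by (simp add: fst_sum)
    have g2: "\<beta> (\<psi> q) o\<^sub>L ?T q = (\<Sum>i<k. g i *\<^sub>R snd (\<sigma> i) q)"
      using arg_cong[OF g, of snd] by (simp add: snd_sum)
    have fu: "fderiv f u = jac c d \<psi> q" by (simp add: f_def jac_def q(4))
    have "Y' (f u) = jac c d \<psi> q (dchart A c q v)"
      by (simp add: Y'_def f_def q(4) lrep_cmap[OF chc q(1)] vrep_cmap[OF chd q(3)] v(1)
          jac_dchart_apply[OF A B \<psi> c(1) q(1) d(1) q(3)])
    also have "\<dots> = (\<Sum>i<k. g i *\<^sub>R fderiv f u (y i u))"
      by (simp add: g1 y_def q(4) vrep_cmap[OF chc q(1)] fu[unfolded q(4)] blinfun.sum_right blinfun.scaleR_right)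
    finally have 1: "Y' (f u) = (\<Sum>i<k. g i *\<^sub>R fderiv f u (y i u))" .
    have "\<beta>' (f u) o\<^sub>L fderiv f u = crep A c (\<lambda>q. \<beta> (\<psi> q) o\<^sub>L ?T q) u"
      using crep_related[OF A B \<psi> c(1) q(1) d(1) q(3), of "\<lambda>q. \<beta> (\<psi> q) o\<^sub>L ?T q" \<beta>]
      by (simp add: \<beta>'_def f_def q(4) lrep_cmap[OF chc q(1)] jac_def)
    also have "\<dots> = (\<Sum>i<k. g i *\<^sub>R a i u)"
      by (rule blinfun_eqI)
        (simp add: a_def q(4) crep_cmap[OF chc q(1)] g2 blinfun.sum_left blinfun.scaleR_left
          del: blinfun_apply_blinfun_compose add: blinfun_apply_blinfun_compose[of "sum _ _"]
            blinfun_apply_blinfun_compose[of "snd _ _"])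
    finally have 2: "riesz b (\<beta>' (f u) o\<^sub>L fderiv f u) = (\<Sum>i<k. g i *\<^sub>R riesz b (a i u))"
      using bounded_linear.linear[OF bounded_linear_riesz[of b]] by (simp add: linear_sum linear_scale)
    show ?thesis
      by (intro exI[of _ g] prod_eqI) (simp_all add: rhs_def lhs_def fst_sum snd_sum 1 2)
  qed
  have lhs: "lhs i differentiable (at u)" if i: "i \<in> {..<k}" and u: "u \<in> G" for i u
  proof -
    have "((\<lambda>u. riesz b (a i u)) has_derivative (\<lambda>v. riesz b (fderiv (a i) u v))) (at u)"
      using i u by (intro bounded_linear.has_derivative[OF bounded_linear_riesz] has_derivative_fderiv a) auto
    moreover have "((\<lambda>u. fderiv f u (y i u)) has_derivative
        (\<lambda>v. fderiv f u (fderiv (y i) u v) + fderiv (fderiv f) u v (y i u))) (at u)"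
      using i u by (intro blinfun.FDERIV has_derivative_fderiv f2 y) auto
    ultimately show ?thesis
      unfolding lhs_def[abs_def] by (intro differentiableI[OF has_derivative_Pair])
  qed
  have rhs: "rhs differentiable (at u)" if u: "u \<in> G" for u
  proof -
    note f' = has_derivative_fderiv[OF f1[OF u]]
    have 1: "((\<lambda>u. Y' (f u)) has_derivative (\<lambda>v. fderiv Y' (f u) (fderiv f u v))) (at u)"
      by (rule has_derivative_compose[OF f' has_derivative_fderiv[OF Y'[OF fd[OF u]]]])
    have 2: "((\<lambda>u. \<beta>' (f u)) has_derivative (\<lambda>v. fderiv \<beta>' (f u) (fderiv f u v))) (at u)"
      by (rule has_derivative_compose[OF f' has_derivative_fderiv[OF \<beta>'[OF fd[OF u]]]])
    show ?thesis
      unfolding rhs_def[abs_def]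
      by (rule differentiableI[OF has_derivative_Pair[OF 1 bounded_linear.has_derivative[OF bounded_linear_riesz
            bounded_bilinear.FDERIV[OF bounded_bilinear_blinfun_compose 2 has_derivative_fderiv[OF f2[OF u]]]]]])
  qed
  have "G \<noteq> {}" using G(2) by blast
  then have "\<exists>u V g. open V \<and> u \<in> V \<and> V \<subseteq> G \<and> (\<forall>i\<in>{..<k}. g i differentiable (at u)) \<and>
      (\<forall>x\<in>V. rhs x = (\<Sum>i<k. g i x *\<^sub>R lhs i x))"
    by (rule generic_differentiable_coefficients[OF finite_lessThan[of k] G(1)]) (rule lhs rhs sol; assumption)+
  then obtain u V g where gen: "open V \<and> u \<in> V \<and> V \<subseteq> G \<and> (\<forall>i\<in>{..<k}. g i differentiable (at u)) \<and>
      (\<forall>x\<in>V. rhs x = (\<Sum>i<k. g i x *\<^sub>R lhs i x))"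
    by (elim exE) (rule that)
  have V: "open V" "u \<in> V" "V \<subseteq> G" using gen by simp_all
  have g: "g i differentiable (at u)" if "i < k" for i using gen that by simp
  have eq: "rhs x = (\<Sum>i<k. g i x *\<^sub>R lhs i x)" if "x \<in> V" for x using gen that by simp
  have uG: "u \<in> G" using V by blast
  then obtain x where x: "x \<in> cdom c" "x \<in> U" "\<psi> x \<in> cdom d" "u = cmap c x"
    by (auto simp: G_def Q_def)
  define ys where "ys u = (\<Sum>i<k. g i u *\<^sub>R y i u)" for u
  define as where "as u = (\<Sum>i<k. g i u *\<^sub>R a i u)" for u
  have ys: "ys differentiable (at u)"
    unfolding ys_def[abs_def] using g y[OF _ uG]
    by (intro differentiableI[OF has_derivative_sum[OF has_derivative_scaleR[OF has_derivative_fderiv has_derivative_fderiv]]]) auto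
  have as: "as differentiable (at u)"
    unfolding as_def[abs_def] using g a[OF _ uG]
    by (intro differentiableI[OF has_derivative_sum[OF has_derivative_scaleR[OF has_derivative_fderiv has_derivative_fderiv]]]) auto
  have ys_rel: "fderiv f v (ys v) = Y' (f v)" if "v \<in> V" for v
    using arg_cong[OF eq[OF that], of fst]
    by (simp add: rhs_def lhs_def ys_def fst_sum blinfun.sum_right blinfun.scaleR_right)
  have as_rel: "as v = \<beta>' (f v) o\<^sub>L fderiv f v" if "v \<in> V" for v
  proof (rule riesz_inject[OF b])
    show "riesz b (as v) = riesz b (\<beta>' (f v) o\<^sub>L fderiv f v)"
      using arg_cong[OF eq[OF that], of snd] bounded_linear.linear[OF bounded_linear_riesz[of b]]
      by (simp add: rhs_def lhs_def as_def snd_sum linear_sum linear_scale)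
  qed
  define RM where "RM = erep A c r\<^sub>M"
  define RN where "RN = erep B d r\<^sub>N"
  have R1: "RM differentiable (at u)"
    unfolding RM_def using smooth_on_differentiable[OF smooth_endofield_erep[OF rM c(1)]] uG Gc by blast
  have R2: "RN differentiable (at (f u))"
    unfolding RN_def by (rule smooth_on_differentiable[OF smooth_endofield_erep[OF rN d(1)] fd[OF uG]])
  have R3: "RN (f v) o\<^sub>L fderiv f v = fderiv f v o\<^sub>L RM v" if "v \<in> V" for v
  proof -
    obtain q where q: "q \<in> cdom c" "\<psi> q \<in> cdom d" "v = cmap c q"
      using \<open>v \<in> V\<close> V(3) by (auto simp: G_def Q_def)
    show ?thesis
      using erep_related[OF A B \<psi> c(1) q(1) d(1) q(2), of r\<^sub>N r\<^sub>M] rel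
      by (simp add: related_by_def RN_def RM_def f_def q(3) lrep_cmap[OF chc q(1)] jac_def)
  qed
  have f1V: "f differentiable (at v)" if "v \<in> V" for v using f1 V(3) that by blast
  have "surj (blinfun_apply (?T x))" using sub by (simp add: surjective_submersion_def)
  \<comment> \<open>The lifted field has to match X only at x, because both coordinate operators
    take a single vector in place of X.\<close>
  then obtain v0 where v0: "?T x v0 = X (\<psi> x)" by (metis surjD)
  obtain XM where XM: "smooth_vfield_on A UNIV XM" "XM x = v0"
    by (rule vfield_through[OF A])
  have fu: "f u = cmap d (\<psi> x)" and J: "fderiv f u = jac c d \<psi> x"
    by (simp_all add: f_def x(4) lrep_cmap[OF chc x(1)] jac_def)
  have XX: "fderiv f u (vrep A c XM u) = vrep B d X (f u)"
    unfolding J fu using vrep_related[OF A B \<psi> c(1) x(1) d(1) x(3), of XM X] v0 XM(2) by (simp add: x(4))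
  have gx: "g i differentiable (at (cmap c x))" if "i < k" for i using g[OF that] by (simp add: x(4))
  have "\<exists>m \<mu>. (m, \<mu>) \<in> L\<^sub>M x \<and> dchart A c x m = D_vec_coord RM (vrep A c XM u) ys u \<and>
      (\<forall>W. \<mu> (dchart_inv A c x W) = D_dual_coord RM (vrep A c XM u) as u W)"
    unfolding ys_def[abs_def] as_def[abs_def] y_def a_def RM_def x(4)
    by (rule D_gen_combination[OF A L rM comp XM(1) _ c(1) x(1)]) (rule \<sigma> gx; assumption)+
  then obtain m \<mu> where "(m, \<mu>) \<in> L\<^sub>M x \<and> dchart A c x m = D_vec_coord RM (vrep A c XM u) ys u \<and>
      (\<forall>W. \<mu> (dchart_inv A c x W) = D_dual_coord RM (vrep A c XM u) as u W)"
    by (elim exE) (rule that)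
  then have m: "(m, \<mu>) \<in> L\<^sub>M x" and m1: "dchart A c x m = D_vec_coord RM (vrep A c XM u) ys u"
    and m2: "\<mu> (dchart_inv A c x W) = D_dual_coord RM (vrep A c XM u) as u W" for W
    by simp_all
  have "dchart B d (\<psi> x) (?T x m) = fderiv f u (D_vec_coord RM (vrep A c XM u) ys u)"
    by (simp add: J flip: m1 jac_dchart_apply[OF A B \<psi> c(1) x(1) d(1) x(3)])
  also have "\<dots> = D_vec_coord RN (vrep B d X (f u)) Y' (f u)"
    using D_vec_coord_natural[OF V(1,2) f1V f2[OF uG] R1 R2 R3 ys Y'[OF fd[OF uG]] ys_rel, of "vrep A c XM u"]
    by (simp only: XX)
  also have "\<dots> = vrep B d (D_vec B r\<^sub>N X Y) (f u)"
    unfolding RN_def Y'_def by (rule D_gen_local(1)[OF B rN X d(1) fd[OF uG] Y, symmetric])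
  also have "\<dots> = dchart B d (\<psi> x) (D_vec B r\<^sub>N X Y (\<psi> x))"
    unfolding fu by (rule vrep_cmap[OF chd x(3)])
  finally have T1: "?T x m = D_vec B r\<^sub>N X Y (\<psi> x)"
    by (metis dchart_cancel(2)[OF B d(1) x(3)])
  \<comment> \<open>This is the covector condition in the description of L_N: \<mu> is the pullback
    of the covector whose membership is sought.\<close>
  have T2: "\<mu> = D_dual B r\<^sub>N X \<beta> (\<psi> x) o\<^sub>L ?T x"
  proof (rule blinfun_eqI)
    fix w
    define W where "W = dchart A c x w"
    have w: "w = dchart_inv A c x W" by (simp add: W_def dchart_cancel[OF A c(1) x(1)])
    have "\<mu> w = D_dual_coord RM (vrep A c XM u) as u W" unfolding w by (rule m2)
    also have "\<dots> = D_dual_coord RN (vrep B d X (f u)) \<beta>' (f u) (fderiv f u W)"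
      using D_dual_coord_natural[OF V(1,2) f1V f2[OF uG] R1 R2 R3 as \<beta>'[OF fd[OF uG]] as_rel, of "vrep A c XM u" W]
      by (simp only: XX)
    also have "\<dots> = crep B d (D_dual B r\<^sub>N X \<beta>) (f u) (fderiv f u W)"
      unfolding RN_def \<beta>'_def by (rule D_gen_local(2)[OF B rN X d(1) fd[OF uG] \<beta>, symmetric])
    also have "\<dots> = D_dual B r\<^sub>N X \<beta> (\<psi> x) (?T x w)"
      unfolding fu J w
      by (simp add: crep_cmap[OF chd x(3)] tangent_map_dchart_inv[OF A B \<psi> c(1) x(1) d(1) x(3)])
    finally show "\<mu> w = (D_dual B r\<^sub>N X \<beta> (\<psi> x) o\<^sub>L ?T x) w" by simp
  qed
  have "(D_vec B r\<^sub>N X Y (\<psi> x), D_dual B r\<^sub>N X \<beta> (\<psi> x)) \<in> L\<^sub>N (\<psi> x)"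
    unfolding forward_dirac_iff[OF fwd] using m T1 unfolding T2 by (intro exI[of _ m]) simp
  then show ?thesis using that x(2) unfolding Y_def \<beta>_def by blast
qed

text \<open>\<open>dchart\<close> and \<open>dchart_inv\<close> cancel in the pairing, so it can be
  read in one fixed chart, where it is a continuous function of the coordinates for smooth
  sections.\<close>

lemma pairing_chart:
  assumes A: "smooth_manifold A" and c: "c \<in> A" "p \<in> cdom c"
  shows "pairing (at_point \<sigma> p) (at_point \<tau> p)
    = crep A c (snd \<tau>) (cmap c p) (vrep A c (fst \<sigma>) (cmap c p))
      + crep A c (snd \<sigma>) (cmap c p) (vrep A c (fst \<tau>) (cmap c p))"
  using smooth_manifold_chart[OF A c(1)] c
  by (simp add: pairing_def crep_cmap vrep_cmap dchart_cancel[OF A c])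

lemma linear_pairing: "linear (pairing a)"
  by (rule linearI)
    (simp_all add: pairing_def blinfun.add_left blinfun.add_right blinfun.scaleR_left blinfun.scaleR_right
      algebra_simps)

theorem proposition4p4:
  fixes A :: "('a::{t2_space, second_countable_topology}, 'e::real_inner) chart set"
    and B :: "('b::{t2_space, second_countable_topology}, 'f::real_inner) chart set"
    and L\<^sub>M :: "('a, 'e) gen_distribution" and L\<^sub>N :: "('b, 'f) gen_distribution"
    and r\<^sub>M :: "('a, 'e) endofield" and r\<^sub>N :: "('b, 'f) endofield"
    and \<psi> :: "'a \<Rightarrow> 'b"
  assumes "dirac_manifold A L\<^sub>M" and "dirac_manifold B L\<^sub>N"
    and "surjective_submersion A B \<psi>"
    and "forward_dirac_map A L\<^sub>M B L\<^sub>N \<psi>"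
    and "smooth_endofield A r\<^sub>M" and "smooth_endofield B r\<^sub>N"
    and "related_by A B \<psi> r\<^sub>M r\<^sub>N"
    and "compatible A L\<^sub>M r\<^sub>M"
  shows "compatible B L\<^sub>N r\<^sub>N"
  unfolding compatible_def
proof (intro conjI allI impI)
  have A: "smooth_manifold A" and B: "smooth_manifold B" and LM: "subbundle A L\<^sub>M" and LN: "subbundle B L\<^sub>N"
    and orth: "\<And>y. L\<^sub>N y = orth (L\<^sub>N y)"
    using assms(1,2) by (auto simp: dirac_manifold_def dirac_structure_def)
  have \<psi>: "smooth_map A B \<psi>" "surj \<psi>" using assms(3) by (auto simp: surjective_submersion_def)
  let ?T = "tangent_map A B \<psi>"
  {
    fix y
    obtain x where x: "y = \<psi> x" using \<psi>(2) by (metis surjD)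
    \<comment> \<open>The first condition is pointwise: lift to L_M, apply r_M and its dual there,
      and project again using relatedness.\<close>
    have "(r\<^sub>N y w, \<beta> o\<^sub>L r\<^sub>N y) \<in> L\<^sub>N y" if w\<beta>: "(w, \<beta>) \<in> L\<^sub>N y" for w \<beta>
    proof -
      have "r\<^sub>N (\<psi> x) o\<^sub>L ?T x = ?T x o\<^sub>L r\<^sub>M x" using assms(7) by (simp add: related_by_def)
      then have rel: "r\<^sub>N (\<psi> x) (?T x v) = ?T x (r\<^sub>M x v)" for v
        by (metis blinfun_apply_blinfun_compose)
      obtain v where v: "w = ?T x v" "(v, \<beta> o\<^sub>L ?T x) \<in> L\<^sub>M x"
        using w\<beta> unfolding x forward_dirac_iff[OF assms(4)] by blast
      have "(\<beta> o\<^sub>L ?T x) o\<^sub>L r\<^sub>M x = (\<beta> o\<^sub>L r\<^sub>N (\<psi> x)) o\<^sub>L ?T x"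
        by (rule blinfun_eqI) (simp add: rel)
      then have "(r\<^sub>M x v, (\<beta> o\<^sub>L r\<^sub>N (\<psi> x)) o\<^sub>L ?T x) \<in> L\<^sub>M x"
        using compatible_D(1)[OF assms(8) v(2)] by simp
      moreover have "r\<^sub>N (\<psi> x) w = ?T x (r\<^sub>M x v)"
        by (simp add: v(1) rel)
      ultimately show ?thesis unfolding x forward_dirac_iff[OF assms(4)] by blast
    qed
    then show "(\<lambda>(v, \<alpha>). (r\<^sub>N y v, \<alpha> o\<^sub>L r\<^sub>N y)) ` L\<^sub>N y \<subseteq> L\<^sub>N y" by auto
  }
  fix X assume X: "smooth_vfield_on B UNIV X"
  show "D_gen B r\<^sub>N X ` sections B L\<^sub>N \<subseteq> sections B L\<^sub>N"
  proof
    fix D assume "D \<in> D_gen B r\<^sub>N X ` sections B L\<^sub>N"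
    then obtain \<tau> where \<tau>: "\<tau> \<in> sections B L\<^sub>N"
      and D: "D = (D_vec B r\<^sub>N X (fst \<tau>), D_dual B r\<^sub>N X (snd \<tau>))"
      by (auto simp: D_gen_def split: prod.splits)
    have smooth: "smooth_vfield_on B UNIV (fst D)" "smooth_oneform_on B UNIV (snd D)"
      using \<tau> D_gen_smooth[OF B assms(6) X] by (auto simp: D sections_iff)
    have "at_point D y \<in> L\<^sub>N y" for y
    proof -
      obtain W and k :: nat and \<sigma> where fr: "open W \<and> y \<in> W \<and> (\<forall>i<k. \<sigma> i \<in> sections B L\<^sub>N) \<and>
          (\<forall>q\<in>W. L\<^sub>N q = span ((\<lambda>i. at_point (\<sigma> i) q) ` {..<k}))"
        using global_frame[OF B LN, of y] by (elim exE) (rule that)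
      have \<sigma>: "\<sigma> i \<in> sections B L\<^sub>N" if "i < k" for i using fr that by simp
      have sp: "L\<^sub>N y = span ((\<lambda>i. at_point (\<sigma> i) y) ` {..<k})" using fr by simp
      \<comment> \<open>A nonzero pairing at y would remain nonzero on a neighbourhood. The preimage
        of that neighbourhood is open and, by surjectivity, nonempty, so it contains a generic point
        x; there the value lies in L_N and the pairing vanishes.\<close>
      have zero: "pairing (at_point D y) (at_point (\<sigma> i) y) = 0" if i: "i < k" for i
      proof (rule ccontr)
        assume ne: "pairing (at_point D y) (at_point (\<sigma> i) y) \<noteq> 0"
        define d where "d = chart_at B y"
        have d: "d \<in> B" "y \<in> cdom d" unfolding d_def by (rule chart_at[OF B])+
        note ch = smooth_manifold_chart[OF B d(1)]
        define F where "F u = crep B d (snd (\<sigma> i)) u (vrep B d (fst D) u)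
            + crep B d (snd D) u (vrep B d (fst (\<sigma> i)) u)" for u
        have F: "pairing (at_point D q) (at_point (\<sigma> i) q) = F (cmap d q)" if "q \<in> cdom d" for q
          unfolding F_def by (rule pairing_chart[OF B d(1) that])
        have "smooth_vfield_on B UNIV (fst (\<sigma> i))" "smooth_oneform_on B UNIV (snd (\<sigma> i))"
          using \<sigma>[OF i] by (auto simp: sections_iff)
        then have "continuous_on (cmap d ` cdom d) F"
          unfolding F_def[abs_def]
          by (intro continuous_on_add bounded_bilinear.continuous_on[OF bounded_bilinear_blinfun_apply]
              smooth_on_imp_continuous_on smooth_vfield_on_vrep smooth_oneform_on_crep d smooth)
        then have "open (cmap d ` cdom d \<inter> F -` (- {0}))"
          by (rule continuous_open_preimage[OF _ chart_open(2)[OF ch] open_Compl[OF closed_singleton]])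
        from chart_preimage_open[OF ch this]
        have "open (\<psi> -` (cdom d \<inter> cmap d -` (cmap d ` cdom d \<inter> F -` (- {0}))))" (is "open ?U")
          by (rule open_vimage) (use \<psi>(1) in \<open>simp add: smooth_map_def\<close>)
        moreover obtain x0 where "y = \<psi> x0" using \<psi>(2) by (metis surjD)
        then have "x0 \<in> ?U" using ne d(2) F[OF d(2)] by auto
        ultimately obtain x where x: "x \<in> ?U"
          "(D_vec B r\<^sub>N X (fst \<tau>) (\<psi> x), D_dual B r\<^sub>N X (snd \<tau>) (\<psi> x)) \<in> L\<^sub>N (\<psi> x)"
          by (rule D_gen_generic_mem[OF A B LM assms(3-8) X \<tau>])
        have "at_point (\<sigma> i) (\<psi> x) \<in> L\<^sub>N (\<psi> x)" using \<sigma>[OF i] by (simp add: sections_iff)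
        then have "pairing (at_point D (\<psi> x)) (at_point (\<sigma> i) (\<psi> x)) = 0"
          using x(2) orth[of "\<psi> x"] by (auto simp: orth_def D)
        then show False using x(1) F[of "\<psi> x"] by auto
      qed
      \<comment> \<open>The global sections span the fibre at y, so testing against them gives
        orthogonality to all of L_N at y, and L_N is its own orthogonal.\<close>
      have "pairing (at_point D y) b = 0" if "b \<in> L\<^sub>N y" for b
        by (rule linear_eq_0_on_span[OF linear_pairing _ that[unfolded sp]]) (use zero in auto)
      then have "at_point D y \<in> orth (L\<^sub>N y)" by (simp add: orth_def)
      then show ?thesis using orth by simp
    qed
    then show "D \<in> sections B L\<^sub>N" using smooth by (simp add: sections_iff)
  qed
qed

end
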